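(* The function $f:\mathcal A_n^k\to\mathrm{Av}_{n+1}^k(1324)$ is injective for all $n$ and $k$. Furthermore, $\mathrm{av}_n^k(1324)\le\mathrm{av}_{n+1}^k(1324)$ whenever $k\le 2n-7$.
   Context: $\mathrm{Av}_n^k(\tau)$ is the set of permutations $\pi=\pi_1\ldots\pi_n\in\mathfrak S_n$ that avoid the pattern $\tau$ (classical pattern avoidance) and have exactly $k$ inversions (pairs $i<j$ with $\pi_i>\pi_j$), and $\mathrm{av}_n^k(\tau)=|\mathrm{Av}_n^k(\tau)|$. Direct sum: for $\sigma\in\mathfrak S_a,\tau\in\mathfrak S_b$, $\sigma\oplus\tau\in\mathfrak S_{a+b}$ is given by $(\sigma\oplus\tau)(i)=\sigma(i)$ for $i\le a$ and $a+\tau(i-a)$ for $i>a$. A permutation is decomposable if it is a direct sum of two nonempty permutations, otherwise indecomposable. For a value $v\in[n]$, $\pi\smallsetminus v\in\mathfrak S_{n-1}$ is the permutation order-isomorphic to $\pi_1\ldots\pi_n$ with the entry of value $v$ removed. $\pi\in\mathfrak S_n$ is almost decomposable if it is indecomposable but at least one of $\pi\smallsetminus 1$, $\pi\smallsetminus n$, $\pi\smallsetminus\pi_1$, $\pi\smallsetminus\pi_n$ is decomposable. $\mathcal D_n^k$ and $\mathcal A_n^k$ are the sets of decomposable, respectively almost decomposable, permutations in $\mathrm{Av}_n^k(1324)$. The reverse-complement $\mathrm{rc}(\pi)$ of $\pi\in\mathfrak S_n$ is $\mathrm{rc}(\pi)_i=n+1-\pi_{n+1-i}$. The map $g$: every decomposable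 $1324$-avoiding permutation can be written uniquely as $\pi=\pi^{(1)}\oplus 1\oplus\dots\oplus 1\oplus\pi^{(2)}$ with $m\ge 0$ summands $1$ in the middle and $\pi^{(1)},\pi^{(2)}$ indecomposable (nonempty); $g(\pi)$ is the permutation $\pi^{(1)}\oplus 1\oplus\dots\oplus 1\oplus\pi^{(2)}$ with $m+1$ summands $1$ in the middle. The map $f:\mathcal A_n^k\to\mathrm{Av}_{n+1}^k(1324)$ is defined for $\pi\in\mathcal A_n^k$ as follows. (1) If $\pi\smallsetminus\pi_1$ is decomposable, $f(\pi)\in\mathfrak S_{n+1}$ is the permutation with $f(\pi)_1=\pi_1$ and $f(\pi)\smallsetminus\pi_1=g(\pi\smallsetminus\pi_1)$. (2) If $\pi\smallsetminus 1$ is decomposable, $f(\pi)=f(\pi^{-1})^{-1}$, where $f(\pi^{-1})$ is given by (1). (3) Otherwise, $f(\pi)=\mathrm{rc}(f(\mathrm{rc}(\pi)))$, where $f(\mathrm{rc}(\pi))$ is given by (1) or (2). (Cases (1) and (2) are mutually exclusive.) *)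

theory Defs
  imports Main "HOL-Library.Sublist" "HOL-Library.FuncSet"
    "HOL-Combinatorics.Multiset_Permutations"
begin

text \<open>
  A permutation of \<open>{1..n}\<close> is represented by its one-line notation, a list of natural numbers.
  The entries are 1-based, as usual; only the list positions used by \<open>(!)\<close> are 0-based.
\<close>

definition perms :: "nat \<Rightarrow> nat list set" where
  "perms n = permutations_of_set {1..n}"

definition is_perm :: "nat list \<Rightarrow> bool" where
  "is_perm p \<longleftrightarrow> p \<in> perms (length p)"

definition order_isomorphic :: "nat list \<Rightarrow> nat list \<Rightarrow> bool" where
  "order_isomorphic xs ys \<longleftrightarrow> length xs = length ys \<and>
     (\<forall>i < length xs. \<forall>j < length xs. xs ! i < xs ! j \<longleftrightarrow> ys ! i < ys ! j)"

text \<open>\<open>subseq\<close> is the library's scattered-subsequence relation, so this is classical containment.\<close>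

definition contains :: "nat list \<Rightarrow> nat list \<Rightarrow> bool" where
  "contains p t \<longleftrightarrow> (\<exists>s. subseq s p \<and> order_isomorphic s t)"

definition inversions :: "nat list \<Rightarrow> (nat \<times> nat) set" where
  "inversions p = {(i, j). i < j \<and> j < length p \<and> p ! i > p ! j}"

definition Av :: "nat \<Rightarrow> nat \<Rightarrow> nat list \<Rightarrow> nat list set" where
  "Av n k t = {p \<in> perms n. \<not> contains p t \<and> card (inversions p) = k}"

definition av :: "nat \<Rightarrow> nat \<Rightarrow> nat list \<Rightarrow> nat" where
  "av n k t = card (Av n k t)"

definition direct_sum :: "nat list \<Rightarrow> nat list \<Rightarrow> nat list" (infixr \<open>\<oplus>\<close> 65) where
  "s \<oplus> t = s @ map (\<lambda>x. length s + x) t"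

definition decomposable :: "nat list \<Rightarrow> bool" where
  "decomposable p \<longleftrightarrow> (\<exists>s t. is_perm s \<and> is_perm t \<and> s \<noteq> [] \<and> t \<noteq> [] \<and> p = s \<oplus> t)"

text \<open>
  For a list with distinct entries, the permutation order-isomorphic to it: each entry is
  replaced by its rank.
\<close>

definition standardize :: "nat list \<Rightarrow> nat list" where
  "standardize xs = map (\<lambda>x. card {y \<in> set xs. y \<le> x}) xs"

definition remove_value :: "nat list \<Rightarrow> nat \<Rightarrow> nat list" (infixl \<open>\<smallsetminus>\<close> 70) where
  "p \<smallsetminus> v = standardize (removeAll v p)"

definition almost_decomposable :: "nat list \<Rightarrow> bool" where
  "almost_decomposable p \<longleftrightarrow> p \<noteq> [] \<and> \<not> decomposable p \<and>
     (decomposable (p \<smallsetminus> 1) \<or> decomposable (p \<smallsetminus> length p) \<or>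
      decomposable (p \<smallsetminus> hd p) \<or> decomposable (p \<smallsetminus> last p))"

definition AD :: "nat \<Rightarrow> nat \<Rightarrow> nat list set" where
  "AD n k = {p \<in> Av n k [1, 3, 2, 4]. almost_decomposable p}"

definition reverse_complement :: "nat list \<Rightarrow> nat list" where
  "reverse_complement p = map (\<lambda>x. length p + 1 - x) (rev p)"

definition inverse_perm :: "nat list \<Rightarrow> nat list" where
  "inverse_perm p = map (\<lambda>v. Suc (THE i. i < length p \<and> p ! i = v)) [1..<Suc (length p)]"

text \<open>\<open>sandwich s m t\<close> is \<open>s \<oplus> 1 \<oplus> \<dots> \<oplus> 1 \<oplus> t\<close> with \<open>m\<close> summands \<open>1\<close>.\<close>

definition sandwich :: "nat list \<Rightarrow> nat \<Rightarrow> nat list \<Rightarrow> nat list" where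
  "sandwich s m t = s \<oplus> (((\<lambda>u. [1] \<oplus> u) ^^ m) t)"

text \<open>
  The description below is meaningful only for decomposable permutations avoiding 1324, for
  which \<open>s\<close>, \<open>m\<close>, \<open>t\<close> exist and are unique; elsewhere the value is irrelevant. Likewise for the
  maps defined after it.
\<close>

definition map_g :: "nat list \<Rightarrow> nat list" where
  "map_g p = (THE q. \<exists>s m t. is_perm s \<and> is_perm t \<and> s \<noteq> [] \<and> t \<noteq> [] \<and>
     \<not> decomposable s \<and> \<not> decomposable t \<and> p = sandwich s m t \<and> q = sandwich s (m + 1) t)"

definition f_first :: "nat list \<Rightarrow> nat list" where
  "f_first p = (THE q. q \<in> perms (length p + 1) \<and> hd q = hd p \<and> q \<smallsetminus> hd p = map_g (p \<smallsetminus> hd p))"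

definition f_first_or_one :: "nat list \<Rightarrow> nat list" where
  "f_first_or_one p =
     (if decomposable (p \<smallsetminus> hd p) then f_first p
      else inverse_perm (f_first (inverse_perm p)))"

definition map_f :: "nat list \<Rightarrow> nat list" where
  "map_f p =
     (if decomposable (p \<smallsetminus> hd p) \<or> decomposable (p \<smallsetminus> 1) then f_first_or_one p
      else reverse_complement (f_first_or_one (reverse_complement p)))"

end

theory Submission
  imports Defs
begin

text \<open>
  A permutation is studied through its set of points (position, value). Decomposability, avoidance
  of 1324 and the number of inversions are defined for finite point sets, where the exchange of coordinates (inverse) and the half turn
  (reverse-complement) preserve them; reductions are described up to \<open>order_iso\<close>.

  \<^bold>\<open>Injectivity of \<open>f\<close>.\<close> Let \<open>p\<close> be indecomposable and let removing its first entry leave \<open>a \<oplus> b\<close>,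
  with \<open>a\<close> indecomposable. Then \<open>f\<close> inserts one point \<open>w\<close> between \<open>a\<close> and \<open>b\<close>. The first point \<open>u\<close> of
  \<open>f(p)\<close> is northwest of \<open>w\<close> and every other point is southwest or northeast of \<open>w\<close>; conversely \<open>p\<close> is
  recovered up to order isomorphism by deleting \<open>w\<close> and lifting \<open>u\<close> above the next higher value. This is
  the relation \<open>expansion\<close>, and it has four consequences. The permutation \<open>f(p)\<close> avoids 1324
  (\<open>expansion_avoids1324\<close>). It has no pivot, i.e. no point comparable to all others with points on both
  sides (\<open>expansion_no_pivot\<close>). The entry 1 has a position smaller than the first entry, so an
  image in case (1) is never the inverse of another one (\<open>expansion_bottom_left\<close>). Finally, if \<open>f(p)\<close> is
  also the reverse-complement of an image, of \<open>q'\<close> say, then the points southwest of \<open>w\<close> survive in the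
  reverse-complement of \<open>q'\<close> and witness that this permutation falls under case (1) or (2), not (3)
  (\<open>expansion12_reflect\<close>). Within one case, \<open>f\<close> is injective because \<open>g\<close> is, and \<open>g\<close> is injective because the
  first component \<open>a\<close> is determined by \<open>a \<oplus> 1 \<oplus> b\<close>.

  \<^bold>\<open>Monotonicity.\<close> On decomposable permutations \<open>g\<close> is injective and preserves inversions, and its images have
  a pivot; so the images of \<open>g\<close> and \<open>f\<close> are disjoint, and it suffices that every permutation in
  \<open>Av n k\<close> is decomposable or almost decomposable. That is \<open>card_le_invs_of_indecomposable\<close>: otherwise
  there are at least \<open>2 * n - 6\<close> inversions. Let \<open>c_i\<close> count the first \<open>i\<close> points with value above \<open>i\<close>.
  A point in position \<open>x\<close> with value \<open>y\<close> has at least \<open>y - x\<close> points to its southeast, hence the sum of the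
  \<open>c_i\<close> is at most the number of inversions. All \<open>c_i\<close> with
  \<open>1 \<le> i < n\<close> are positive by indecomposability; if \<open>c_i \<ge> 2\<close> whenever \<open>2 \<le> i \<le> n - 2\<close>, this gives \<open>2 * n - 4\<close>.
  If some such \<open>c_i\<close> is 1, the permutation consists of a set \<open>L\<close> southwest of a set \<open>R\<close>, one point \<open>u\<close>
  northwest and one point \<open>v\<close> southeast of the corner between them (locale \<open>cross\<close>). Each of \<open>u\<close>, \<open>v\<close> is
  inverted with all of \<open>L\<close> but an initial part of it (in position for \<open>u\<close>, in value for \<open>v\<close>), and
  likewise with all but a final part of \<open>R\<close>. Such parts can only be large if \<open>L\<close> or \<open>R\<close> has many
  inversions itself, because the permutation and its four reductions are indecomposable.
\<close>


section \<open>Finite point sets in the plane\<close>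

text \<open>
  \<open>sw p q\<close>: \<open>p\<close> lies to the southwest of \<open>q\<close>; \<open>nw p q\<close>: \<open>p\<close> lies to the northwest of \<open>q\<close>, i.e. the two
  points form an inversion.
\<close>

definition sw :: "int \<times> int \<Rightarrow> int \<times> int \<Rightarrow> bool" where
  "sw p q \<longleftrightarrow> fst p < fst q \<and> snd p < snd q"

definition nw :: "int \<times> int \<Rightarrow> int \<times> int \<Rightarrow> bool" where
  "nw p q \<longleftrightarrow> fst p < fst q \<and> snd q < snd p"

text \<open>
  No two points share a coordinate.
\<close>

definition generic :: "(int \<times> int) set \<Rightarrow> bool" where
  "generic S \<longleftrightarrow> inj_on fst S \<and> inj_on snd S"

definition inv_pairs :: "(int \<times> int) set \<Rightarrow> ((int \<times> int) \<times> (int \<times> int)) set" where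
  "inv_pairs S = {(p, q). p \<in> S \<and> q \<in> S \<and> nw p q}"

definition invs :: "(int \<times> int) set \<Rightarrow> nat" where
  "invs S = card (inv_pairs S)"

text \<open>
  \<open>init X S\<close>: \<open>X\<close> is a nonempty part of \<open>S\<close> lying southwest of all the rest; \<open>X = S\<close> is allowed. A set that
  has such a part other than itself \<open>splits\<close>: this is decomposability.
\<close>

definition init :: "(int \<times> int) set \<Rightarrow> (int \<times> int) set \<Rightarrow> bool" where
  "init X S \<longleftrightarrow> X \<noteq> {} \<and> X \<subseteq> S \<and> (\<forall>p\<in>X. \<forall>q\<in>S - X. sw p q)"

definition splits :: "(int \<times> int) set \<Rightarrow> bool" where
  "splits S \<longleftrightarrow> (\<exists>X. init X S \<and> X \<noteq> S)"

definition avoids132 :: "(int \<times> int) set \<Rightarrow> bool" where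
  "avoids132 S \<longleftrightarrow> \<not> (\<exists>a\<in>S. \<exists>b\<in>S. \<exists>c\<in>S. sw a c \<and> sw a b \<and> nw b c)"

definition avoids1324 :: "(int \<times> int) set \<Rightarrow> bool" where
  "avoids1324 S \<longleftrightarrow>
     \<not> (\<exists>a\<in>S. \<exists>b\<in>S. \<exists>c\<in>S. \<exists>d\<in>S. sw a b \<and> sw a c \<and> nw b c \<and> sw b d \<and> sw c d)"

lemma generic_subset: "generic S \<Longrightarrow> T \<subseteq> S \<Longrightarrow> generic T"
  unfolding generic_def by (meson inj_on_subset)

lemma generic_neq:
  assumes "generic S" "p \<in> S" "q \<in> S" "p \<noteq> q"
  shows "fst p \<noteq> fst q" "snd p \<noteq> snd q"
  using assms unfolding generic_def inj_on_def by blast+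

lemma finite_inv_pairs: "finite S \<Longrightarrow> finite (inv_pairs S)"
  by (rule finite_subset[of _ "S \<times> S"]) (auto simp: inv_pairs_def)

lemma invs_mono: "finite S \<Longrightarrow> T \<subseteq> S \<Longrightarrow> invs T \<le> invs S"
  unfolding invs_def by (rule card_mono[OF finite_inv_pairs]) (auto simp: inv_pairs_def)

lemma invs_union_ge:
  assumes fin: "finite X" "finite Y" and dis: "X \<inter> Y = {}"
    and E: "E \<subseteq> {(p, q). (p \<in> X \<and> q \<in> Y \<or> p \<in> Y \<and> q \<in> X) \<and> nw p q}"
  shows "invs X + invs Y + card E \<le> invs (X \<union> Y)"
proof -
  have finE: "finite E"
    by (rule finite_subset[of _ "(X \<union> Y) \<times> (X \<union> Y)"]) (use E fin in auto)
  have "card (inv_pairs X \<union> inv_pairs Y \<union> E) = card (inv_pairs X \<union> inv_pairs Y) + card E"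
    by (rule card_Un_disjoint) (use E fin finE dis in \<open>auto simp: finite_inv_pairs\<close>, auto simp: inv_pairs_def)
  also have "card (inv_pairs X \<union> inv_pairs Y) = invs X + invs Y"
    unfolding invs_def
    by (rule card_Un_disjoint) (use fin dis in \<open>auto simp: finite_inv_pairs\<close>, auto simp: inv_pairs_def)
  finally have "invs X + invs Y + card E = card (inv_pairs X \<union> inv_pairs Y \<union> E)" by simp
  also have "\<dots> \<le> invs (X \<union> Y)"
    unfolding invs_def
    by (rule card_mono) (use E fin in \<open>auto simp: finite_inv_pairs\<close>, auto simp: inv_pairs_def)
  finally show ?thesis .
qed

section \<open>Ranks, crossings and inversions\<close>

text \<open>
  The rank of \<open>p\<close> in \<open>S\<close> with respect to the coordinate \<open>f\<close>, counted from 1.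
\<close>

definition rank :: "('a \<Rightarrow> int) \<Rightarrow> 'a set \<Rightarrow> 'a \<Rightarrow> nat" where
  "rank f S p = card {q \<in> S. f q \<le> f p}"

lemma rank_less:
  assumes "finite S" "p \<in> S" "q \<in> S" "f p < f q"
  shows "rank f S p < rank f S q"
proof -
  have "{r \<in> S. f r \<le> f p} \<subseteq> {r \<in> S. f r \<le> f q}"
    and "q \<in> {r \<in> S. f r \<le> f q} - {r \<in> S. f r \<le> f p}" using assms by auto
  then have "{r \<in> S. f r \<le> f p} \<subset> {r \<in> S. f r \<le> f q}" by blast
  then show ?thesis unfolding rank_def using assms(1) by (intro psubset_card_mono) auto
qed

lemma rank_le_iff:
  assumes "finite S" "p \<in> S" "q \<in> S"
  shows "rank f S p \<le> rank f S q \<longleftrightarrow> f p \<le> f q"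
proof
  assume "rank f S p \<le> rank f S q"
  then show "f p \<le> f q" using rank_less[of S q p f] assms by (meson leD not_le_imp_less)
next
  assume "f p \<le> f q"
  then show "rank f S p \<le> rank f S q"
    unfolding rank_def by (intro card_mono) (use assms in auto)
qed

lemma rank_bij:
  assumes "finite S" "inj_on f S"
  shows "bij_betw (rank f S) S {1..card S}"
proof -
  have inj: "inj_on (rank f S) S"
    using assms rank_le_iff[of S _ _ f] by (metis inj_on_def order_antisym order_refl)
  have sub: "rank f S ` S \<subseteq> {1..card S}"
  proof clarify
    fix p assume "p \<in> S"
    then have "{q \<in> S. f q \<le> f p} \<noteq> {}" by auto
    then show "rank f S p \<in> {1..card S}"
      using assms card_mono[of S "{q \<in> S. f q \<le> f p}"]
      by (simp add: rank_def Suc_le_eq card_gt_0_iff)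
  qed
  have "rank f S ` S = {1..card S}"
    by (rule card_subset_eq) (use sub inj in \<open>auto simp: card_image\<close>)
  then show ?thesis using inj by (simp add: bij_betw_def)
qed

lemma card_rank_le:
  assumes "finite S" "inj_on f S" "i \<le> card S"
  shows "card {p \<in> S. rank f S p \<le> i} = i"
proof -
  have b: "bij_betw (rank f S) S {1..card S}" by (rule rank_bij) fact+
  have "rank f S ` {p \<in> S. rank f S p \<le> i} = {1..i}"
  proof
    show "rank f S ` {p \<in> S. rank f S p \<le> i} \<subseteq> {1..i}"
      using b by (auto simp: bij_betw_def)
    show "{1..i} \<subseteq> rank f S ` {p \<in> S. rank f S p \<le> i}"
    proof
      fix j assume j: "j \<in> {1..i}"
      then have "j \<in> rank f S ` S" using b assms(3) by (auto simp: bij_betw_def)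
      then show "j \<in> rank f S ` {p \<in> S. rank f S p \<le> i}" using j by auto
    qed
  qed
  moreover have "inj_on (rank f S) {p \<in> S. rank f S p \<le> i}"
    using b by (auto simp: bij_betw_def inj_on_def)
  ultimately show ?thesis using card_image by fastforce
qed

lemma initial_segment_eq_rank_le:
  assumes "finite S" "inj_on f S" "C \<subseteq> S" and ini: "\<And>a b. a \<in> C \<Longrightarrow> b \<in> S \<Longrightarrow> f b < f a \<Longrightarrow> b \<in> C"
  shows "C = {p \<in> S. rank f S p \<le> card C}"
proof (rule card_subset_eq)
  have finC: "finite C" using assms finite_subset by blast
  show "finite {p \<in> S. rank f S p \<le> card C}" using assms by simp
  show "card C = card {p \<in> S. rank f S p \<le> card C}"
    using card_rank_le[OF assms(1,2), of "card C"] card_mono[OF assms(1,3)] by simp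
  show "C \<subseteq> {p \<in> S. rank f S p \<le> card C}"
  proof
    fix a assume a: "a \<in> C"
    have "{q \<in> S. f q \<le> f a} \<subseteq> C"
    proof
      fix q assume q: "q \<in> {q \<in> S. f q \<le> f a}"
      show "q \<in> C"
      proof (cases "f q = f a")
        case True
        then show ?thesis using q a assms(2,3) by (metis (no_types, lifting) inj_onD mem_Collect_eq subsetD)
      next
        case False
        then show ?thesis using q a ini by auto
      qed
    qed
    then show "a \<in> {p \<in> S. rank f S p \<le> card C}"
      using a assms(3) card_mono[OF finC] by (auto simp: rank_def)
  qed
qed

text \<open>
  The points that are among the \<open>i\<close> leftmost, but not among the \<open>i\<close> lowest ones.
\<close>

definition crossing :: "(int \<times> int) set \<Rightarrow> nat \<Rightarrow> (int \<times> int) set" where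
  "crossing S i = {p \<in> S. rank fst S p \<le> i \<and> i < rank snd S p}"

text \<open>
  A point \<open>p\<close> crosses at \<open>rank snd S p - rank fst S p\<close> indices (if this is positive), and at least
  that many points lie to its southeast.
\<close>

lemma sum_crossing_le_invs:
  assumes fin: "finite S" and gen: "generic S" and I: "finite I"
  shows "(\<Sum>i\<in>I. card (crossing S i)) \<le> invs S"
proof -
  have "(\<Sum>i\<in>I. card (crossing S i)) = (\<Sum>i\<in>I. \<Sum>p\<in>S. of_bool (rank fst S p \<le> i \<and> i < rank snd S p))"
    using fin by (simp add: crossing_def Int_def)
  also have "\<dots> = (\<Sum>p\<in>S. \<Sum>i\<in>I. of_bool (rank fst S p \<le> i \<and> i < rank snd S p))"
    by (rule sum.swap)
  also have "\<dots> = (\<Sum>p\<in>S. card {i \<in> I. rank fst S p \<le> i \<and> i < rank snd S p})"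
    using I by (simp add: Int_def)
  also have "\<dots> \<le> (\<Sum>p\<in>S. card {q \<in> S. nw p q})"
  proof (rule sum_mono)
    fix p assume p: "p \<in> S"
    have "card {i \<in> I. rank fst S p \<le> i \<and> i < rank snd S p} \<le> card {rank fst S p..<rank snd S p}"
      by (rule card_mono) auto
    also have "\<dots> = rank snd S p - rank fst S p" by simp
    also have "\<dots> \<le> card ({q \<in> S. snd q \<le> snd p} - {q \<in> S. fst q \<le> fst p})"
      unfolding rank_def by (rule diff_card_le_card_Diff) (use fin in simp)
    also have "\<dots> \<le> card {q \<in> S. nw p q}"
    proof (rule card_mono)
      show "finite {q \<in> S. nw p q}" using fin by simp
      show "{q \<in> S. snd q \<le> snd p} - {q \<in> S. fst q \<le> fst p} \<subseteq> {q \<in> S. nw p q}"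
        using generic_neq(2)[OF gen p] by (force simp: nw_def)
    qed
    finally show "card {i \<in> I. rank fst S p \<le> i \<and> i < rank snd S p} \<le> card {q \<in> S. nw p q}" .
  qed
  also have "\<dots> = card (SIGMA p:S. {q \<in> S. nw p q})"
    using fin by simp
  also have "(SIGMA p:S. {q \<in> S. nw p q}) = inv_pairs S"
    by (auto simp: inv_pairs_def)
  finally show ?thesis by (simp add: invs_def)
qed

lemma crossing_empty_init:
  assumes fin: "finite S" and gen: "generic S" and i: "1 \<le> i" "i \<le> card S"
    and e: "crossing S i = {}"
  shows "init {p \<in> S. rank fst S p \<le> i} S"
    and "{p \<in> S. rank fst S p \<le> i} = {p \<in> S. rank snd S p \<le> i}"
proof -
  let ?X = "{p \<in> S. rank fst S p \<le> i}" and ?Y = "{p \<in> S. rank snd S p \<le> i}"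
  have inj: "inj_on fst S" "inj_on snd S" using gen by (auto simp: generic_def)
  have cX: "card ?X = i" and cY: "card ?Y = i" using card_rank_le[OF fin] inj i by auto
  have "?X \<subseteq> ?Y" using e by (force simp: crossing_def)
  then show eq: "?X = ?Y" using cX cY fin by (intro card_subset_eq) auto
  have "?X \<noteq> {}" using cX i by (metis card.empty not_one_le_zero)
  moreover have "sw p q" if "p \<in> ?X" "q \<in> S - ?X" for p q
  proof -
    have "rank fst S p < rank fst S q" using that by auto
    moreover have "rank snd S p < rank snd S q"
      using that eq by (metis (no_types, lifting) DiffE le_less_trans mem_Collect_eq not_le_imp_less)
    ultimately show ?thesis using rank_le_iff[OF fin, of q p fst] rank_le_iff[OF fin, of q p snd] that
      by (auto simp: sw_def)
  qed
  ultimately show "init ?X S" by (auto simp: init_def)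
qed

text \<open>
  If \<open>C\<close> and \<open>D\<close> are the \<open>card C\<close> leftmost and the \<open>card D\<close> lowest points of \<open>L\<close>, then an empty crossing
  at an index up to the smaller cardinality would be an initial part contained in both.
\<close>

lemma no_init_invs_ge_min:
  assumes fin: "finite L" and gen: "generic L" and CL: "C \<subseteq> L" and DL: "D \<subseteq> L"
    and iniC: "\<And>a b. a \<in> C \<Longrightarrow> b \<in> L \<Longrightarrow> fst b < fst a \<Longrightarrow> b \<in> C"
    and iniD: "\<And>a b. a \<in> D \<Longrightarrow> b \<in> L \<Longrightarrow> snd b < snd a \<Longrightarrow> b \<in> D"
    and no: "\<And>Z. init Z L \<Longrightarrow> \<not> Z \<subseteq> C \<inter> D"
  shows "min (card C) (card D) \<le> invs L"
proof -
  let ?m = "min (card C) (card D)"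
  have inj: "inj_on fst L" "inj_on snd L" using gen by (auto simp: generic_def)
  have C: "C = {p \<in> L. rank fst L p \<le> card C}"
    by (rule initial_segment_eq_rank_le) (use assms inj in auto)
  have D: "D = {p \<in> L. rank snd L p \<le> card D}"
    by (rule initial_segment_eq_rank_le) (use assms inj in auto)
  have "1 \<le> card (crossing L i)" if i: "i \<in> {1..?m}" for i
  proof (rule ccontr)
    assume "\<not> 1 \<le> card (crossing L i)"
    then have e: "crossing L i = {}"
      using fin by (auto simp: not_le crossing_def)
    have i': "1 \<le> i" "i \<le> card L" using i card_mono[OF fin CL] by auto
    note ce = crossing_empty_init[OF fin gen i' e]
    have "{p \<in> L. rank fst L p \<le> i} \<subseteq> C" using C i by force
    moreover have "{p \<in> L. rank fst L p \<le> i} \<subseteq> D" unfolding ce(2) using D i by force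
    ultimately show False using no[OF ce(1)] by blast
  qed
  then have "(\<Sum>i\<in>{1..?m}. 1) \<le> (\<Sum>i\<in>{1..?m}. card (crossing L i))"
    by (intro sum_mono) auto
  also have "\<dots> \<le> invs L" by (rule sum_crossing_le_invs) (use fin gen in auto)
  finally show ?thesis by simp
qed

section \<open>Symmetries\<close>

text \<open>
  The half turn about the point \<open>(N/2, N/2)\<close>; \<open>N = n + 1\<close> gives the reverse-complement of a permutation of
  length \<open>n\<close>.
\<close>

definition reflect :: "int \<Rightarrow> int \<times> int \<Rightarrow> int \<times> int" where
  "reflect N p = (N - fst p, N - snd p)"

lemma reflect_simps [simp]: "fst (reflect N p) = N - fst p" "snd (reflect N p) = N - snd p"
  "reflect N (reflect N p) = p"
  by (simp_all add: reflect_def)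

lemma reflect_image_image [simp]: "reflect N ` reflect N ` S = S"
  by (simp add: image_image)

lemma swap_image_image [simp]: "prod.swap ` prod.swap ` S = S"
  by (simp add: image_image)

lemma inj_reflect: "inj (reflect N)"
  by (metis injI reflect_simps(3))

lemma inj_on_reflect [simp]: "inj_on (reflect N) S"
  using inj_reflect inj_on_subset by blast

lemma inj_on_swap [simp]: "inj_on prod.swap S"
  by (simp add: inj_on_def prod_eq_iff)

lemma sw_reflect [simp]: "sw (reflect N p) (reflect N q) \<longleftrightarrow> sw q p"
  and nw_reflect [simp]: "nw (reflect N p) (reflect N q) \<longleftrightarrow> nw q p"
  and sw_swap [simp]: "sw (prod.swap p) (prod.swap q) \<longleftrightarrow> sw p q"
  and nw_swap [simp]: "nw (prod.swap p) (prod.swap q) \<longleftrightarrow> nw q p"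
  by (auto simp: sw_def nw_def)

lemma generic_swap [simp]: "generic (prod.swap ` S) \<longleftrightarrow> generic S"
  and generic_reflect [simp]: "generic (reflect N ` S) \<longleftrightarrow> generic S"
  by (auto simp: generic_def inj_on_def prod_eq_iff)

lemma init_swap:
  assumes "init X S" shows "init (prod.swap ` X) (prod.swap ` S)"
proof -
  have "prod.swap ` S - prod.swap ` X = prod.swap ` (S - X)"
    by (simp add: image_set_diff)
  then show ?thesis using assms by (auto simp: init_def simp del: image_diff_subset)
qed

lemma init_reflect:
  assumes "init X S" "X \<noteq> S" shows "init (reflect N ` (S - X)) (reflect N ` S)"
proof -
  have "reflect N ` S - reflect N ` (S - X) = reflect N ` X"
    using assms by (auto simp: init_def image_set_diff[OF inj_reflect, symmetric])
  then show ?thesis using assms by (auto simp: init_def)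
qed

lemma splits_swap [simp]: "splits (prod.swap ` S) \<longleftrightarrow> splits S"
proof -
  have "splits (prod.swap ` S)" if "splits S" for S
    using that init_swap unfolding splits_def by (metis swap_image_image)
  from this[of S] this[of "prod.swap ` S"] show ?thesis by auto
qed

lemma splits_reflect [simp]: "splits (reflect N ` S) \<longleftrightarrow> splits S"
proof -
  have "splits (reflect N ` S)" if sp: "splits S" for S
  proof -
    obtain X where X: "init X S" "X \<noteq> S" using sp by (auto simp: splits_def)
    have "reflect N ` (S - X) \<noteq> reflect N ` S"
    proof
      assume "reflect N ` (S - X) = reflect N ` S"
      then have "S - X = S" by (metis reflect_image_image)
      then show False using X by (auto simp: init_def)
    qed
    then show ?thesis using init_reflect[OF X, of N] unfolding splits_def by blast
  qed
  from this[of S] this[of "reflect N ` S"] show ?thesis by auto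
qed

lemma invs_image_anti:
  assumes "inj_on f S" and "\<And>p q. p \<in> S \<Longrightarrow> q \<in> S \<Longrightarrow> nw (f q) (f p) \<longleftrightarrow> nw p q"
  shows "invs (f ` S) = invs S"
proof -
  have "inv_pairs (f ` S) = (\<lambda>(p, q). (f q, f p)) ` inv_pairs S"
    using assms(2) by (auto simp: inv_pairs_def image_def) blast
  moreover have "inj_on (\<lambda>(p, q). (f q, f p)) (inv_pairs S)"
    using assms(1) by (auto simp: inj_on_def inv_pairs_def)
  ultimately show ?thesis by (simp add: invs_def card_image)
qed

lemma invs_swap [simp]: "invs (prod.swap ` S) = invs S"
  and invs_reflect [simp]: "invs (reflect N ` S) = invs S"
  by (rule invs_image_anti; simp)+

lemma avoids1324_swap [simp]: "avoids1324 (prod.swap ` S) \<longleftrightarrow> avoids1324 S"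
  unfolding avoids1324_def by simp blast

lemma avoids1324_reflect [simp]: "avoids1324 (reflect N ` S) \<longleftrightarrow> avoids1324 S"
  unfolding avoids1324_def by simp blast

section \<open>Permutations with few inversions\<close>

lemma init_self: "S \<noteq> {} \<Longrightarrow> init S S"
  by (simp add: init_def)

lemma mult_ge_add: "1 \<le> a \<Longrightarrow> 1 \<le> b \<Longrightarrow> a + b \<le> a * b + (1::nat)"
  by (cases a; cases b) auto

lemma double_mult_ge_add: "1 \<le> a \<Longrightarrow> 2 \<le> b \<Longrightarrow> 2 * a + b \<le> a * b + (2::nat)"
proof -
  assume "1 \<le> a" "2 \<le> b"
  then obtain c d where "a = c + 1" "b = d + 2" by (metis add.commute le_Suc_ex)
  then show ?thesis by (simp add: algebra_simps)
qed

lemma avoids132_subset: "avoids132 S \<Longrightarrow> T \<subseteq> S \<Longrightarrow> avoids132 T"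
  unfolding avoids132_def by (meson subsetD)

text \<open>
  In a set avoiding 132, everything to the left of the top point \<open>M\<close> is above everything to its right.
\<close>

lemma top_split:
  fixes L :: "(int \<times> int) set" and M :: "int \<times> int"
  defines "X \<equiv> {p \<in> L. fst p < fst M}" and "Y \<equiv> {p \<in> L. fst M < fst p}"
  assumes fin: "finite L" and gen: "generic L" and av: "avoids132 L"
    and M: "M \<in> L" and top: "\<forall>p\<in>L. snd p \<le> snd M"
  shows "L = insert M X \<union> Y" "M \<notin> X" "M \<notin> Y" "X \<inter> Y = {}" "\<And>a. a \<in> X \<Longrightarrow> sw a M"
    "\<And>b. b \<in> Y \<Longrightarrow> nw M b" "\<And>a b. a \<in> X \<Longrightarrow> b \<in> Y \<Longrightarrow> nw a b"
    "invs (insert M X) + invs Y + card Y * (card X + 1) \<le> invs L"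
proof -
  note neqM = generic_neq[OF gen _ M]
  show L: "L = insert M X \<union> Y"
    using M neqM(1) by (force simp: X_def Y_def)
  show MX: "M \<notin> X" and MY: "M \<notin> Y" and XY: "X \<inter> Y = {}" by (auto simp: X_def Y_def)
  show aM: "sw a M" if "a \<in> X" for a
    using that bspec[OF top, of a] neqM(2)[of a] MX by (force simp: X_def sw_def)
  show Mb: "nw M b" if "b \<in> Y" for b
    using that bspec[OF top, of b] neqM(2)[of b] MY by (force simp: Y_def nw_def)
  show ab: "nw a b" if "a \<in> X" "b \<in> Y" for a b
  proof -
    have "a \<in> L" "b \<in> L" "a \<noteq> b" using that XY by (auto simp: X_def Y_def)
    moreover have "fst a < fst b" using that by (auto simp: X_def Y_def)
    moreover have "\<not> sw a b"
      using av M aM[OF that(1)] Mb[OF that(2)] calculation unfolding avoids132_def by blast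
    ultimately show ?thesis using generic_neq(2)[OF gen, of a b] by (force simp: sw_def nw_def)
  qed
  have fX: "finite X" "finite Y" using fin by (auto simp: X_def Y_def)
  have "invs (insert M X) + invs Y + card (insert M X \<times> Y) \<le> invs (insert M X \<union> Y)"
    by (rule invs_union_ge) (use fX XY MY ab Mb in auto)
  then show "invs (insert M X) + invs Y + card Y * (card X + 1) \<le> invs L"
    using fX MX L by (simp add: card_cartesian_product mult.commute)
qed

text \<open>
  The case of a cross in which \<open>u\<close> is the top and \<open>v\<close> the rightmost point. The hypotheses on \<open>Z\<close> express
  that removing \<open>v\<close>, \<open>u\<close>, the leftmost point, or the lowest point does not make the cross decomposable. The
  proof splits \<open>L\<close> at its top point. If nothing is to the right of \<open>M\<close>, then \<open>C\<close> and \<open>D\<close> live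
  in the part \<open>X\<close> left of \<open>M\<close>, and induction applies; otherwise the inversions
  between \<open>insert M X\<close> and the part \<open>Y\<close> right of \<open>M\<close> suffice, except when \<open>X\<close> is empty or \<open>Y\<close> is a singleton:
  then \<open>M\<close> is leftmost, respectively the point of \<open>Y\<close> is lowest, and it is removed first.
\<close>

lemma invs_ge_two_initial_sets:
  assumes "finite L" "generic L" "avoids132 L" "C \<subseteq> L" "D \<subseteq> L"
    and "\<And>a b. a \<in> C \<Longrightarrow> b \<in> L \<Longrightarrow> fst b < fst a \<Longrightarrow> b \<in> C"
    and "\<And>a b. a \<in> D \<Longrightarrow> b \<in> L \<Longrightarrow> snd b < snd a \<Longrightarrow> b \<in> D"
    and "C \<inter> D \<noteq> {}"
    and "\<And>Z. init Z L \<Longrightarrow> \<not> Z \<subseteq> C" "\<And>Z. init Z L \<Longrightarrow> \<not> Z \<subseteq> D"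
    and "\<And>l Z. l \<in> L \<Longrightarrow> \<forall>p\<in>L. fst l \<le> fst p \<Longrightarrow> init Z (L - {l}) \<Longrightarrow> \<not> Z \<subseteq> C \<inter> D"
    and "\<And>l Z. l \<in> L \<Longrightarrow> \<forall>p\<in>L. snd l \<le> snd p \<Longrightarrow> init Z (L - {l}) \<Longrightarrow> \<not> Z \<subseteq> C \<inter> D"
  shows "card C + card D \<le> invs L + 2"
  using assms
proof (induction "card L" arbitrary: L rule: less_induct)
  case less
  note fin = less.prems(1) and gen = less.prems(2) and av = less.prems(3)
    and CL = less.prems(4) and DL = less.prems(5) and iniC = less.prems(6) and iniD = less.prems(7)
    and CD = less.prems(8) and noC = less.prems(9) and noD = less.prems(10)
    and left = less.prems(11) and bot = less.prems(12)
  have Lne: "L \<noteq> {}" using CD CL by auto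
  have finC: "finite C" and finD: "finite D" using CL DL fin finite_subset by blast+
  have CneL: "\<not> L \<subseteq> C" and DneL: "\<not> L \<subseteq> D" using noC noD init_self[OF Lne] by blast+
  have "Max (snd ` L) \<in> snd ` L" using fin Lne by simp
  then obtain M where M: "M \<in> L" "snd M = Max (snd ` L)" by auto
  then have top: "\<forall>p\<in>L. snd p \<le> snd M" using fin by simp
  define X where "X = {p \<in> L. fst p < fst M}"
  define Y where "Y = {p \<in> L. fst M < fst p}"
  note spl = top_split[OF fin gen av M(1) top, folded X_def Y_def]
  have MD: "M \<notin> D"
  proof
    assume "M \<in> D"
    moreover have "snd p < snd M" if "p \<in> L" "p \<noteq> M" for p
      using bspec[OF top that(1)] generic_neq(2)[OF gen that(1) M(1) that(2)] by simp
    ultimately have "L \<subseteq> D" using iniD by blast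
    then show False using DneL by blast
  qed
  have finX: "finite X" and finY: "finite Y" using fin by (auto simp: X_def Y_def)
  have X_or: "C \<subseteq> X \<or> insert M X \<subseteq> C"
  proof (cases "C \<subseteq> X")
    case False
    then obtain a where a: "a \<in> C" "a \<notin> X" by auto
    then have "a \<in> insert M Y" using CL spl(1) by auto
    then have "M \<in> C" using iniC[OF a(1) M(1)] a by (auto simp: Y_def)
    then show ?thesis using iniC[of M] by (auto simp: X_def)
  qed simp
  have Y_or: "D \<subseteq> Y \<or> Y \<subseteq> D"
  proof (cases "D \<subseteq> Y")
    case False
    then obtain a where a: "a \<in> D" "a \<notin> Y" by auto
    then have "a \<in> insert M X" using DL spl(1) by auto
    then have "snd b < snd a" if "b \<in> Y" for b
      using spl(6)[OF that] spl(7)[OF _ that, of a] \<open>a \<in> insert M X\<close> by (auto simp: nw_def)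
    then show ?thesis using iniD[OF a(1)] by (auto simp: Y_def)
  qed simp
  show ?case
  proof (cases "Y = {}")
    case True
    then have LX: "L = insert M X" using spl(1) by simp
    show ?thesis
    proof (cases "X = {}")
      case True
      then show ?thesis using LX CD CL DL MD by auto
    next
      case False
      have initX: "init X L" using False spl(2,5) by (auto simp: LX init_def)
      have CX: "C \<subseteq> X" using X_or noC[OF initX] by auto
      have DX: "D \<subseteq> X" using MD DL LX by auto
      have up: "init Z X \<Longrightarrow> init Z L" for Z
        using spl(2,5) by (auto simp: LX init_def)
      have up': "init Z (X - {l}) \<Longrightarrow> init Z (L - {l})" if "l \<in> X" for l Z
        using spl(2,5) that by (auto simp: LX init_def)
      have "card C + card D \<le> invs X + 2"
      proof (rule less.hyps)
        show "card X < card L" using spl(2) finX by (simp add: LX)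
        show "generic X" using gen LX generic_subset by blast
        show "avoids132 X" using av LX avoids132_subset by blast
        show "\<not> Z \<subseteq> C \<inter> D" if "l \<in> X" "\<forall>p\<in>X. fst l \<le> fst p" "init Z (X - {l})" for l Z
        proof -
          have "\<forall>p\<in>L. fst l \<le> fst p" using that(2) spl(5)[OF that(1)] LX by (auto simp: sw_def)
          then show ?thesis using left[OF _ _ up'[OF that(1,3)]] that(1) LX by simp
        qed
        show "\<not> Z \<subseteq> C \<inter> D" if "l \<in> X" "\<forall>p\<in>X. snd l \<le> snd p" "init Z (X - {l})" for l Z
        proof -
          have "\<forall>p\<in>L. snd l \<le> snd p" using that(2) spl(5)[OF that(1)] LX by (auto simp: sw_def)
          then show ?thesis using bot[OF _ _ up'[OF that(1,3)]] that(1) LX by simp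
        qed
        show "finite X" "C \<subseteq> X" "D \<subseteq> X" "C \<inter> D \<noteq> {}" by fact+
        show "b \<in> C" if "a \<in> C" "b \<in> X" "fst b < fst a" for a b
          using iniC that LX by blast
        show "b \<in> D" if "a \<in> D" "b \<in> X" "snd b < snd a" for a b
          using iniD that LX by blast
        show "\<not> Z \<subseteq> C" "\<not> Z \<subseteq> D" if "init Z X" for Z
          using noC noD up that by blast+
      qed
      also have "invs X \<le> invs L" by (rule invs_mono) (use fin LX in auto)
      finally show ?thesis by simp
    qed
  next
    case Yne: False
    define x y where "x = card X" and "y = card Y"
    have y1: "1 \<le> y" using Yne finY by (simp add: y_def Suc_le_eq card_gt_0_iff)
    have inv: "invs (insert M X) + invs Y + (y * x + y) \<le> invs L"
      using spl(8) by (simp add: x_def y_def)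
    have cardL: "card L = x + 1 + y"
      using spl(1-4) finX finY by (simp add: card_Un_disjoint x_def y_def)
    have cL: "card C < card L" using CL CneL fin by (intro psubset_card_mono) auto
    show ?thesis
    proof (cases "X = {}")
      case True
      then have L: "L = insert M Y" using spl(1) by simp
      have MY: "fst M < fst b" if "b \<in> Y" for b using that by (simp add: Y_def)
      have lM: "\<forall>p\<in>L. fst M \<le> fst p" using L MY by (fastforce dest: less_imp_le)
      have LM: "L - {M} = Y" using L spl(3) by auto
      obtain c where c: "c \<in> C" using CD by auto
      then have "c = M \<or> fst M < fst c" using CL L MY by blast
      then have MC: "M \<in> C" using c iniC[OF c M(1)] by auto
      have DY: "D \<subseteq> Y" using MD DL L by auto
      have "min (card (C - {M})) (card D) \<le> invs Y"
      proof (rule no_init_invs_ge_min[OF finY])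
        show "generic Y" using gen L generic_subset by blast
        show "\<not> Z \<subseteq> (C - {M}) \<inter> D" if "init Z Y" for Z
          using left[OF M(1) lM] that LM by auto
        show "C - {M} \<subseteq> Y" using CL L by auto
        show "b \<in> C - {M}" if "a \<in> C - {M}" "b \<in> Y" "fst b < fst a" for a b
          using iniC[of a b] that L spl(3) by auto
      qed (use DY iniD L in auto)
      moreover have "card (C - {M}) + 1 = card C"
        using card_Suc_Diff1[OF finC MC] by simp
      moreover have "card C \<le> y" using cL cardL True by (simp add: x_def)
      moreover have "card D \<le> y" using DY finY by (simp add: card_mono y_def)
      ultimately show ?thesis using inv by linarith
    next
      case Xne: False
      then have x1: "1 \<le> x" using finX by (simp add: x_def Suc_le_eq card_gt_0_iff)
      define c0 c1 d0 d1 where "c0 = card (C - Y)" and "c1 = card (C \<inter> Y)"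
        and "d0 = card (D - Y)" and "d1 = card (D \<inter> Y)"
      have c: "card C = c0 + c1"
        unfolding c0_def c1_def using finC
        by (metis Int_Diff_disjoint Un_Diff_Int card_Un_disjoint finite_Diff finite_Int inf_commute)
      have d: "card D = d0 + d1"
        unfolding d0_def d1_def using finD
        by (metis Int_Diff_disjoint Un_Diff_Int card_Un_disjoint finite_Diff finite_Int inf_commute)
      have "C - Y \<subseteq> insert M X" using CL spl(1) by auto
      then have c0: "c0 \<le> x + 1"
        unfolding c0_def x_def using spl(2) finX card_mono[of "insert M X" "C - Y"] by simp
      have "D - Y \<subseteq> X" using DL MD spl(1) by auto
      then have d0: "d0 \<le> x" unfolding d0_def x_def using finX by (simp add: card_mono)
      have d1: "d1 \<le> y" unfolding d1_def y_def using finY by (simp add: card_mono)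
      have c1: "c1 \<le> y - 1"
      proof (cases "C \<subseteq> X")
        case True
        then have "C \<inter> Y = {}" using spl(4) by blast
        then show ?thesis by (simp add: c1_def)
      next
        case False
        then have "\<not> Y \<subseteq> C" using X_or CneL spl(1) by auto
        then have "c1 < y" unfolding c1_def y_def using finY by (intro psubset_card_mono) auto
        then show ?thesis by simp
      qed
      have one: "min c0 d0 \<le> invs (insert M X)" if y: "y = 1"
      proof -
        obtain b where b: "Y = {b}" using y by (auto simp: y_def card_1_singleton_iff)
        have bL: "b \<in> L" "\<forall>p\<in>L. snd b \<le> snd p" "L - {b} = insert M X"
          using spl b by (auto simp: nw_def less_imp_le)
        show ?thesis unfolding c0_def d0_def
        proof (rule no_init_invs_ge_min)
          show "generic (insert M X)" using gen spl(1) generic_subset by blast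
          show "\<not> Z \<subseteq> (C - Y) \<inter> (D - Y)" if "init Z (insert M X)" for Z
            using bot[OF bL(1,2)] bL(3) that by auto
          show "b' \<in> C - Y" if "a \<in> C - Y" "b' \<in> insert M X" "fst b' < fst a" for a b'
            using iniC[of a b'] that spl(1,3,4) by auto
          show "b' \<in> D - Y" if "a \<in> D - Y" "b' \<in> insert M X" "snd b' < snd a" for a b'
            using iniD[of a b'] that spl(1,3,4) by auto
          show "C - Y \<subseteq> insert M X" "D - Y \<subseteq> insert M X" using CL DL spl(1) by blast+
          show "finite (insert M X)" using finX by simp
        qed
      qed
      show ?thesis
      proof (cases "y = 1")
        case True
        then have "invs (insert M X) + invs Y + (x + 1) \<le> invs L" "c1 = 0" "d1 \<le> 1"
          using inv c1 d1 by auto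
        then show ?thesis using one[OF True] c d c0 d0 by linarith
      next
        case False
        then have y2: "2 \<le> y" using y1 by simp
        have "2 * x + y \<le> x * y + 2" using double_mult_ge_add x1 y2 by blast
        then show ?thesis using c d c0 d0 c1 d1 inv y2 by (simp only: mult.commute[of y x])
      qed
    qed
  qed
qed

text \<open>
  \<open>p\<close> is the leftmost, rightmost, lowest or highest point of \<open>S\<close>.
\<close>

definition extremal :: "int \<times> int \<Rightarrow> (int \<times> int) set \<Rightarrow> bool" where
  "extremal p S \<longleftrightarrow> p \<in> S \<and> ((\<forall>q\<in>S. fst p \<le> fst q) \<or> (\<forall>q\<in>S. fst q \<le> fst p) \<or>
     (\<forall>q\<in>S. snd p \<le> snd q) \<or> (\<forall>q\<in>S. snd q \<le> snd p))"

lemma extremal_swap [simp]: "extremal (prod.swap p) (prod.swap ` S) \<longleftrightarrow> extremal p S"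
proof -
  have "prod.swap p \<in> prod.swap ` S \<longleftrightarrow> p \<in> S" by (rule inj_image_mem_iff) simp
  then show ?thesis by (simp add: extremal_def) blast
qed

lemma extremal_reflect [simp]: "extremal (reflect N p) (reflect N ` S) \<longleftrightarrow> extremal p S"
proof -
  have "reflect N p \<in> reflect N ` S \<longleftrightarrow> p \<in> S" using inj_reflect by (rule inj_image_mem_iff)
  then show ?thesis by (simp add: extremal_def) blast
qed

text \<open>
  An indecomposable 1324-avoider, without a decomposable reduction, in which \<open>L\<close> is southwest and \<open>R\<close>
  northeast of some corner, with a single point \<open>u\<close> northwest and a single point \<open>v\<close> southeast of it.
\<close>

locale cross =
  fixes S L R :: "(int \<times> int) set" and u v :: "int \<times> int"
  assumes fin: "finite S" and gen: "generic S" and S: "S = L \<union> R \<union> {u, v}"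
    and LR: "a \<in> L \<Longrightarrow> b \<in> R \<Longrightarrow> sw a b"
    and Lu: "a \<in> L \<Longrightarrow> snd a < snd u" and Lv: "a \<in> L \<Longrightarrow> fst a < fst v"
    and uR: "b \<in> R \<Longrightarrow> fst u < fst b" and vR: "b \<in> R \<Longrightarrow> snd v < snd b"
    and uv: "nw u v" and av: "avoids1324 S" and Lne: "L \<noteq> {}" and Rne: "R \<noteq> {}"
    and nsplit: "\<not> splits S" and extr: "extremal p S \<Longrightarrow> \<not> splits (S - {p})"
begin

text \<open>
  \<open>C\<close> and \<open>D\<close> are the points of \<open>L\<close> that form no inversion with \<open>u\<close>, respectively with \<open>v\<close>; \<open>A\<close> and \<open>B\<close> are
  the corresponding subsets of \<open>R\<close>. A half turn exchanges \<open>C\<close> with \<open>B\<close> and \<open>D\<close> with \<open>A\<close>.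
\<close>

definition C where "C = {a \<in> L. fst a < fst u}"
definition D where "D = {a \<in> L. snd a < snd v}"
definition A where "A = {b \<in> R. snd u < snd b}"
definition B where "B = {b \<in> R. fst v < fst b}"

lemma S_cases:
  assumes "q \<in> S" obtains "q \<in> L" | "q \<in> R" | "q = u" | "q = v"
  using assms S by auto

lemma finL: "finite L" and finC: "finite C" and finD: "finite D"
  using fin S by (auto simp: C_def D_def)

lemma genL: "generic L" using gen S generic_subset by blast

lemma disjoint: "u \<notin> L" "v \<notin> L" "u \<notin> R" "v \<notin> R" "u \<noteq> v" "L \<inter> R = {}"
proof -
  show "u \<notin> L" "v \<notin> L" "u \<notin> R" "v \<notin> R"
    using Lu[of u] Lv[of v] uR[of u] vR[of v] by blast+
  show "u \<noteq> v" using uv by (auto simp: nw_def)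
  have "\<not> sw a a" for a by (simp add: sw_def)
  then show "L \<inter> R = {}" using LR by blast
qed

lemma Cu: assumes "a \<in> L" "a \<notin> C" shows "fst u < fst a"
proof -
  have "fst a \<noteq> fst u" using generic_neq(1)[OF gen, of a u] assms disjoint S by auto
  then show ?thesis using assms by (simp add: C_def)
qed

lemma Dv: assumes "a \<in> L" "a \<notin> D" shows "snd v < snd a"
proof -
  have "snd a \<noteq> snd v" using generic_neq(2)[OF gen, of a v] assms disjoint S by auto
  then show ?thesis using assms by (simp add: D_def)
qed

lemma iniC: "a \<in> C \<Longrightarrow> b \<in> L \<Longrightarrow> fst b < fst a \<Longrightarrow> b \<in> C"
  and iniD: "a \<in> D \<Longrightarrow> b \<in> L \<Longrightarrow> snd b < snd a \<Longrightarrow> b \<in> D"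
  by (auto simp: C_def D_def)

lemma CL: "C \<subseteq> L" and DL: "D \<subseteq> L" by (auto simp: C_def D_def)

lemma sw_u: "a \<in> C \<Longrightarrow> sw a u" and sw_v: "a \<in> D \<Longrightarrow> sw a v"
  using Lu Lv by (auto simp: C_def D_def sw_def)

text \<open>
  An initial part of \<open>L - {p}\<close> that is also southwest of \<open>u\<close> and \<open>v\<close> (as far as these are not the removed
  point \<open>p\<close>) would be an initial part of the reduction \<open>S - {p}\<close>.
\<close>

lemma no_init_extremal:
  assumes p: "extremal p S" and Z: "init Z (L - {p})" "p = u \<or> Z \<subseteq> C" "p = v \<or> Z \<subseteq> D"
  shows False
proof -
  have sub: "Z \<subseteq> L - {p}" using Z by (auto simp: init_def)
  have "sw a b" if ab: "a \<in> Z" "b \<in> S - {p} - Z" for a b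
  proof -
    consider "b \<in> L - {p} - Z" | "b \<in> R" | "b = u" "p \<noteq> u" | "b = v" "p \<noteq> v"
      using ab(2) S by auto
    then show ?thesis
    proof cases
      case 1
      then show ?thesis using ab(1) Z(1) unfolding init_def by blast
    next
      case 2
      then show ?thesis using ab(1) sub LR by blast
    next
      case 3
      then show ?thesis using ab(1) Z(2) sw_u by blast
    next
      case 4
      then show ?thesis using ab(1) Z(3) sw_v by blast
    qed
  qed
  then have "init Z (S - {p})" using Z sub S by (auto simp: init_def)
  moreover have "Z \<noteq> S - {p}" using sub disjoint S by auto
  ultimately show False using extr[OF p] by (auto simp: splits_def)
qed

lemma no_init: assumes Z: "init Z L" shows "\<not> Z \<subseteq> C \<inter> D"
proof
  assume sub: "Z \<subseteq> C \<inter> D"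
  have sub': "Z \<subseteq> L" using Z by (auto simp: init_def)
  have "sw a b" if ab: "a \<in> Z" "b \<in> S - Z" for a b
  proof -
    consider "b \<in> L - Z" | "b \<in> R" | "b = u" | "b = v" using ab(2) S by auto
    then show ?thesis
    proof cases
      case 1
      then show ?thesis using ab(1) Z unfolding init_def by blast
    next
      case 2
      then show ?thesis using ab(1) sub' LR by blast
    next
      case 3
      then show ?thesis using ab(1) sub sw_u by blast
    next
      case 4
      then show ?thesis using ab(1) sub sw_v by blast
    qed
  qed
  then have "init Z S" using Z sub' S by (auto simp: init_def)
  moreover have "Z \<noteq> S" using sub' disjoint S by auto
  ultimately show False using nsplit by (auto simp: splits_def)
qed

lemma bound_disjoint:
  assumes CD: "C \<inter> D = {}" shows "card C + card D \<le> invs L + 1"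
proof -
  consider "C = {}" | "D = {}" | "C \<noteq> {}" "D \<noteq> {}" by blast
  then show ?thesis
  proof cases
    case 1
    have "fst u \<le> fst q" if "q \<in> S" for q
      using that Cu[of q] uR[of q] uv 1 by (cases q rule: S_cases) (auto simp: nw_def)
    then have eu: "extremal u S" using S by (simp add: extremal_def)
    have "min (card L) (card D) \<le> invs L"
      by (rule no_init_invs_ge_min[OF finL genL])
        (use DL iniD no_init_extremal[OF eu] disjoint in auto)
    then show ?thesis using 1 card_mono[OF finL DL] by simp
  next
    case 2
    have "snd v \<le> snd q" if "q \<in> S" for q
      using that Dv[of q] vR[of q] uv 2 by (cases q rule: S_cases) (auto simp: nw_def)
    then have ev: "extremal v S" using S by (simp add: extremal_def)
    have "min (card C) (card L) \<le> invs L"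
      by (rule no_init_invs_ge_min[OF finL genL])
        (use CL iniC no_init_extremal[OF ev] disjoint in auto)
    then show ?thesis using 2 card_mono[OF finL CL] by simp
  next
    case 3
    have "C \<times> D \<subseteq> inv_pairs L"
    proof clarify
      fix c d assume c: "c \<in> C" and d: "d \<in> D"
      then have "c \<in> L" "d \<in> L" "c \<notin> D" "d \<notin> C" using CL DL CD by auto
      then have "nw c d" using c d Cu[of d] Dv[of c] by (auto simp: nw_def C_def D_def)
      then show "(c, d) \<in> inv_pairs L" using \<open>c \<in> L\<close> \<open>d \<in> L\<close> by (simp add: inv_pairs_def)
    qed
    then have "card C * card D \<le> invs L"
      unfolding invs_def card_cartesian_product[symmetric]
      by (rule card_mono[OF finite_inv_pairs[OF finL]])
    moreover have "1 \<le> card C" "1 \<le> card D"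
      using 3 finC finD by (auto simp: Suc_le_eq card_gt_0_iff)
    ultimately show ?thesis using mult_ge_add[of "card C" "card D"] by linarith
  qed
qed

text \<open>
  A point of \<open>C \<inter> D\<close>, the points \<open>u\<close> and \<open>v\<close>, and a point of \<open>A \<inter> B\<close> would form 1324.
\<close>

lemma AB_empty: assumes "C \<inter> D \<noteq> {}" shows "A \<inter> B = {}"
proof (rule ccontr)
  assume "A \<inter> B \<noteq> {}"
  then obtain b e where "b \<in> A \<inter> B" "e \<in> C \<inter> D" using assms by auto
  moreover from this have "sw u b" "sw v b" "b \<in> S" "e \<in> S"
    using uR vR S CL by (auto simp: A_def B_def sw_def)
  ultimately show False using av sw_u sw_v uv S unfolding avoids1324_def by blast
qed

text \<open>
  With a point of \<open>B\<close> as the largest entry, avoidance of 1324 forces the points of \<open>L - D\<close> to be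
  northwest of all of \<open>D\<close>.
\<close>

lemma bound_B:
  assumes CD: "C \<inter> D \<noteq> {}" and B: "B \<noteq> {}" and LD: "\<not> L \<subseteq> D"
  shows "card C + card D \<le> invs L + 2"
proof -
  obtain b where b: "b \<in> B" using B by auto
  then have bR: "b \<in> R" by (simp add: B_def)
  define W where "W = L - D"
  have WD: "nw w d" if w: "w \<in> W" and d: "d \<in> D" for w d
  proof -
    have wL: "w \<in> L" "d \<in> L" "w \<noteq> d" "snd v < snd w" "snd d < snd v"
      using w d DL Dv by (auto simp: W_def D_def)
    have "\<not> fst d < fst w"
    proof
      assume "fst d < fst w"
      then have "sw d w" using wL by (auto simp: sw_def)
      moreover have "nw w v" using wL Lv by (simp add: nw_def)
      moreover have "sw v b" using b vR[OF bR] by (simp add: B_def sw_def)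
      moreover have "sw w b" using LR wL bR by blast
      ultimately show False using av sw_v[OF d] wL bR S unfolding avoids1324_def by blast
    qed
    then show ?thesis using wL generic_neq(1)[OF genL, of w d] by (force simp: nw_def)
  qed
  obtain e where e: "e \<in> C" "e \<in> D" using CD by auto
  have WC: "W \<subseteq> C"
  proof
    fix w assume w: "w \<in> W"
    then show "w \<in> C" using WD[OF w e(2)] iniC[OF e(1), of w] by (simp add: W_def nw_def)
  qed
  have finW: "finite W" using finL by (simp add: W_def)
  have "C = W \<union> (C \<inter> D)" using WC CL by (auto simp: W_def)
  moreover have "W \<inter> (C \<inter> D) = {}" by (auto simp: W_def)
  ultimately have cC: "card C = card W + card (C \<inter> D)"
    using finW finD by (metis card_Un_disjoint finite_Int)
  have "L = W \<union> D" using DL by (auto simp: W_def)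
  moreover have "invs W + invs D + card (W \<times> D) \<le> invs (W \<union> D)"
    by (rule invs_union_ge) (use finW finD WD in \<open>auto simp: W_def\<close>)
  ultimately have inv: "invs W + invs D + card W * card D \<le> invs L"
    by (simp add: card_cartesian_product)
  have cCD: "card (C \<inter> D) \<le> card D" using finD by (simp add: card_mono)
  have d1: "1 \<le> card D" using e finD by (auto simp: Suc_le_eq card_gt_0_iff)
  have "W \<noteq> {}" using LD by (auto simp: W_def)
  then have w1: "1 \<le> card W" using finW by (simp add: Suc_le_eq card_gt_0_iff)
  show ?thesis
  proof (cases "card W = 1")
    case False
    then show ?thesis
      using double_mult_ge_add[of "card D" "card W"] d1 w1 cC cCD inv by (simp add: mult.commute)
  next
    case True
    \<comment> \<open>The only point \<open>w\<close> of \<open>L - D\<close> is leftmost, so that \<open>S - {w}\<close> is indecomposable.\<close>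
    then obtain w where w: "W = {w}" by (auto simp: card_1_singleton_iff)
    have wL: "w \<in> L" "w \<in> C" using w WC by (auto simp: W_def)
    have "fst w \<le> fst q" if "q \<in> S" for q
    proof -
      have "q = w \<or> q \<in> D \<or> q \<in> R \<or> q = u \<or> q = v" using that S w by (auto simp: W_def)
      then show ?thesis
        using WD[of w q] w LR[of w q] wL Lv[of w] by (auto simp: nw_def sw_def C_def)
    qed
    then have ew: "extremal w S" using wL S by (auto simp: extremal_def)
    have LwD: "L - {w} = D" using w DL by (auto simp: W_def)
    have "min (card (C \<inter> D)) (card D) \<le> invs D"
    proof (rule no_init_invs_ge_min[OF finD])
      show "generic D" using genL DL generic_subset by blast
      show "\<not> Z \<subseteq> C \<inter> D \<inter> D" if "init Z D" for Z
        using no_init_extremal[OF ew, of Z] that LwD by auto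
    qed (use iniC DL in auto)
    then show ?thesis using cC cCD inv True by simp
  qed
qed

lemma u_extremal: assumes "A = {}" shows "extremal u S"
proof -
  have "snd q \<le> snd u" if q: "q \<in> S" for q
  proof -
    show ?thesis using q
    proof (cases q rule: S_cases)
      case 2
      then have "\<not> snd u < snd q" using assms unfolding A_def by blast
      then show ?thesis by simp
    qed (use Lu[of q] uv in \<open>auto simp: nw_def\<close>)
  qed
  then show ?thesis using S by (simp add: extremal_def)
qed

lemma v_extremal: assumes "B = {}" shows "extremal v S"
proof -
  have "fst q \<le> fst v" if q: "q \<in> S" for q
  proof -
    show ?thesis using q
    proof (cases q rule: S_cases)
      case 2
      then have "\<not> fst v < fst q" using assms unfolding B_def by blast
      then show ?thesis by simp
    qed (use Lv[of q] uv in \<open>auto simp: nw_def\<close>)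
  qed
  then show ?thesis using S by (simp add: extremal_def)
qed

lemma bound_top_right:
  assumes CD: "C \<inter> D \<noteq> {}" and A: "A = {}" and B: "B = {}"
  shows "card C + card D \<le> invs L + 2"
proof (rule invs_ge_two_initial_sets[OF finL genL _ CL DL _ _ CD])
  obtain r where r: "r \<in> R" using Rne by auto
  then have "r \<in> S" using S by auto
  then show "avoids132 L"
    using av LR[OF _ r] S unfolding avoids132_def avoids1324_def by blast
  obtain e where e: "e \<in> C" "e \<in> D" using CD by auto
  note eu = u_extremal[OF A] and ev = v_extremal[OF B]
  show "\<not> Z \<subseteq> C" if "init Z L" for Z
    using no_init_extremal[OF ev, of Z] that disjoint by auto
  show "\<not> Z \<subseteq> D" if "init Z L" for Z
    using no_init_extremal[OF eu, of Z] that disjoint by auto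
  show "\<not> Z \<subseteq> C \<inter> D" if l: "l \<in> L" "\<forall>p\<in>L. fst l \<le> fst p" "init Z (L - {l})" for l Z
  proof -
    have "fst l \<le> fst e" using l e CL by auto
    then have "\<forall>q\<in>S. fst l \<le> fst q" using l S e LR[OF l(1)] Lv[OF l(1)] 
      by (force simp: C_def sw_def)
    then have "extremal l S" using S l by (auto simp: extremal_def)
    then show ?thesis using no_init_extremal l by blast
  qed
  show "\<not> Z \<subseteq> C \<inter> D" if l: "l \<in> L" "\<forall>p\<in>L. snd l \<le> snd p" "init Z (L - {l})" for l Z
  proof -
    have "snd l \<le> snd e" using l e CL by auto
    then have "\<forall>q\<in>S. snd l \<le> snd q" using l S e LR[OF l(1)] Lu[OF l(1)] 
      by (force simp: D_def sw_def)
    then have "extremal l S" using S l by (auto simp: extremal_def)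
    then show ?thesis using no_init_extremal l by blast
  qed
qed (use iniC iniD in auto)

lemma L_not_subset:
  assumes "C \<inter> D \<noteq> {}"
  shows "A = {} \<Longrightarrow> \<not> L \<subseteq> D" "B = {} \<Longrightarrow> \<not> L \<subseteq> C"
proof -
  have e: "init L (L - {u})" "init L (L - {v})"
    using init_self[OF Lne] disjoint by simp_all
  show "\<not> L \<subseteq> D" if "A = {}"
    using no_init_extremal[OF u_extremal[OF that] e(1)] by blast
  show "\<not> L \<subseteq> C" if "B = {}"
    using no_init_extremal[OF v_extremal[OF that] e(2)] by blast
qed

text \<open>
  The inversions inside \<open>L\<close> and inside \<open>R\<close>, the pair \<open>(u, v)\<close>, and the inversions of \<open>u\<close> and \<open>v\<close> with \<open>L\<close>
  and \<open>R\<close>.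
\<close>

lemma invs_cross_ge:
  "invs L + invs R + 1 + (card L - card C) + (card L - card D) + (card R - card A)
     + (card R - card B) \<le> invs S"
proof -
  let ?E1 = "{u} \<times> (L - C)" and ?E2 = "(L - D) \<times> {v}" and ?E3 = "{u} \<times> (R - A)"
    and ?E4 = "(R - B) \<times> {v}"
  have finR: "finite R" using fin S by auto
  have bA: "snd b < snd u" if "b \<in> R - A" for b
  proof -
    have "b \<in> S" "u \<in> S" "b \<noteq> u" using that S disjoint by auto
    then have "snd b \<noteq> snd u" using generic_neq(2)[OF gen] by blast
    moreover have "\<not> snd u < snd b" using that unfolding A_def by blast
    ultimately show ?thesis by simp
  qed
  have bB: "fst b < fst v" if "b \<in> R - B" for b
  proof -
    have "b \<in> S" "v \<in> S" "b \<noteq> v" using that S disjoint by auto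
    then have "fst b \<noteq> fst v" using generic_neq(1)[OF gen] by blast
    moreover have "\<not> fst v < fst b" using that unfolding B_def by blast
    ultimately show ?thesis by simp
  qed
  have LR': "invs L + invs R \<le> invs (L \<union> R)"
    using invs_union_ge[of L R "{}"] finL finR disjoint by auto
  have "card (?E1 \<union> ?E2 \<union> ?E3 \<union> ?E4) = card (?E1 \<union> ?E2 \<union> ?E3) + card ?E4"
    by (rule card_Un_disjoint) (use finL finR disjoint in auto)
  also have "card (?E1 \<union> ?E2 \<union> ?E3) = card (?E1 \<union> ?E2) + card ?E3"
    by (rule card_Un_disjoint) (use finL finR disjoint in auto)
  also have "card (?E1 \<union> ?E2) = card ?E1 + card ?E2"
    by (rule card_Un_disjoint) (use finL finR disjoint in auto)
  finally have cE: "card (?E1 \<union> ?E2 \<union> ?E3 \<union> ?E4) =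
      (card L - card C) + (card L - card D) + (card R - card A) + (card R - card B)"
    using finL finR by (simp add: card_cartesian_product card_Diff_subset C_def D_def A_def B_def)
  have "invs (L \<union> R) + invs {u, v} + card (?E1 \<union> ?E2 \<union> ?E3 \<union> ?E4) \<le> invs S"
    unfolding S
  proof (rule invs_union_ge)
    show "?E1 \<union> ?E2 \<union> ?E3 \<union> ?E4 \<subseteq> {(p, q). (p \<in> L \<union> R \<and> q \<in> {u, v} \<or>
        p \<in> {u, v} \<and> q \<in> L \<union> R) \<and> nw p q}"
      using Cu Lu Lv Dv uR vR bA bB by (auto simp: nw_def)
  qed (use finL finR disjoint in auto)
  moreover have "1 \<le> invs {u, v}"
  proof -
    have "(u, v) \<in> inv_pairs {u, v}" using uv by (simp add: inv_pairs_def)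
    then show ?thesis by (auto simp: invs_def Suc_le_eq card_gt_0_iff finite_inv_pairs)
  qed
  ultimately show ?thesis using cE LR' by linarith
qed

lemma cross_swap:
  "cross (prod.swap ` S) (prod.swap ` L) (prod.swap ` R) (prod.swap v) (prod.swap u)"
proof
  show "prod.swap ` S = prod.swap ` L \<union> prod.swap ` R \<union> {prod.swap v, prod.swap u}"
    unfolding S by (simp add: image_Un insert_commute)
  show "\<not> splits (prod.swap ` S - {p})" if "extremal p (prod.swap ` S)" for p
  proof -
    have e: "extremal (prod.swap p) S" using that extremal_swap[of "prod.swap p" S] by simp
    have "prod.swap ` S - {p} = prod.swap ` (S - {prod.swap p})"
      by (simp add: image_set_diff)
    then show ?thesis using extr[OF e] by simp
  qed
  show "sw a b" if "a \<in> prod.swap ` L" "b \<in> prod.swap ` R" for a b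
    using that by (elim imageE) (simp add: LR Lu Lv uR vR)
  show "snd a < snd (prod.swap v)" if "a \<in> prod.swap ` L" for a
    using that by (elim imageE) (simp add: LR Lu Lv uR vR)
  show "fst a < fst (prod.swap u)" if "a \<in> prod.swap ` L" for a
    using that by (elim imageE) (simp add: LR Lu Lv uR vR)
  show "fst (prod.swap v) < fst b" if "b \<in> prod.swap ` R" for b
    using that by (elim imageE) (simp add: LR Lu Lv uR vR)
  show "snd (prod.swap u) < snd b" if "b \<in> prod.swap ` R" for b
    using that by (elim imageE) (simp add: LR Lu Lv uR vR)
qed (simp_all add: fin gen uv av Lne Rne nsplit)

lemma cross_reflect:
  "cross (reflect N ` S) (reflect N ` R) (reflect N ` L) (reflect N v) (reflect N u)"
proof
  show "reflect N ` S = reflect N ` R \<union> reflect N ` L \<union> {reflect N v, reflect N u}"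
    unfolding S by (simp add: image_Un insert_commute Un_commute)
  show "\<not> splits (reflect N ` S - {p})" if "extremal p (reflect N ` S)" for p
  proof -
    have e: "extremal (reflect N p) S" using that extremal_reflect[of N "reflect N p" S] by simp
    have "reflect N ` S - {p} = reflect N ` (S - {reflect N p})"
      by (simp add: image_set_diff[OF inj_reflect])
    then show ?thesis using extr[OF e] by simp
  qed
  show "sw a b" if "a \<in> reflect N ` R" "b \<in> reflect N ` L" for a b
    using that by (elim imageE) (simp add: LR Lu Lv uR vR)
  show "snd a < snd (reflect N v)" if "a \<in> reflect N ` R" for a
    using that by (elim imageE) (simp add: LR Lu Lv uR vR)
  show "fst a < fst (reflect N u)" if "a \<in> reflect N ` R" for a
    using that by (elim imageE) (simp add: LR Lu Lv uR vR)
  show "fst (reflect N v) < fst b" if "b \<in> reflect N ` L" for b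
    using that by (elim imageE) (simp add: LR Lu Lv uR vR)
  show "snd (reflect N u) < snd b" if "b \<in> reflect N ` L" for b
    using that by (elim imageE) (simp add: LR Lu Lv uR vR)
qed (simp_all add: fin gen uv av Lne Rne nsplit)

end

lemma (in cross) bound_meet:
  assumes CD: "C \<inter> D \<noteq> {}"
  shows "card C + card D \<le> invs L + 2"
proof -
  interpret sw: cross "prod.swap ` S" "prod.swap ` L" "prod.swap ` R" "prod.swap v" "prod.swap u"
    by (rule cross_swap)
  have eqs: "sw.C = prod.swap ` D" "sw.D = prod.swap ` C" "sw.A = prod.swap ` B" "sw.B = prod.swap ` A"
    by (auto simp: sw.C_def sw.D_def sw.A_def sw.B_def C_def D_def A_def B_def)
  consider "B \<noteq> {}" "\<not> L \<subseteq> D" | "A \<noteq> {}" "\<not> L \<subseteq> C" | "A = {}" "B = {}" | "L \<subseteq> C" "L \<subseteq> D"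
    using L_not_subset[OF CD] by blast
  then show ?thesis
  proof cases
    case 1
    then show ?thesis using bound_B[OF CD] by simp
  next
    case 2
    have "sw.C \<inter> sw.D = prod.swap ` (C \<inter> D)" unfolding eqs by (auto simp: image_Int)
    then have "card sw.C + card sw.D \<le> invs (prod.swap ` L) + 2"
      using 2 CD sw.bound_B by (simp add: eqs inj_image_subset_iff)
    then show ?thesis by (simp add: eqs card_image)
  next
    case 3
    then show ?thesis using bound_top_right[OF CD] by simp
  next
    case 4
    then show ?thesis using no_init[OF init_self[OF Lne]] by auto
  qed
qed

text \<open>
  By \<open>AB_empty\<close> at most one of \<open>C \<inter> D\<close> and \<open>A \<inter> B\<close> is nonempty, so the excesses of
  \<open>card C + card D\<close> over \<open>invs L\<close> and of \<open>card A + card B\<close> over \<open>invs R\<close> add up to at most 3.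
\<close>

lemma (in cross) card_le_invs: "2 * card S \<le> invs S + 6"
proof -
  interpret r: cross "reflect 0 ` S" "reflect 0 ` R" "reflect 0 ` L" "reflect 0 v" "reflect 0 u"
    by (rule cross_reflect)
  have "r.C = reflect 0 ` B" "r.D = reflect 0 ` A" "r.A = reflect 0 ` D" "r.B = reflect 0 ` C"
    by (auto simp: r.C_def r.D_def r.A_def r.B_def C_def D_def A_def B_def)
  note eqs = this
  have i1: "r.C \<inter> r.D = reflect 0 ` (A \<inter> B)" "r.A \<inter> r.B = reflect 0 ` (C \<inter> D)"
    unfolding eqs by (auto simp: image_Int[OF inj_reflect])
  have "card A + card B \<le> invs R + (if A \<inter> B = {} then 1 else 2)"
    using r.bound_meet r.bound_disjoint unfolding i1 by (simp add: eqs card_image add.commute)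
  moreover have "card C + card D \<le> invs L + (if C \<inter> D = {} then 1 else 2)"
    using bound_meet bound_disjoint by simp
  moreover have "A \<inter> B = {} \<or> C \<inter> D = {}" using AB_empty by blast
  ultimately have "card A + card B + (card C + card D) \<le> invs L + invs R + 3"
    by (auto split: if_splits)
  moreover have "card S = card L + card R + 2"
  proof -
    have finR: "finite R" using fin S by auto
    have "card S = card (L \<union> R) + card {u, v}"
      unfolding S by (rule card_Un_disjoint) (use finL finR disjoint in auto)
    also have "card (L \<union> R) = card L + card R"
      by (rule card_Un_disjoint) (use finL finR disjoint in auto)
    finally show ?thesis using disjoint by simp
  qed
  moreover have "card C \<le> card L" "card D \<le> card L" using card_mono finL CL DL by auto
  moreover have "finite R" using fin S by auto
  then have "card A \<le> card R" "card B \<le> card R" by (auto simp: A_def B_def card_mono)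
  ultimately show ?thesis using invs_cross_ge by linarith
qed

lemma card_le_invs_of_indecomposable:
  assumes fin: "finite S" and gen: "generic S" and av: "avoids1324 S" and ns: "\<not> splits S"
    and extr: "\<And>p. extremal p S \<Longrightarrow> \<not> splits (S - {p})"
  shows "2 * card S \<le> invs S + 6"
proof (cases "card S \<le> 3")
  case False
  define n where "n = card S"
  have n4: "4 \<le> n" using False by (simp add: n_def)
  have inj: "inj_on fst S" "inj_on snd S" using gen by (auto simp: generic_def)
  have one: "1 \<le> card (crossing S i)" if i: "1 \<le> i" "i < n" for i
  proof (rule ccontr)
    assume "\<not> 1 \<le> card (crossing S i)"
    then have e: "crossing S i = {}" using fin by (auto simp: not_le crossing_def)
    have "init {p \<in> S. rank fst S p \<le> i} S"
      by (rule crossing_empty_init(1)[OF fin gen _ _ e]) (use i n_def in auto)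
    moreover have "{p \<in> S. rank fst S p \<le> i} \<noteq> S"
      using card_rank_le[OF fin inj(1), of i] i by (metis less_imp_le n_def nat_neq_iff)
    ultimately show False using ns by (auto simp: splits_def)
  qed
  show ?thesis
  proof (cases "\<forall>i\<in>{2..n-2}. 2 \<le> card (crossing S i)")
    case True
    have "{1..n-1} = insert 1 (insert (n - 1) {2..n-2})" using n4 by auto
    then have "(\<Sum>i\<in>{1..n-1}. card (crossing S i)) =
        card (crossing S 1) + (card (crossing S (n - 1)) + (\<Sum>i\<in>{2..n-2}. card (crossing S i)))"
    proof -
      assume eq: "{1..n-1} = insert 1 (insert (n - 1) {2..n-2})"
      have "1 \<notin> insert (n - 1) {2..n-2}" "n - 1 \<notin> {2..n-2}" using n4 by auto
      then show ?thesis unfolding eq by (simp only: sum.insert finite_insert finite_atLeastAtMost simp_thms)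
    qed
    moreover have "(\<Sum>i\<in>{2..n-2}. 2) \<le> (\<Sum>i\<in>{2..n-2}. card (crossing S i))"
      by (rule sum_mono) (use True in auto)
    moreover have "1 \<le> card (crossing S 1)" "1 \<le> card (crossing S (n - 1))"
      using one n4 by auto
    moreover have "(\<Sum>i\<in>{1..n-1}. card (crossing S i)) \<le> invs S"
      by (rule sum_crossing_le_invs) (use fin gen in auto)
    ultimately show ?thesis using n4 by (simp add: n_def)
  next
    case False
    then obtain i where i: "2 \<le> i" "i \<le> n - 2" "card (crossing S i) < 2" by auto
    then have "1 \<le> i" "i < n" using n4 by auto
    then have c1: "card (crossing S i) = 1" using one[of i] i(3) by simp
    define P Q where "P = {p \<in> S. rank fst S p \<le> i}" and "Q = {p \<in> S. rank snd S p \<le> i}"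
    have fPQ: "finite P" "finite Q" using fin by (auto simp: P_def Q_def)
    have cP: "card P = i" and cQ: "card Q = i"
      using card_rank_le[OF fin] inj i n4 by (auto simp: n_def P_def Q_def)
    have PQ: "P - Q = crossing S i" by (auto simp: P_def Q_def crossing_def)
    have c: "card (P - Q) = card P - card (P \<inter> Q)" "card (Q - P) = card Q - card (P \<inter> Q)"
      using fPQ card_Diff_subset_Int[of P Q] card_Diff_subset_Int[of Q P] by (auto simp: Int_commute)
    then have c2: "card (Q - P) = 1" using c1 PQ cP cQ by simp
    obtain u v where u: "P - Q = {u}" and v: "Q - P = {v}"
      using c1 c2 PQ by (auto simp: card_1_singleton_iff)
    let ?L = "P \<inter> Q" and ?R = "S - (P \<union> Q)"
    have le1: "fst p < fst q" if "p \<in> P" "q \<in> S - P" for p q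
      using that rank_le_iff[OF fin, of q p fst] by (auto simp: P_def)
    have le2: "snd p < snd q" if "p \<in> Q" "q \<in> S - Q" for p q
      using that rank_le_iff[OF fin, of q p snd] by (auto simp: Q_def)
    have PS: "P \<subseteq> S" "Q \<subseteq> S" by (auto simp: P_def Q_def)
    have uPQ: "u \<in> P" "u \<in> S" "u \<notin> Q" "v \<in> Q" "v \<in> S" "v \<notin> P" using u v PS by auto
    have "card ?L = i - 1" using c c1 PQ cP i by simp
    then have Lne: "?L \<noteq> {}" using i by (intro notI) simp
    have "card (P \<union> Q) + card (P \<inter> Q) = 2 * i"
      using card_Un_Int[OF fPQ] cP cQ by simp
    then have "card (P \<union> Q) = i + 1" using \<open>card ?L = i - 1\<close> i by simp
    then have "P \<union> Q \<noteq> S" using i n4 by (auto simp: n_def)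
    then have Rne: "?R \<noteq> {}" using PS by auto
    have "cross S ?L ?R u v"
    proof
      show "S = P \<inter> Q \<union> (S - (P \<union> Q)) \<union> {u, v}" using u v PS by auto
      show "nw u v" using le1[of u v] le2[of v u] uPQ by (simp add: nw_def)
      show "sw a b" if "a \<in> P \<inter> Q" "b \<in> S - (P \<union> Q)" for a b
        using le1[of a b] le2[of a b] that by (simp add: sw_def)
      show "snd a < snd u" if "a \<in> P \<inter> Q" for a using le2[of a u] that uPQ by simp
      show "fst a < fst v" if "a \<in> P \<inter> Q" for a using le1[of a v] that uPQ by simp
      show "fst u < fst b" if "b \<in> S - (P \<union> Q)" for b using le1[of u b] that uPQ by simp
      show "snd v < snd b" if "b \<in> S - (P \<union> Q)" for b using le2[of v b] that uPQ by simp
    qed (fact fin gen av ns extr Lne Rne)+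
    then show ?thesis by (rule cross.card_le_invs)
  qed
qed simp

section \<open>Permutations as point sets\<close>

text \<open>
  There is a bijection preserving and reflecting the strict order of each coordinate.
\<close>

definition order_iso :: "(int \<times> int) set \<Rightarrow> (int \<times> int) set \<Rightarrow> bool" where
  "order_iso S T \<longleftrightarrow> (\<exists>f. bij_betw f S T \<and>
     (\<forall>p\<in>S. \<forall>q\<in>S. (fst (f p) < fst (f q) \<longleftrightarrow> fst p < fst q) \<and> (snd (f p) < snd (f q) \<longleftrightarrow> snd p < snd q)))"

lemma order_iso_sym: assumes "order_iso S T" shows "order_iso T S"
proof -
  obtain f where f: "bij_betw f S T"
    "\<And>p q. p \<in> S \<Longrightarrow> q \<in> S \<Longrightarrow> (fst (f p) < fst (f q) \<longleftrightarrow> fst p < fst q) \<and> (snd (f p) < snd (f q) \<longleftrightarrow> snd p < snd q)"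
    using assms unfolding order_iso_def by blast
  let ?g = "inv_into S f"
  have g: "?g t \<in> S" "f (?g t) = t" if "t \<in> T" for t
    using that f(1) by (auto simp: bij_betw_def inv_into_into f_inv_into_f)
  have "bij_betw ?g T S" using f(1) by (rule bij_betw_inv_into)
  moreover have "(fst (?g p) < fst (?g q) \<longleftrightarrow> fst p < fst q) \<and> (snd (?g p) < snd (?g q) \<longleftrightarrow> snd p < snd q)"
    if "p \<in> T" "q \<in> T" for p q
    using f(2)[OF g(1)[OF that(1)] g(1)[OF that(2)]] g(2) that by simp
  ultimately show ?thesis unfolding order_iso_def by blast
qed

lemma order_iso_imp:
  assumes "order_iso S T"
  shows "splits S \<Longrightarrow> splits T" "avoids1324 T \<Longrightarrow> avoids1324 S"
proof -
  obtain f where f: "bij_betw f S T"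
    and iff: "\<And>p q. p \<in> S \<Longrightarrow> q \<in> S \<Longrightarrow> (fst (f p) < fst (f q) \<longleftrightarrow> fst p < fst q) \<and> (snd (f p) < snd (f q) \<longleftrightarrow> snd p < snd q)"
    using assms unfolding order_iso_def by blast
  have sw: "sw (f p) (f q) \<longleftrightarrow> sw p q" and nw: "nw (f p) (f q) \<longleftrightarrow> nw p q"
    if "p \<in> S" "q \<in> S" for p q using iff[OF that] iff[OF that(2,1)] by (simp_all add: sw_def nw_def)
  have inj: "inj_on f S" and T: "T = f ` S" using f by (auto simp: bij_betw_def)
  show "splits T" if sp: "splits S"
  proof -
    obtain X where X: "init X S" "X \<noteq> S" using sp unfolding splits_def by blast
    have XS: "X \<subseteq> S" "X \<noteq> {}" using X by (auto simp: init_def)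
    have D: "T - f ` X = f ` (S - X)" using inj XS T by (simp add: inj_on_image_set_diff[OF inj])
    have "sw a b" if ab: "a \<in> f ` X" "b \<in> T - f ` X" for a b
    proof -
      obtain a' b' where ab': "a' \<in> X" "a = f a'" "b' \<in> S - X" "b = f b'" using ab D by auto
      then have "sw a' b'" using X unfolding init_def by blast
      then show ?thesis using ab' sw XS by blast
    qed
    then have "init (f ` X) T" using XS T unfolding init_def by blast
    moreover have "f ` X \<noteq> T" using T XS X(2) inj by (metis inj_on_image_eq_iff order_refl)
    ultimately show ?thesis unfolding splits_def by blast
  qed
  show "avoids1324 S" if "avoids1324 T"
    unfolding avoids1324_def
  proof clarify
    fix a b c d assume *: "a \<in> S" "b \<in> S" "c \<in> S" "d \<in> S"
      "sw a b" "sw a c" "nw b c" "sw b d" "sw c d"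
    then have "f a \<in> T" "f b \<in> T" "f c \<in> T" "f d \<in> T" using T by blast+
    moreover have "sw (f a) (f b)" "sw (f a) (f c)" "nw (f b) (f c)" "sw (f b) (f d)" "sw (f c) (f d)"
      using * sw nw by blast+
    ultimately show False using that unfolding avoids1324_def by blast
  qed
qed

lemma order_iso_splits: "order_iso S T \<Longrightarrow> splits S \<longleftrightarrow> splits T"
  using order_iso_imp(1) order_iso_sym by blast

text \<open>
  Removing the leftmost point yields a decomposable set.
\<close>

definition left_split :: "(int \<times> int) set \<Rightarrow> bool" where
  "left_split S \<longleftrightarrow> (\<exists>u\<in>S. (\<forall>q\<in>S. fst u \<le> fst q) \<and> splits (S - {u}))"

lemma order_iso_remove:
  assumes "order_iso S T" "u \<in> S" "\<forall>q\<in>S. fst u \<le> fst q"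
  shows "\<exists>v\<in>T. (\<forall>q\<in>T. fst v \<le> fst q) \<and> order_iso (S - {u}) (T - {v})"
proof -
  obtain f where f: "bij_betw f S T"
    and iff: "\<And>p q. p \<in> S \<Longrightarrow> q \<in> S \<Longrightarrow> (fst (f p) < fst (f q) \<longleftrightarrow> fst p < fst q) \<and> (snd (f p) < snd (f q) \<longleftrightarrow> snd p < snd q)"
    using assms unfolding order_iso_def by blast
  have T: "T = f ` S" using f by (auto simp: bij_betw_def)
  have "f u \<in> T" using assms T by auto
  moreover have "fst (f u) \<le> fst q" if q: "q \<in> T" for q
  proof -
    obtain q' where q': "q' \<in> S" "q = f q'" using q T by auto
    then have "\<not> fst q' < fst u" using assms(3) by auto
    then show ?thesis using iff[OF q'(1) assms(2)] q' by auto
  qed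
  moreover have "bij_betw f (S - {u}) (T - {f u})"
    using f assms(2) by (simp add: bij_betw_def inj_on_diff inj_on_image_set_diff[of f S])
  then have "order_iso (S - {u}) (T - {f u})" unfolding order_iso_def using iff by blast
  ultimately show ?thesis by blast
qed

lemma order_iso_left_split: "order_iso S T \<Longrightarrow> left_split S \<Longrightarrow> left_split T"
  unfolding left_split_def using order_iso_remove order_iso_imp(1) by meson

text \<open>
  The points of a permutation; positions are counted from 1, like values.
\<close>

definition pts :: "nat list \<Rightarrow> (int \<times> int) set" where
  "pts p = (\<lambda>i. (int (Suc i), int (p ! i))) ` {..<length p}"

lemma mem_pts: "(x, y) \<in> pts p \<longleftrightarrow> (\<exists>i<length p. x = int (Suc i) \<and> y = int (p ! i))"
  by (auto simp: pts_def)

lemma is_perm_iff: "is_perm p \<longleftrightarrow> distinct p \<and> set p = {1..length p}"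
  by (auto simp: is_perm_def perms_def permutations_of_set_def)

lemma perms_iff: "p \<in> perms n \<longleftrightarrow> is_perm p \<and> length p = n"
proof -
  have "length p = n" if "distinct p" "set p = {1..n}" using that distinct_card[of p] by simp
  then show ?thesis by (auto simp: is_perm_iff perms_def permutations_of_set_def)
qed

lemma is_perm_nth: "is_perm p \<Longrightarrow> i < length p \<Longrightarrow> 1 \<le> p ! i \<and> p ! i \<le> length p"
  unfolding is_perm_iff by (metis atLeastAtMost_iff nth_mem)

lemma is_perm_nth_eq: "is_perm p \<Longrightarrow> i < length p \<Longrightarrow> j < length p \<Longrightarrow> p ! i = p ! j \<longleftrightarrow> i = j"
  unfolding is_perm_iff by (simp add: nth_eq_iff_index_eq)

lemma is_perm_obtain: 
  assumes "is_perm p" "1 \<le> v" "v \<le> length p" obtains i where "i < length p" "p ! i = v"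
  using assms unfolding is_perm_iff by (metis atLeastAtMost_iff in_set_conv_nth)

lemma inj_pt: "inj_on (\<lambda>i. (int (Suc i), int (p ! i))) A"
  by (auto simp: inj_on_def)

lemma finite_pts [simp]: "finite (pts p)"
  by (simp add: pts_def)

lemma card_pts [simp]: "card (pts p) = length p"
  unfolding pts_def by (subst card_image[OF inj_pt]) simp

lemma generic_pts: "is_perm p \<Longrightarrow> generic (pts p)"
  unfolding generic_def inj_on_def pts_def by (auto simp: is_perm_nth_eq)

lemma pts_inject: assumes "pts p = pts q" shows "p = q"
proof (rule nth_equalityI)
  show l: "length p = length q" using arg_cong[OF assms, of card] by simp
  show "p ! i = q ! i" if "i < length p" for i
  proof -
    have "(int (Suc i), int (p ! i)) \<in> pts q" unfolding assms[symmetric] using that by (auto simp: mem_pts)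
    then show ?thesis by (auto simp: mem_pts)
  qed
qed

lemma card_inversions: "card (inversions p) = invs (pts p)"
proof -
  let ?f = "\<lambda>i. (int (Suc i), int (p ! i))"
  have nw: "nw (?f i) (?f j) \<longleftrightarrow> i < j \<and> p ! j < p ! i" for i j by (simp add: nw_def)
  have "inv_pairs (pts p) = (\<lambda>(i, j). (?f i, ?f j)) ` inversions p"
  proof (intro equalityI subsetI)
    fix x assume "x \<in> inv_pairs (pts p)"
    then obtain i j where ij: "x = (?f i, ?f j)" "i < length p" "j < length p" "nw (?f i) (?f j)"
      unfolding inv_pairs_def pts_def by blast
    then have "(i, j) \<in> inversions p" unfolding nw by (simp add: inversions_def)
    then show "x \<in> (\<lambda>(i, j). (?f i, ?f j)) ` inversions p" using ij(1) by (intro image_eqI) auto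
  next
    fix x assume "x \<in> (\<lambda>(i, j). (?f i, ?f j)) ` inversions p"
    then obtain i j where ij: "x = (?f i, ?f j)" "(i, j) \<in> inversions p" by auto
    then have "nw (?f i) (?f j)" "i < length p" "j < length p"
      unfolding nw by (simp_all add: inversions_def)
    then show "x \<in> inv_pairs (pts p)" unfolding ij(1) inv_pairs_def pts_def by blast
  qed
  moreover have "inj_on (\<lambda>(i, j). (?f i, ?f j)) (inversions p)"
    by (rule inj_onI) (simp add: case_prod_unfold prod_eq_iff)
  ultimately show ?thesis by (simp add: invs_def card_image)
qed

text \<open>
  Used repeatedly to read off a subsequence at increasing indices.
\<close>

lemma subseq_nth_drop:
  assumes "m \<le> i" "i < length xs" "subseq s (drop (Suc i) xs)"
  shows "subseq (xs ! i # s) (drop m xs)"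
proof -
  have "drop i xs = xs ! i # drop (Suc i) xs" using assms(2) by (rule Cons_nth_drop_Suc[symmetric])
  then have eq: "drop m xs = take (i - m) (drop m xs) @ xs ! i # drop (Suc i) xs"
    using append_take_drop_id[of "i - m" "drop m xs"] assms(1) by simp
  have "subseq (xs ! i # s) (xs ! i # drop (Suc i) xs)" using assms(3) by simp
  then show ?thesis by (subst eq) (rule list_emb_append2)
qed

lemma subseq_Cons_obtain:
  assumes "subseq (a # s) xs" obtains us ws where "xs = us @ a # ws" "subseq s ws"
  using list_emb_ConsD[OF assms] by auto

lemma contains_iff: "contains p [1, 3, 2, 4] \<longleftrightarrow> \<not> avoids1324 (pts p)"
proof
  assume "contains p [1, 3, 2, 4]"
  then obtain s where s: "subseq s p" "order_isomorphic s [1, 3, 2, 4]" by (auto simp: contains_def)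
  have len: "length s = 4" using s(2) by (simp add: order_isomorphic_def)
  then obtain a b c d where abcd: "s = [a, b, c, d]"
    by (auto simp: length_Suc_conv eval_nat_numeral)
  have lt: "s ! i < s ! j \<longleftrightarrow> [1, 3, 2, 4::nat] ! i < [1, 3, 2, 4] ! j" if "i < 4" "j < 4" for i j
    using s(2) len that by (simp add: order_isomorphic_def)
  have v: "a < c" "c < b" "b < d"
    using lt[of 0 2] lt[of 2 1] lt[of 1 3] by (simp_all add: abcd)
  obtain u1 w1 where 1: "p = u1 @ a # w1" "subseq [b, c, d] w1"
    using s(1) abcd subseq_Cons_obtain by metis
  obtain u2 w2 where 2: "w1 = u2 @ b # w2" "subseq [c, d] w2" using 1(2) subseq_Cons_obtain by metis
  obtain u3 w3 where 3: "w2 = u3 @ c # w3" "subseq [d] w3" using 2(2) subseq_Cons_obtain by metis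
  obtain u4 w4 where 4: "w3 = u4 @ d # w4" using 3(2) subseq_Cons_obtain by metis
  define i where "i = length u1"
  define j where "j = length (u1 @ a # u2)"
  define k where "k = length (u1 @ a # u2 @ b # u3)"
  define l where "l = length (u1 @ a # u2 @ b # u3 @ c # u4)"
  have p: "p = u1 @ a # u2 @ b # u3 @ c # u4 @ d # w4" using 1 2 3 4 by simp
  have "p = (u1 @ a # u2) @ b # u3 @ c # u4 @ d # w4"
    "p = (u1 @ a # u2 @ b # u3) @ c # u4 @ d # w4"
    "p = (u1 @ a # u2 @ b # u3 @ c # u4) @ d # w4" using p by simp_all
  then have pi: "p ! i = a" and pj: "p ! j = b" and pk: "p ! k = c" and pl: "p ! l = d"
    unfolding i_def j_def k_def l_def using p by (metis nth_append_length)+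
  have ord: "i < j" "j < k" "k < l" "l < length p" by (simp_all add: i_def j_def k_def l_def p)
  let ?f = "\<lambda>i. (int (Suc i), int (p ! i))"
  have "?f i \<in> pts p" "?f j \<in> pts p" "?f k \<in> pts p" "?f l \<in> pts p" using ord by (auto simp: mem_pts)
  moreover have "sw (?f i) (?f j)" "sw (?f i) (?f k)" "nw (?f j) (?f k)" "sw (?f j) (?f l)"
    "sw (?f k) (?f l)" using ord v by (simp_all add: sw_def nw_def pi pj pk pl)
  ultimately show "\<not> avoids1324 (pts p)" unfolding avoids1324_def by blast
next
  assume "\<not> avoids1324 (pts p)"
  then obtain A B C D where m: "A \<in> pts p" "B \<in> pts p" "C \<in> pts p" "D \<in> pts p"
    and r: "sw A B" "sw A C" "nw B C" "sw B D" "sw C D"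
    unfolding avoids1324_def by blast
  obtain i j k l where ijkl: "A = (int (Suc i), int (p ! i))" "B = (int (Suc j), int (p ! j))"
    "C = (int (Suc k), int (p ! k))" "D = (int (Suc l), int (p ! l))" "l < length p"
    using m unfolding pts_def by blast
  have o: "i < j" "j < k" "k < l" and v: "p ! i < p ! k" "p ! k < p ! j" "p ! j < p ! l"
    using r by (auto simp: ijkl sw_def nw_def)
  have "subseq [p ! i, p ! j, p ! k, p ! l] (drop 0 p)"
    by (intro subseq_nth_drop) (use o ijkl in auto)
  moreover have "order_isomorphic [p ! i, p ! j, p ! k, p ! l] [1, 3, 2, 4]"
    using v by (auto simp: order_isomorphic_def less_Suc_eq)
  ultimately show "contains p [1, 3, 2, 4]" unfolding contains_def by auto
qed

section \<open>Cuts\<close>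

text \<open>
  A cut \<open>c\<close> of a permutation: its first \<open>c\<close> entries are \<open>1, \<dots>, c\<close> in some order, and they are
  neither none nor all of its entries.
\<close>

definition cut :: "nat list \<Rightarrow> nat \<Rightarrow> bool" where
  "cut p c \<longleftrightarrow> 0 < c \<and> c < length p \<and> (\<forall>i<c. p ! i \<le> c)"

lemma cut_upper:
  assumes "is_perm p" "cut p c" "c \<le> i" "i < length p" shows "c < p ! i"
proof (rule ccontr)
  assume "\<not> c < p ! i"
  have "(!) p ` insert i {..<c} \<subseteq> {1..c}"
    using assms \<open>\<not> c < p ! i\<close> is_perm_nth[OF assms(1)] unfolding cut_def
    by (auto simp: not_less)
  then have "card ((!) p ` insert i {..<c}) \<le> card {1..c}" by (rule card_mono[rotated]) simp
  moreover have "inj_on ((!) p) (insert i {..<c})"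
    using assms by (intro inj_onI) (auto simp: cut_def is_perm_nth_eq)
  then have "card ((!) p ` insert i {..<c}) = Suc c" using assms(3) by (subst card_image) auto
  ultimately show False by simp
qed

lemma set_take_cut:
  assumes "is_perm p" "cut p c" shows "set (take c p) = {1..c}"
proof (rule card_subset_eq)
  show "set (take c p) \<subseteq> {1..c}"
    using assms is_perm_nth[OF assms(1)] by (auto simp: in_set_conv_nth cut_def Suc_le_eq)
  show "card (set (take c p)) = card {1..c}"
    using assms by (simp add: is_perm_iff cut_def distinct_card)
qed simp

lemma decomposable_iff_cut:
  assumes "is_perm p" shows "decomposable p \<longleftrightarrow> (\<exists>c. cut p c)"
proof
  assume "decomposable p"
  then obtain s t where st: "is_perm s" "is_perm t" "s \<noteq> []" "t \<noteq> []" "p = s \<oplus> t"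
    by (auto simp: decomposable_def)
  have "cut p (length s)"
    using st is_perm_nth[OF st(1)] by (auto simp: cut_def direct_sum_def nth_append)
  then show "\<exists>c. cut p c" ..
next
  assume "\<exists>c. cut p c"
  then obtain c where c: "cut p c" ..
  then have c': "0 < c" "c < length p" by (auto simp: cut_def)
  let ?t = "map (\<lambda>x. x - c) (drop c p)"
  have dp: "distinct p" "set p = {1..length p}" using assms by (auto simp: is_perm_iff)
  have gt: "c < x" if "x \<in> set (drop c p)" for x
    using that cut_upper[OF assms c] by (auto simp: in_set_conv_nth)
  have "set (take c p) \<union> set (drop c p) = {1..length p}" 
    using dp by (metis append_take_drop_id set_append)
  then have sd: "set (drop c p) = {c+1..length p}"
  proof -
    assume un: "set (take c p) \<union> set (drop c p) = {1..length p}"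
    have "{1..c} \<inter> set (drop c p) = {}" by (auto dest: gt)
    then have "set (drop c p) = {1..length p} - {1..c}"
      using un unfolding set_take_cut[OF assms c] by blast
    also have "\<dots> = {c+1..length p}" by auto
    finally show ?thesis .
  qed
  have "is_perm (take c p)" using dp c' set_take_cut[OF assms c] by (simp add: is_perm_iff)
  moreover have "is_perm ?t"
  proof -
    have "inj_on (\<lambda>x. x - c) (set (drop c p))" 
    proof (rule inj_onI)
      fix x y assume "x \<in> set (drop c p)" "y \<in> set (drop c p)" "x - c = y - c"
      then show "x = y" using gt[of x] gt[of y] by linarith
    qed
    then have "distinct ?t" using dp by (simp add: distinct_map)
    moreover have "(\<lambda>x. x - c) ` {c+1..length p} = {1..length p - c}"
    proof
      show "{1..length p - c} \<subseteq> (\<lambda>x. x - c) ` {c+1..length p}"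
      proof
        fix y assume "y \<in> {1..length p - c}"
        then show "y \<in> (\<lambda>x. x - c) ` {c+1..length p}" by (intro image_eqI[of _ _ "y + c"]) auto
      qed
    qed auto
    ultimately show ?thesis using sd by (simp add: is_perm_iff)
  qed
  moreover have "p = take c p \<oplus> ?t"
  proof -
    have "c + (x - c) = x" if "x \<in> set (drop c p)" for x using gt[OF that] by simp
    then have "map (\<lambda>x. c + (x - c)) (drop c p) = drop c p" by (rule map_idI)
    then show ?thesis using c' by (simp add: direct_sum_def comp_def)
  qed
  ultimately show "decomposable p" unfolding decomposable_def using c'
    by (intro exI[of _ "take c p"] exI[of _ ?t]) auto
qed

lemma splits_pts_iff_cut:
  assumes "is_perm p" shows "splits (pts p) \<longleftrightarrow> (\<exists>c. cut p c)"
proof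
  let ?f = "\<lambda>i. (int (Suc i), int (p ! i))"
  assume "splits (pts p)"
  then obtain X where X: "init X (pts p)" "X \<noteq> pts p" unfolding splits_def by blast
  define I where "I = {i. i < length p \<and> ?f i \<in> X}"
  have XI: "X = ?f ` I"
  proof -
    have "X \<subseteq> ?f ` {..<length p}" using X(1) unfolding init_def pts_def by blast
    then show ?thesis unfolding I_def by blast
  qed
  have fin: "finite I" by (simp add: I_def)
  have out: "i < j \<and> p ! i < p ! j" if "i \<in> I" "j < length p" "j \<notin> I" for i j
  proof -
    have "?f i \<in> X" "?f j \<in> pts p - X" using that by (auto simp: I_def pts_def)
    then have "sw (?f i) (?f j)" using X unfolding init_def by blast
    then show ?thesis by (simp add: sw_def)
  qed
  define c where "c = card I"
  have "I \<subseteq> {..<c}"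
  proof
    fix i assume i: "i \<in> I"
    have "{..i} \<subseteq> I"
    proof
      fix j assume j: "j \<in> {..i}"
      then have "j < length p" using i by (simp add: I_def)
      then show "j \<in> I" using out[OF i, of j] j by auto
    qed
    then have "card {..i} \<le> c" unfolding c_def by (rule card_mono[OF fin])
    then show "i \<in> {..<c}" by simp
  qed
  then have I: "I = {..<c}" by (rule card_subset_eq[rotated]) (simp_all add: c_def)
  have "p ! i \<le> c" if i: "i < c" for i
  proof -
    have iI: "i \<in> I" using i I by simp
    then have il: "i < length p" by (simp add: I_def)
    have "{1..p ! i} \<subseteq> (!) p ` I"
    proof
      fix w assume w: "w \<in> {1..p ! i}"
      then obtain j where j: "j < length p" "p ! j = w"
        using is_perm_obtain[OF assms, of w] is_perm_nth[OF assms il] by auto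
      then have "j \<in> I" using out[OF iI j(1)] w by (metis atLeastAtMost_iff not_le)
      then show "w \<in> (!) p ` I" using j by auto
    qed
    then have "card {1..p ! i} \<le> card ((!) p ` I)" using fin by (intro card_mono) auto
    also have "\<dots> \<le> c" unfolding c_def by (rule card_image_le[OF fin])
    finally show ?thesis by simp
  qed
  moreover have "0 < c"
  proof -
    have "I \<noteq> {}" using X(1) XI unfolding init_def by blast
    then show ?thesis using fin by (simp add: c_def card_gt_0_iff)
  qed
  moreover have "c < length p"
  proof -
    have "I \<subset> {..<length p}" 
    proof
      show "I \<subseteq> {..<length p}" unfolding I_def by blast
      show "I \<noteq> {..<length p}" using X(2) XI unfolding pts_def by blast
    qed
    then have "card I < card {..<length p}" by (rule psubset_card_mono[rotated]) simp
    then show ?thesis by (simp add: c_def)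
  qed
  ultimately show "\<exists>c. cut p c" by (auto simp: cut_def)
next
  let ?f = "\<lambda>i. (int (Suc i), int (p ! i))"
  assume "\<exists>c. cut p c"
  then obtain c where c: "cut p c" ..
  let ?X = "?f ` {..<c}"
  have sub: "?X \<subseteq> pts p" using c by (auto simp: pts_def cut_def)
  have "sw a b" if ab: "a \<in> ?X" "b \<in> pts p - ?X" for a b
  proof -
    obtain i where i: "i < c" "a = ?f i" using ab(1) by blast
    obtain j where j: "j < length p" "b = ?f j" using ab(2) unfolding pts_def by blast
    have "c \<le> j" using ab(2) j by (auto simp: not_less[symmetric])
    moreover have "p ! i \<le> c" using c i by (simp add: cut_def)
    ultimately show ?thesis using cut_upper[OF assms c _ j(1)] i j by (simp add: sw_def)
  qed
  then have "init ?X (pts p)" using c sub by (auto simp: init_def cut_def)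
  moreover have "card ?X \<noteq> card (pts p)" using c by (subst card_image[OF inj_pt]) (simp add: cut_def)
  then have "?X \<noteq> pts p" by (elim contrapos_nn) simp
  ultimately show "splits (pts p)" unfolding splits_def by blast
qed

lemma decomposable_iff_splits: "is_perm p \<Longrightarrow> decomposable p \<longleftrightarrow> splits (pts p)"
  by (simp add: decomposable_iff_cut splits_pts_iff_cut)

section \<open>Removing a value, inverses and reverse-complements\<close>

lemma order_isoI:
  assumes gen: "generic S" and T: "f ` S = T"
    and x: "\<And>p q. p \<in> S \<Longrightarrow> q \<in> S \<Longrightarrow> fst p < fst q \<Longrightarrow> fst (f p) < fst (f q)"
    and y: "\<And>p q. p \<in> S \<Longrightarrow> q \<in> S \<Longrightarrow> snd p < snd q \<Longrightarrow> snd (f p) < snd (f q)"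
  shows "order_iso S T"
proof -
  have iff: "(fst (f p) < fst (f q) \<longleftrightarrow> fst p < fst q) \<and> (snd (f p) < snd (f q) \<longleftrightarrow> snd p < snd q)"
    if "p \<in> S" "q \<in> S" for p q
  proof (cases "p = q")
    case False
    then show ?thesis
      using x[OF that] x[OF that(2,1)] y[OF that] y[OF that(2,1)] generic_neq[OF gen that False] 
      by linarith
  qed simp
  have "inj_on f S"
  proof (rule inj_onI)
    fix p q assume pq: "p \<in> S" "q \<in> S" "f p = f q"
    then have "\<not> fst p < fst q" "\<not> fst q < fst p" using iff[OF pq(1,2)] iff[OF pq(2,1)] by simp_all
    then show "p = q" using generic_neq(1)[OF gen pq(1,2)] by linarith
  qed
  then have "bij_betw f S T" using T by (simp add: bij_betw_def)
  then show ?thesis unfolding order_iso_def using iff by blast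
qed

text \<open>
  The change of an entry \<open>x \<noteq> v\<close> when the value \<open>v\<close> is removed.
\<close>

definition dec :: "nat \<Rightarrow> nat \<Rightarrow> nat" where
  "dec v x = (if v < x then x - 1 else x)"

lemma remove_value_append:
  assumes p: "is_perm (us @ v # ws)"
  shows "(us @ v # ws) \<smallsetminus> v = map (dec v) (us @ ws)"
proof -
  let ?p = "us @ v # ws"
  have d: "distinct ?p" "set ?p = {1..length ?p}" using p by (simp_all only: is_perm_iff)
  have rem: "removeAll v ?p = us @ ws" using d(1) by (simp add: removeAll_id)
  have st: "set (us @ ws) = {1..length ?p} - {v}" unfolding d(2)[symmetric] using d(1) by auto
  have v: "1 \<le> v" using d(2) by auto
  have "card {y \<in> set (us @ ws). y \<le> x} = dec v x" if x: "x \<in> set (us @ ws)" for x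
  proof -
    have x': "x \<le> length ?p" "x \<noteq> v" using x unfolding st by simp_all
    have "{y \<in> set (us @ ws). y \<le> x} = {1..x} - {v}" unfolding st using x' by auto
    then show ?thesis using x' v by (simp add: dec_def card_Diff_singleton_if)
  qed
  then show ?thesis unfolding remove_value_def rem standardize_def by (intro map_cong) simp_all
qed

lemma is_permI: "{1..length p} \<subseteq> set p \<Longrightarrow> is_perm p"
proof -
  assume a: "{1..length p} \<subseteq> set p"
  then have "length p \<le> card (set p)" using card_mono[OF _ a] by simp
  then have c: "card (set p) = length p" using card_length[of p] by simp
  then have "{1..length p} = set p" using a by (intro card_subset_eq) simp_all
  then show ?thesis using c card_distinct by (simp add: is_perm_iff)
qed

lemma remove_value_perm:
  assumes p: "is_perm p" and v: "v \<in> set p"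
  shows "is_perm (p \<smallsetminus> v)" "length (p \<smallsetminus> v) = length p - 1"
proof -
  obtain us ws where uw: "p = us @ v # ws" using v by (meson split_list)
  have eq: "p \<smallsetminus> v = map (dec v) (us @ ws)" using remove_value_append p uw by simp
  show len: "length (p \<smallsetminus> v) = length p - 1" by (subst eq) (simp add: uw)
  have d: "distinct p" "set p = {1..length p}" using p by (simp_all add: is_perm_iff)
  have st: "set (us @ ws) = {1..length p} - {v}" unfolding d(2)[symmetric] using d(1) uw by auto
  have v': "1 \<le> v" "v \<le> length p" using v unfolding d(2) by auto
  have "{1..length p - 1} \<subseteq> set (p \<smallsetminus> v)"
  proof
    fix y assume y: "y \<in> {1..length p - 1}"
    let ?x = "if v \<le> y then y + 1 else y"
    have "?x \<in> set (us @ ws)" unfolding st using y by auto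
    moreover have "dec v ?x = y" by (simp add: dec_def)
    ultimately show "y \<in> set (p \<smallsetminus> v)" unfolding eq set_map by (metis imageI)
  qed
  then show "is_perm (p \<smallsetminus> v)" using len by (intro is_permI) simp
qed

lemma remove_value_order_iso:
  assumes p: "is_perm p" and v: "k < length p" "p ! k = v"
  shows "order_iso (pts p - {(int (Suc k), int v)}) (pts (p \<smallsetminus> v))"
proof -
  let ?f = "\<lambda>q::int \<times> int. (if int (Suc k) < fst q then fst q - 1 else fst q,
                          if int v < snd q then snd q - 1 else snd q)"
  let ?us = "take k p" and ?ws = "drop (Suc k) p"
  have uw: "p = ?us @ v # ?ws" using v id_take_nth_drop by blast
  have eq: "p \<smallsetminus> v = map (dec v) (?us @ ?ws)" using remove_value_append[of ?us v ?ws] p uw by simp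
  have len: "length (p \<smallsetminus> v) = length p - 1" unfolding eq using v by simp
  have nth: "(p \<smallsetminus> v) ! (dec k j) = dec v (p ! j)" "dec k j < length p - 1" if "j < length p" "j \<noteq> k" for j
  proof -
    show lt: "dec k j < length p - 1" using that v by (auto simp: dec_def)
    then have "(p \<smallsetminus> v) ! (dec k j) = dec v ((?us @ ?ws) ! dec k j)" unfolding eq using v by (subst nth_map) simp_all
    also have "(?us @ ?ws) ! dec k j = p ! j" using that v by (auto simp: dec_def nth_append)
    finally show "(p \<smallsetminus> v) ! (dec k j) = dec v (p ! j)" .
  qed
  have fpt: "?f (int (Suc j), int (p ! j)) = (int (Suc (dec k j)), int ((p \<smallsetminus> v) ! dec k j))"
    if "j < length p" "j \<noteq> k" for j
    unfolding nth(1)[OF that] using that by (auto simp: dec_def)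
  have gen: "generic (pts p)" by (rule generic_pts[OF p])
  have S: "pts p - {(int (Suc k), int v)} = (\<lambda>j. (int (Suc j), int (p ! j))) ` ({..<length p} - {k})"
    using v by (auto simp: pts_def)
  show ?thesis
  proof (rule order_isoI)
    show "generic (pts p - {(int (Suc k), int v)})" by (rule generic_subset[OF gen]) blast
    show "?f ` (pts p - {(int (Suc k), int v)}) = pts (p \<smallsetminus> v)"
    proof (intro equalityI subsetI)
      fix x assume "x \<in> ?f ` (pts p - {(int (Suc k), int v)})"
      then obtain j where j: "j < length p" "j \<noteq> k" "x = ?f (int (Suc j), int (p ! j))"
        unfolding S by blast
      then show "x \<in> pts (p \<smallsetminus> v)" using nth(2)[OF j(1,2)] len
        unfolding j(3) fpt[OF j(1,2)] pts_def by auto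
    next
      fix x assume "x \<in> pts (p \<smallsetminus> v)"
      then obtain i where i: "i < length p - 1" "x = (int (Suc i), int ((p \<smallsetminus> v) ! i))"
        unfolding pts_def len by blast
      let ?j = "if k \<le> i then Suc i else i"
      have j: "?j < length p" "?j \<noteq> k" "dec k ?j = i" using i by (auto simp: dec_def)
      have "x = ?f (int (Suc ?j), int (p ! ?j))" unfolding fpt[OF j(1,2)] j(3) by (rule i(2))
      then show "x \<in> ?f ` (pts p - {(int (Suc k), int v)})" unfolding S using j by blast
    qed
    fix a b assume ab: "a \<in> pts p - {(int (Suc k), int v)}" "b \<in> pts p - {(int (Suc k), int v)}"
    have kv: "(int (Suc k), int v) \<in> pts p" using v by (auto simp: mem_pts)
    have ne: "fst a \<noteq> int (Suc k)" "fst b \<noteq> int (Suc k)" "snd a \<noteq> int v" "snd b \<noteq> int v"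
      using ab generic_neq[OF gen _ kv] by fastforce+
    show "fst (?f a) < fst (?f b)" if "fst a < fst b" using that ne by auto
    show "snd (?f a) < snd (?f b)" if "snd a < snd b" using that ne by auto
  qed
qed

lemma decomposable_remove_value:
  assumes p: "is_perm p" and v: "k < length p" "p ! k = v"
  shows "decomposable (p \<smallsetminus> v) \<longleftrightarrow> splits (pts p - {(int (Suc k), int v)})"
proof -
  have "v \<in> set p" using v by auto
  then show ?thesis
    using order_iso_splits[OF remove_value_order_iso[OF assms]] decomposable_iff_splits remove_value_perm p
    by simp
qed

lemma left_split_iff:
  assumes "u \<in> S" "\<And>q. q \<in> S \<Longrightarrow> q \<noteq> u \<Longrightarrow> fst u < fst q"
  shows "left_split S \<longleftrightarrow> splits (S - {u})"
proof -
  have "w = u" if "w \<in> S" "\<forall>q\<in>S. fst w \<le> fst q" for w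
    using assms(2)[OF that(1)] that(2) assms(1) by (meson linorder_not_less)
  moreover have "\<forall>q\<in>S. fst u \<le> fst q" using assms(2) by (metis less_imp_le order_refl)
  ultimately show ?thesis unfolding left_split_def using assms(1) by metis
qed

lemma pts_bounds:
  assumes "is_perm p" "q \<in> pts p"
  shows "1 \<le> fst q" "fst q \<le> int (length p)" "1 \<le> snd q" "snd q \<le> int (length p)"
proof -
  obtain i where i: "i < length p" "q = (int (Suc i), int (p ! i))" using assms(2) unfolding pts_def by blast
  show "1 \<le> fst q" "fst q \<le> int (length p)" "1 \<le> snd q" "snd q \<le> int (length p)"
    using i is_perm_nth[OF assms(1) i(1)] by simp_all
qed

lemma left_split_pts_iff:
  fixes g :: "int \<times> int \<Rightarrow> int \<times> int"
  assumes p: "is_perm p" and k: "k < length p"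
    and g: "\<And>a. g (g a) = a" and ext: "\<And>q. q \<in> pts p \<Longrightarrow> q \<noteq> (int (Suc k), int (p ! k)) \<Longrightarrow> 
      fst (g (int (Suc k), int (p ! k))) < fst (g q)"
    and sp: "\<And>S. splits (g ` S) \<longleftrightarrow> splits S"
  shows "decomposable (p \<smallsetminus> (p ! k)) \<longleftrightarrow> left_split (g ` pts p)"
proof -
  let ?u = "(int (Suc k), int (p ! k))"
  have inj: "inj g" using g by (metis injI)
  have "?u \<in> pts p" using k by (auto simp: mem_pts)
  then have "left_split (g ` pts p) \<longleftrightarrow> splits (g ` pts p - {g ?u})"
  proof (intro left_split_iff)
    fix q assume q: "q \<in> g ` pts p" "q \<noteq> g ?u"
    then obtain q' where "q' \<in> pts p" "q = g q'" by blast
    then show "fst (g ?u) < fst q" using q ext by blast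
  qed blast
  also have "g ` pts p - {g ?u} = g ` (pts p - {?u})"
    using inj by (simp add: image_set_diff)
  also have "splits \<dots> \<longleftrightarrow> decomposable (p \<smallsetminus> (p ! k))"
    using sp decomposable_remove_value[OF p k refl] by simp
  finally show ?thesis by simp
qed

lemma decomposable_remove_extremes:
  assumes p: "is_perm p" and ne: "p \<noteq> []"
  shows "decomposable (p \<smallsetminus> hd p) \<longleftrightarrow> left_split (pts p)"
    and "decomposable (p \<smallsetminus> 1) \<longleftrightarrow> left_split (prod.swap ` pts p)"
    and "decomposable (p \<smallsetminus> last p) \<longleftrightarrow> left_split (reflect N ` pts p)"
    and "decomposable (p \<smallsetminus> length p) \<longleftrightarrow> left_split (prod.swap ` reflect N ` pts p)"
proof -
  let ?n = "length p"
  have n: "0 < ?n" using ne by simp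
  note gen = generic_pts[OF p] and b = pts_bounds[OF p]
  have mem: "(int (Suc k), int (p ! k)) \<in> pts p" if "k < ?n" for k using that by (auto simp: mem_pts)
  show "decomposable (p \<smallsetminus> hd p) \<longleftrightarrow> left_split (pts p)"
  proof -
    have "decomposable (p \<smallsetminus> (p ! 0)) \<longleftrightarrow> left_split ((\<lambda>x. x) ` pts p)"
    proof (rule left_split_pts_iff[OF p n])
      fix q assume "q \<in> pts p" "q \<noteq> (int (Suc 0), int (p ! 0))"
      then show "fst (int (Suc 0), int (p ! 0)) < fst q"
        using generic_neq(1)[OF gen _ mem[OF n]] b(1)[of q] by fastforce
    qed simp_all
    then show ?thesis using ne by (simp add: hd_conv_nth)
  qed
  show "decomposable (p \<smallsetminus> last p) \<longleftrightarrow> left_split (reflect N ` pts p)"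
  proof -
    have n': "?n - 1 < ?n" using n by simp
    have "decomposable (p \<smallsetminus> (p ! (?n - 1))) \<longleftrightarrow> left_split (reflect N ` pts p)"
    proof (rule left_split_pts_iff[OF p n'])
      fix q assume "q \<in> pts p" "q \<noteq> (int (Suc (?n - 1)), int (p ! (?n - 1)))"
      then show "fst (reflect N (int (Suc (?n - 1)), int (p ! (?n - 1)))) < fst (reflect N q)"
        using generic_neq(1)[OF gen _ mem[OF n']] b(2)[of q] n by fastforce
    qed simp_all
    then show ?thesis using ne by (simp add: last_conv_nth)
  qed
  show "decomposable (p \<smallsetminus> 1) \<longleftrightarrow> left_split (prod.swap ` pts p)"
  proof -
    obtain k where k: "k < ?n" "p ! k = 1" using is_perm_obtain[OF p, of 1] n by auto
    have "decomposable (p \<smallsetminus> (p ! k)) \<longleftrightarrow> left_split (prod.swap ` pts p)"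
    proof (rule left_split_pts_iff[OF p k(1)])
      fix q assume "q \<in> pts p" "q \<noteq> (int (Suc k), int (p ! k))"
      then show "fst (prod.swap (int (Suc k), int (p ! k))) < fst (prod.swap q)"
        using generic_neq(2)[OF gen _ mem[OF k(1)]] b(3)[of q] k by fastforce
    qed simp_all
    then show ?thesis using k by simp
  qed
  show "decomposable (p \<smallsetminus> length p) \<longleftrightarrow> left_split (prod.swap ` reflect N ` pts p)"
  proof -
    obtain k where k: "k < ?n" "p ! k = ?n" using is_perm_obtain[OF p, of ?n] n by auto
    have "decomposable (p \<smallsetminus> (p ! k)) \<longleftrightarrow> left_split ((\<lambda>x. prod.swap (reflect N x)) ` pts p)"
    proof (rule left_split_pts_iff[OF p k(1)])
      fix q assume "q \<in> pts p" "q \<noteq> (int (Suc k), int (p ! k))"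
      then show "fst (prod.swap (reflect N (int (Suc k), int (p ! k)))) < fst (prod.swap (reflect N q))"
        using generic_neq(2)[OF gen _ mem[OF k(1)]] b(4)[of q] k by fastforce
    next
      show "splits ((\<lambda>x. prod.swap (reflect N x)) ` S) \<longleftrightarrow> splits S" for S
        using splits_swap[of "reflect N ` S"] by (simp add: image_image)
    qed (simp_all add: reflect_def)
    then show ?thesis using k by (simp add: image_image)
  qed
qed

lemma extremal_splits_iff:
  assumes "is_perm p" "p \<noteq> []"
  shows "(\<exists>e. extremal e (pts p) \<and> splits (pts p - {e})) \<longleftrightarrow>
    left_split (pts p) \<or> left_split (prod.swap ` pts p) \<or> left_split (reflect N ` pts p) \<or>
    left_split (prod.swap ` reflect N ` pts p)" (is "?L \<longleftrightarrow> ?R")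
proof -
  let ?S = "pts p"
  have im: "g ` ?S - {g e} = g ` (?S - {e})" if "inj g" for g :: "int \<times> int \<Rightarrow> int \<times> int" and e
    using that by (simp add: image_set_diff)
  have inj: "inj (\<lambda>x. x :: int \<times> int)" "inj (prod.swap :: int \<times> int \<Rightarrow> _)" "inj (reflect N)"
    "inj (\<lambda>x. prod.swap (reflect N x))"
    by (auto simp: inj_def prod_eq_iff)
  have sp: "splits ((\<lambda>x. prod.swap (reflect N x)) ` S) \<longleftrightarrow> splits S" for S
    using splits_swap[of "reflect N ` S"] by (simp add: image_image)
  have ls: "left_split (g ` ?S) \<longleftrightarrow> (\<exists>e\<in>?S. (\<forall>q\<in>?S. fst (g e) \<le> fst (g q)) \<and> splits (g ` (?S - {e})))"
    if "inj g" for g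
    unfolding left_split_def by (simp add: im[OF that])
  have "?R \<longleftrightarrow> left_split ((\<lambda>x. x) ` ?S) \<or> left_split (prod.swap ` ?S) \<or> left_split (reflect N ` ?S) \<or>
    left_split ((\<lambda>x. prod.swap (reflect N x)) ` ?S)" by (simp add: image_image)
  also have "\<dots> \<longleftrightarrow> ?L"
    unfolding inj[THEN ls] by (simp add: extremal_def sp del: split_paired_Ex split_paired_All) blast
  finally show ?thesis by simp
qed

lemma almost_decomposable_iff:
  assumes "is_perm p"
  shows "almost_decomposable p \<longleftrightarrow> p \<noteq> [] \<and> \<not> splits (pts p) \<and>
    (\<exists>e. extremal e (pts p) \<and> splits (pts p - {e}))"
  using assms decomposable_remove_extremes(1,2)[OF assms]
    decomposable_remove_extremes(3,4)[OF assms, of 0] extremal_splits_iff[OF assms, of 0]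
  by (auto simp: almost_decomposable_def decomposable_iff_splits)

lemma length_inverse_perm [simp]: "length (inverse_perm p) = length p"
  and length_reverse_complement [simp]: "length (reverse_complement p) = length p"
  by (simp_all add: inverse_perm_def reverse_complement_def del: upt_Suc)

lemma inverse_perm_nth:
  assumes p: "is_perm p" and i: "i < length p"
  shows "inverse_perm p ! (p ! i - 1) = Suc i"
proof -
  have v: "1 \<le> p ! i" "p ! i \<le> length p" using is_perm_nth[OF p i] by auto
  have "(THE j. j < length p \<and> p ! j = p ! i) = i"
    by (rule the_equality) (use i is_perm_nth_eq[OF p] in auto)
  moreover have "inverse_perm p ! (p ! i - 1) = Suc (THE j. j < length p \<and> p ! j = [1..<Suc (length p)] ! (p ! i - 1))"
    unfolding inverse_perm_def by (subst nth_map) (use v in auto)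
  moreover have "[1..<Suc (length p)] ! (p ! i - 1) = p ! i" using v by (simp del: upt_Suc)
  ultimately show ?thesis by simp
qed

lemma is_perm_inverse_perm:
  assumes p: "is_perm p" shows "is_perm (inverse_perm p)"
proof (rule is_permI, rule subsetI)
  fix x assume "x \<in> {1..length (inverse_perm p)}"
  then have i: "x - 1 < length p" "Suc (x - 1) = x" by auto
  have "p ! (x - 1) - 1 < length p" using is_perm_nth[OF p i(1)] i by auto
  then show "x \<in> set (inverse_perm p)" using inverse_perm_nth[OF p i(1)] i(2)
    by (metis length_inverse_perm nth_mem)
qed

lemma pts_inverse_perm:
  assumes p: "is_perm p" shows "pts (inverse_perm p) = prod.swap ` pts p"
proof -
  have "prod.swap ` pts p \<subseteq> pts (inverse_perm p)"
  proof
    fix x assume "x \<in> prod.swap ` pts p"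
    then obtain i where i: "i < length p" "x = (int (p ! i), int (Suc i))" unfolding pts_def by auto
    have "1 \<le> p ! i" "p ! i \<le> length p" using is_perm_nth[OF p i(1)] by auto
    then show "x \<in> pts (inverse_perm p)" using i inverse_perm_nth[OF p i(1)]
      by (auto simp: mem_pts intro!: exI[of _ "p ! i - 1"])
  qed
  moreover have "card (prod.swap ` pts p) = card (pts (inverse_perm p))" by (simp add: card_image)
  ultimately show ?thesis using card_subset_eq[OF finite_pts] by metis
qed

lemma reverse_complement_nth:
  "i < length p \<Longrightarrow> reverse_complement p ! i = length p + 1 - p ! (length p - Suc i)"
  by (simp add: reverse_complement_def rev_nth)

lemma pts_reverse_complement:
  assumes p: "is_perm p" shows "pts (reverse_complement p) = reflect (int (length p) + 1) ` pts p"
proof -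
  have "reflect (int (length p) + 1) ` pts p \<subseteq> pts (reverse_complement p)"
  proof
    fix x assume "x \<in> reflect (int (length p) + 1) ` pts p"
    then obtain i where i: "i < length p"
      "x = (int (length p) + 1 - int (Suc i), int (length p) + 1 - int (p ! i))"
      unfolding pts_def reflect_def by auto
    let ?j = "length p - Suc i"
    have "?j < length p" "length p - Suc ?j = i" using i by auto
    moreover have "p ! i \<le> length p" using is_perm_nth[OF p i(1)] by auto
    ultimately show "x \<in> pts (reverse_complement p)" using i reverse_complement_nth[of ?j p]
      by (auto simp: mem_pts of_nat_diff intro!: exI[of _ ?j])
  qed
  moreover have "card (reflect (int (length p) + 1) ` pts p) = card (pts (reverse_complement p))"
    by (simp add: card_image)
  ultimately show ?thesis using card_subset_eq[OF finite_pts] by metis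
qed

lemma is_perm_reverse_complement:
  assumes p: "is_perm p" shows "is_perm (reverse_complement p)"
proof (rule is_permI, rule subsetI)
  fix x assume "x \<in> {1..length (reverse_complement p)}"
  then have x: "1 \<le> x" "x \<le> length p" by auto
  then have "1 \<le> length p + 1 - x" "length p + 1 - x \<le> length p" by auto
  then obtain i where i: "i < length p" "p ! i = length p + 1 - x"
    using is_perm_obtain[OF p] by blast
  let ?j = "length p - Suc i"
  have "?j < length p" "length p - Suc ?j = i" using i by auto
  then have "reverse_complement p ! ?j = x" using reverse_complement_nth[of ?j p] i x by simp
  then show "x \<in> set (reverse_complement p)" using \<open>?j < length p\<close>
    by (metis length_reverse_complement nth_mem)
qed

lemma inverse_perm_inverse_perm: "is_perm p \<Longrightarrow> inverse_perm (inverse_perm p) = p"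
  by (rule pts_inject) (simp add: pts_inverse_perm is_perm_inverse_perm)

lemma reverse_complement_reverse_complement:
  "is_perm p \<Longrightarrow> reverse_complement (reverse_complement p) = p"
  by (rule pts_inject) (simp add: pts_reverse_complement is_perm_reverse_complement)

section \<open>Expansions\<close>

text \<open>
  Coordinates are doubled to make room for a coordinate between two consecutive integers.
\<close>

definition double :: "int \<times> int \<Rightarrow> int \<times> int" where
  "double q = (2 * fst q, 2 * snd q)"

lemma double_simps [simp]: "fst (double q) = 2 * fst q" "snd (double q) = 2 * snd q"
  "sw (double p) (double q) \<longleftrightarrow> sw p q" "nw (double p) (double q) \<longleftrightarrow> nw p q"
  by (simp_all add: double_def sw_def nw_def)

lemma double_eq_iff [simp]: "double p = double q \<longleftrightarrow> p = q"
  by (simp add: double_def prod_eq_iff)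

text \<open>
  Delete \<open>w\<close> from \<open>T\<close> and lift \<open>u\<close> by \<open>3/2\<close>, so that in a permutation it passes exactly the next higher
  value.
\<close>

definition raise :: "int \<times> int \<Rightarrow> int \<times> int \<Rightarrow> (int \<times> int) set \<Rightarrow> (int \<times> int) set" where
  "raise u w T = insert (2 * fst u, 2 * snd u + 3) (double ` (T - {u, w}))"

text \<open>
  The shape of an image of \<open>f\<close> in case (1): \<open>u\<close> is leftmost but not highest, \<open>w\<close> is southeast of it, and the
  other points are southwest or northeast of \<open>w\<close>, with both kinds occurring.
\<close>

definition frame :: "int \<times> int \<Rightarrow> int \<times> int \<Rightarrow> (int \<times> int) set \<Rightarrow> bool" where
  "frame u w T \<longleftrightarrow> u \<in> T \<and> w \<in> T \<and> nw u w \<and> (\<forall>q\<in>T. q \<noteq> u \<longrightarrow> fst u < fst q) \<and>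
     (\<exists>q\<in>T. snd u < snd q) \<and> (\<forall>q\<in>T. q \<noteq> u \<longrightarrow> q \<noteq> w \<longrightarrow> sw q w \<or> sw w q) \<and>
     (\<exists>q\<in>T. sw q w) \<and> (\<exists>q\<in>T. sw w q)"

text \<open>
  The relation between the points \<open>S\<close> of \<open>p\<close> and \<open>T\<close> of \<open>f(p)\<close> in case (1). The equation
  between coordinates holds because exactly \<open>u\<close> and the points below \<open>w\<close> are left of \<open>w\<close>.
\<close>

definition expansion :: "(int \<times> int) set \<Rightarrow> (int \<times> int) set \<Rightarrow> bool" where
  "expansion S T \<longleftrightarrow> (\<exists>u w. frame u w T \<and> fst w = snd w + 1 \<and> order_iso S (raise u w T))"

lemma sw_irrefl: "\<not> sw p p" and sw_trans: "sw p q \<Longrightarrow> sw q r \<Longrightarrow> sw p r"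
  and sw_asym: "sw p q \<Longrightarrow> \<not> sw q p" and sw_not_nw: "sw p q \<Longrightarrow> \<not> nw p q \<and> \<not> nw q p"
  and nw_irrefl: "\<not> nw p p"
  by (auto simp: sw_def nw_def)

text \<open>
  A point comparable to all others that is neither first nor last; it separates two adjacent cuts.
\<close>

definition pivot :: "int \<times> int \<Rightarrow> (int \<times> int) set \<Rightarrow> bool" where
  "pivot r T \<longleftrightarrow> r \<in> T \<and> (\<forall>q\<in>T. q \<noteq> r \<longrightarrow> sw q r \<or> sw r q) \<and> (\<exists>q\<in>T. sw q r) \<and> (\<exists>q\<in>T. sw r q)"

lemma pivot_avoids1324:
  assumes pv: "pivot r T" and av: "avoids1324 (T - {r})"
  shows "avoids1324 T"
  unfolding avoids1324_def
proof (rule notI, elim bexE conjE)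
  fix a b c d assume T: "a \<in> T" "b \<in> T" "c \<in> T" "d \<in> T"
    and p: "sw a b" "sw a c" "nw b c" "sw b d" "sw c d"
  have cmp: "\<And>q. q \<in> T \<Longrightarrow> q \<noteq> r \<Longrightarrow> sw q r \<or> sw r q"
    using pv unfolding pivot_def by blast
  obtain lo hi where lo: "lo \<in> T" "sw lo r" and hi: "hi \<in> T" "sw r hi"
    using pv unfolding pivot_def by blast
  have ne: "lo \<noteq> r" "hi \<noteq> r" using lo hi sw_irrefl by blast+
  have "b \<noteq> r" using cmp[OF T(3)] p(3) nw_irrefl sw_not_nw by blast
  moreover have "c \<noteq> r" using cmp[OF T(2)] p(3) nw_irrefl sw_not_nw by blast
  moreover have "\<exists>a'\<in>T - {r}. sw a' b \<and> sw a' c"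
    using T(1) p lo ne sw_trans by (cases "a = r") blast+
  moreover have "\<exists>d'\<in>T - {r}. sw b d' \<and> sw c d'"
    using T(4) p hi ne sw_trans by (cases "d = r") blast+
  ultimately show False using av T p(3) unfolding avoids1324_def by blast
qed

lemma expansion_avoids1324:
  assumes ex: "expansion S T" and av: "avoids1324 S"
  shows "avoids1324 T"
proof -
  obtain u w where fr: "frame u w T" and iso: "order_iso S (raise u w T)"
    using ex unfolding expansion_def by blast
  have u: "u \<in> T" "w \<in> T" "nw u w" and left: "\<And>q. q \<in> T \<Longrightarrow> q \<noteq> u \<Longrightarrow> fst u < fst q"
    and cmp: "\<And>q. q \<in> T \<Longrightarrow> q \<noteq> u \<Longrightarrow> q \<noteq> w \<Longrightarrow> sw q w \<or> sw w q"
    using fr unfolding frame_def by blast+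
  obtain lo hi where lo: "lo \<in> T" "sw lo w" and hi: "hi \<in> T" "sw w hi"
    using fr unfolding frame_def by blast
  have ne: "lo \<noteq> u" "hi \<noteq> u" "w \<noteq> u"
    using lo hi u(3) nw_irrefl sw_not_nw by blast+
  have "avoids1324 (T - {u} - {w})"
    unfolding avoids1324_def
  proof (rule notI, elim bexE conjE)
    fix a b c d assume T: "a \<in> T - {u} - {w}" "b \<in> T - {u} - {w}" "c \<in> T - {u} - {w}" "d \<in> T - {u} - {w}"
      and p: "sw a b" "sw a c" "nw b c" "sw b d" "sw c d"
    have "double a \<in> raise u w T" "double b \<in> raise u w T" "double c \<in> raise u w T" "double d \<in> raise u w T"
      using T unfolding raise_def by blast+
    moreover have "avoids1324 (raise u w T)" using order_iso_imp(2)[OF order_iso_sym[OF iso] av] .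
    moreover have "sw (double a) (double b)" "sw (double a) (double c)" "nw (double b) (double c)"
      "sw (double b) (double d)" "sw (double c) (double d)" using p by simp_all
    ultimately show False unfolding avoids1324_def by blast
  qed
  moreover have "pivot w (T - {u})"
    unfolding pivot_def using u ne lo hi cmp by blast
  ultimately have avu: "avoids1324 (T - {u})" by (rule pivot_avoids1324[rotated])
  have not_u: "q \<noteq> u" if "p \<in> T" "fst p < fst q" for p q using left[of p] that by fastforce
  show ?thesis
    unfolding avoids1324_def
  proof (rule notI, elim bexE conjE)
    fix a b c d assume T: "a \<in> T" "b \<in> T" "c \<in> T" "d \<in> T"
      and p: "sw a b" "sw a c" "nw b c" "sw b d" "sw c d"
    have nu: "b \<noteq> u" "c \<noteq> u" "d \<noteq> u"
      using not_u[OF T(1)] not_u[OF T(2)] p by (simp_all add: sw_def)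
    have above: "sw lo q" if "q \<in> T" "sw u q" for q
    proof -
      have "q \<noteq> w" "q \<noteq> u" "\<not> sw q w" using that(2) u(3) by (auto simp: sw_def nw_def)
      then have "sw w q" using cmp[OF that(1)] by blast
      then show ?thesis using lo(2) sw_trans by blast
    qed
    have "\<exists>a'\<in>T - {u}. sw a' b \<and> sw a' c"
      using T p lo ne above by (cases "a = u") blast+
    then show False using avu T p nu unfolding avoids1324_def by blast
  qed
qed

text \<open>
  A pivot \<open>r\<close> of \<open>T\<close> must be northeast of \<open>u\<close> and \<open>w\<close>. After the deletion of \<open>w\<close> and the lifting of \<open>u\<close>, the
  points up to and including \<open>r\<close> still are southwest of the rest, even if \<open>u\<close> has passed \<open>r\<close>.
\<close>

lemma expansion_no_pivot:
  assumes ex: "expansion S T" and ns: "\<not> splits S"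
  shows "\<not> pivot r T"
proof
  assume pv: "pivot r T"
  obtain u w where fr: "frame u w T" and iso: "order_iso S (raise u w T)"
    using ex unfolding expansion_def by blast
  have u: "u \<in> T" "w \<in> T" "nw u w" and left: "\<And>q. q \<in> T \<Longrightarrow> q \<noteq> u \<Longrightarrow> fst u < fst q"
    using fr unfolding frame_def by blast+
  have r: "r \<in> T" and cmp: "\<And>q. q \<in> T \<Longrightarrow> q \<noteq> r \<Longrightarrow> sw q r \<or> sw r q"
    using pv unfolding pivot_def by blast+
  obtain lo hi where lo: "lo \<in> T" "sw lo r" and hi: "hi \<in> T" "sw r hi"
    using pv unfolding pivot_def by blast
  have ru: "r \<noteq> u"
  proof
    assume "r = u"
    then show False using left[OF lo(1)] lo(2) by (cases "lo = u") (simp_all add: sw_def)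
  qed
  have rw: "r \<noteq> w" using cmp[OF u(1)] u(3) nw_irrefl sw_not_nw by blast
  have "\<not> sw r u" using left[OF r ru] by (simp add: sw_def)
  then have ur: "sw u r" using cmp[OF u(1)] ru by blast
  have "\<not> sw r w" if "sw r w" using sw_trans[OF ur that] u(3) sw_not_nw by blast
  then have wr: "sw w r" using cmp[OF u(2)] rw by blast
  let ?u = "(2 * fst u, 2 * snd u + 3)"
  let ?X = "insert ?u (double ` {q \<in> T - {u, w}. sw q r \<or> q = r})"
  have hi': "hi \<in> T - {u, w}" using hi ur wr sw_asym by blast
  have nX: "q' \<in> double ` {q \<in> T - {u, w}. sw r q}" if "q' \<in> raise u w T - ?X" for q'
  proof -
    obtain q where q: "q' = double q" "q \<in> T - {u, w}" using \<open>q' \<in> raise u w T - ?X\<close> unfolding raise_def by blast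
    then have "\<not> (sw q r \<or> q = r)" using \<open>q' \<in> raise u w T - ?X\<close> by blast
    then show ?thesis using cmp q by blast
  qed
  have "sw a b" if a: "a \<in> ?X" and b: "b \<in> raise u w T - ?X" for a b
  proof -
    obtain q where q: "b = double q" "q \<in> T" "sw r q" using nX[OF b] by blast
    consider "a = ?u" | p where "a = double p" "sw p r \<or> p = r" using a by blast
    then show ?thesis
    proof cases
      case 1
      then show ?thesis using ur q by (simp add: sw_def)
    next
      case 2
      then have "sw p q" using q(3) sw_trans by blast
      then show ?thesis using q(1) 2(1) by simp
    qed
  qed
  moreover have "?X \<subseteq> raise u w T" unfolding raise_def by blast
  ultimately have "init ?X (raise u w T)" unfolding init_def by blast
  moreover have "double hi \<notin> ?X"
  proof
    assume "double hi \<in> ?X"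
    then consider "double hi = ?u" | p where "double hi = double p" "sw p r \<or> p = r" by blast
    then show False
    proof cases
      case 1
      then show ?thesis using hi ur by (simp add: double_def sw_def)
    next
      case 2
      then show ?thesis using hi(2) sw_asym sw_irrefl by auto
    qed
  qed
  moreover have "double hi \<in> raise u w T" using hi' unfolding raise_def by blast
  ultimately have "splits (raise u w T)" unfolding splits_def by blast
  then show False using ns order_iso_splits[OF iso] by blast
qed

text \<open>
  For permutations: the position of the entry 1 is smaller than the first entry.
\<close>

lemma expansion_bottom_left:
  assumes ex: "expansion S T" and b: "b \<in> T" "\<forall>q\<in>T. snd b \<le> snd q" and v: "v \<in> T" "\<forall>q\<in>T. fst v \<le> fst q"
  shows "fst b < snd v"
proof -
  obtain u w where fr: "frame u w T" and w: "fst w = snd w + 1"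
    using ex unfolding expansion_def by blast
  have u: "u \<in> T" "w \<in> T" "nw u w" and left: "\<And>q. q \<in> T \<Longrightarrow> q \<noteq> u \<Longrightarrow> fst u < fst q"
    and cmp: "\<And>q. q \<in> T \<Longrightarrow> q \<noteq> u \<Longrightarrow> q \<noteq> w \<Longrightarrow> sw q w \<or> sw w q"
    using fr unfolding frame_def by blast+
  obtain lo where lo: "lo \<in> T" "sw lo w" using fr unfolding frame_def by blast
  have vu: "v = u" using left[OF v(1)] bspec[OF v(2) u(1)] by fastforce
  have bw: "snd b < snd w" using bspec[OF b(2) lo(1)] lo(2) by (simp add: sw_def)
  then have "b \<noteq> u" "b \<noteq> w" "\<not> sw w b" using u(3) by (auto simp: nw_def sw_def)
  then have "sw b w" using cmp[OF b(1)] by blast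
  then show ?thesis using w u(3) by (simp add: vu sw_def nw_def)
qed

text \<open>
  Delete \<open>r\<close> and move \<open>v\<close> to \<open>v'\<close>. As both coordinates of \<open>v'\<close> exceed those of \<open>w\<close> minus one (in doubled
  coordinates: minus two), the points southwest of \<open>w\<close> remain southwest of everything but \<open>u\<close>.
\<close>

lemma frame_left_split:
  assumes fr: "frame u w T" and v: "v \<in> T" "v \<noteq> u" "sw w v" and r: "r \<noteq> u" "\<not> sw r w"
    and v': "2 * fst w - 1 \<le> fst v'" "2 * snd w - 1 \<le> snd v'"
  shows "left_split (insert v' (double ` (T - {v, r})))" (is "left_split ?K")
proof -
  have u: "u \<in> T" "w \<in> T" "nw u w" and left: "\<And>q. q \<in> T \<Longrightarrow> q \<noteq> u \<Longrightarrow> fst u < fst q"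
    and cmp: "\<And>q. q \<in> T \<Longrightarrow> q \<noteq> u \<Longrightarrow> q \<noteq> w \<Longrightarrow> sw q w \<or> sw w q"
    using fr unfolding frame_def by blast+
  obtain lo where lo: "lo \<in> T" "sw lo w" using fr unfolding frame_def by blast
  have uK: "double u \<in> ?K" using u v r by blast
  have v'u: "v' \<noteq> double u" using v'(1) u(3) by (auto simp: nw_def)
  have "fst (double u) < fst q" if q: "q \<in> ?K" "q \<noteq> double u" for q
  proof -
    consider "q = v'" | q' where "q = double q'" "q' \<in> T" "q' \<noteq> u" using q by blast
    then show ?thesis
    proof cases
      case 1
      then show ?thesis using v'(1) u(3) by (simp add: nw_def)
    next
      case 2
      then show ?thesis using left by simp
    qed
  qed
  then have iff: "left_split ?K \<longleftrightarrow> splits (?K - {double u})" by (rule left_split_iff[OF uK])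
  let ?X = "double ` {q \<in> T. sw q w}"
  have "\<not> sw u w" "\<not> sw v w" using u(3) v(3) sw_not_nw sw_asym by blast+
  then have XK: "?X \<subseteq> ?K - {double u}" using r(2) by auto
  have v'X: "sw a v'" if a: "a \<in> ?X" for a
  proof -
    obtain q where "a = double q" "sw q w" using a by blast
    then show ?thesis using v' by (simp add: sw_def)
  qed
  have "sw a b" if a: "a \<in> ?X" and b: "b \<in> ?K - {double u} - ?X" for a b
  proof -
    obtain q where q: "a = double q" "sw q w" using a by blast
    consider "b = v'" | q' where "b = double q'" "q' \<in> T" "q' \<noteq> u" using b by blast
    then show ?thesis
    proof cases
      case 1
      then show ?thesis using v'X[OF a] by simp
    next
      case 2
      then have "\<not> sw q' w" using b by blast
      then have "q' = w \<or> sw w q'" using cmp 2 by blast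
      then have "sw q q'" using q(2) sw_trans by blast
      then show ?thesis using q 2 by simp
    qed
  qed
  moreover have "?X \<noteq> {}" using lo by blast
  ultimately have "init ?X (?K - {double u})" using XK unfolding init_def by blast
  moreover have "v' \<notin> ?X" using v'X sw_irrefl by blast
  then have "?X \<noteq> ?K - {double u}" using v'u by blast
  ultimately show ?thesis unfolding iff splits_def by blast
qed

lemma order_iso_reflect:
  assumes "order_iso S T" shows "order_iso (reflect N ` S) (reflect M ` T)"
proof -
  obtain f where f: "bij_betw f S T"
    and iff: "\<And>p q. p \<in> S \<Longrightarrow> q \<in> S \<Longrightarrow> (fst (f p) < fst (f q) \<longleftrightarrow> fst p < fst q) \<and> (snd (f p) < snd (f q) \<longleftrightarrow> snd p < snd q)"
    using assms unfolding order_iso_def by blast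
  have "bij_betw (reflect N) (reflect N ` S) S" by (rule bij_betw_imageI) simp_all
  moreover have "bij_betw (reflect M) T (reflect M ` T)" by (rule bij_betw_imageI) simp_all
  ultimately have "bij_betw (reflect M \<circ> (f \<circ> reflect N)) (reflect N ` S) (reflect M ` T)"
    using f bij_betw_trans by blast
  then show ?thesis unfolding order_iso_def using iff by (intro exI conjI) auto
qed

lemma order_iso_swap:
  assumes "order_iso S T" shows "order_iso (prod.swap ` S) (prod.swap ` T)"
proof -
  obtain f where f: "bij_betw f S T"
    and iff: "\<And>p q. p \<in> S \<Longrightarrow> q \<in> S \<Longrightarrow> (fst (f p) < fst (f q) \<longleftrightarrow> fst p < fst q) \<and> (snd (f p) < snd (f q) \<longleftrightarrow> snd p < snd q)"
    using assms unfolding order_iso_def by blast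
  have "bij_betw prod.swap (prod.swap ` S) S" by (rule bij_betw_imageI) simp_all
  moreover have "bij_betw prod.swap T (prod.swap ` T)" by (rule bij_betw_imageI) simp_all
  ultimately have "bij_betw (prod.swap \<circ> (f \<circ> prod.swap)) (prod.swap ` S) (prod.swap ` T)"
    using f bij_betw_trans by blast
  then show ?thesis unfolding order_iso_def using iff by (intro exI conjI) auto
qed

text \<open>
  If \<open>T\<close> is the image of one set in case (1) and, up to a half turn, the image of another set \<open>S'\<close> in case
  (1), respectively (2) in the lemma after this one, then the half turn of \<open>S'\<close> falls under case (1).
\<close>

lemma expansion_reflect_left_split:
  assumes ex: "expansion S T" and ex': "expansion S' (reflect N ` T)"
  shows "left_split (reflect M ` S')"
proof -
  obtain u w where fr: "frame u w T" using ex unfolding expansion_def by blast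
  obtain v0 r0 where fr': "frame v0 r0 (reflect N ` T)" and iso: "order_iso S' (raise v0 r0 (reflect N ` T))"
    using ex' unfolding expansion_def by blast
  define v r where "v = reflect N v0" and "r = reflect N r0"
  have vr0: "v0 = reflect N v" "r0 = reflect N r" by (simp_all add: v_def r_def)
  have inT: "reflect N x \<in> reflect N ` T \<longleftrightarrow> x \<in> T" for x using inj_reflect by (rule inj_image_mem_iff)
  have eqr: "reflect N x = reflect N y \<longleftrightarrow> x = y" for x y using inj_reflect by (rule inj_eq)
  have v: "v \<in> T" "r \<in> T" "nw r v" and right: "\<And>q. q \<in> T \<Longrightarrow> q \<noteq> v \<Longrightarrow> fst q < fst v"
    and cmp: "\<And>q. q \<in> T \<Longrightarrow> q \<noteq> v \<Longrightarrow> q \<noteq> r \<Longrightarrow> sw q r \<or> sw r q"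
    using fr' unfolding frame_def vr0 by (simp_all add: inT eqr del: split_paired_All) blast+
  have u: "u \<in> T" "w \<in> T" "nw u w" and cmpw: "\<And>q. q \<in> T \<Longrightarrow> q \<noteq> u \<Longrightarrow> q \<noteq> w \<Longrightarrow> sw q w \<or> sw w q"
    using fr unfolding frame_def by blast+
  obtain hi where hi: "hi \<in> T" "sw w hi" using fr unfolding frame_def by blast
  have vu: "v \<noteq> u" using right[OF u(2)] u(3) by (cases "w = u") (auto simp: nw_def)
  have vw: "v \<noteq> w" using right[OF hi(1)] hi(2) by (cases "hi = w") (auto simp: sw_def)
  have "\<not> sw v w" using right[OF u(2)] vw by (auto simp: sw_def)
  then have wv: "sw w v" using cmpw[OF v(1) vu vw] by blast
  have "left_split (insert (2 * fst v, 2 * snd v - 3) (double ` (T - {v, r})))"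
  proof (rule frame_left_split[OF fr v(1) vu wv])
    show "\<not> sw r w" using v(3) wv by (simp add: sw_def nw_def)
    show "r \<noteq> u" using cmp[OF u(2)] vw u(3) nw_irrefl sw_not_nw by blast
  qed (use wv in \<open>simp_all add: sw_def\<close>)
  moreover have "reflect (2 * N) ` raise v0 r0 (reflect N ` T) =
    insert (2 * fst v, 2 * snd v - 3) (double ` (T - {v, r}))"
  proof -
    have "reflect N ` T - {v0, r0} = reflect N ` (T - {v, r})"
      unfolding vr0 by (simp add: image_set_diff[OF inj_reflect])
    moreover have "reflect (2 * N) (double (reflect N q)) = double q" for q
      by (simp add: reflect_def double_def)
    ultimately show ?thesis unfolding raise_def by (simp add: image_image vr0) (simp add: reflect_def)
  qed
  ultimately show ?thesis
    using order_iso_left_split[OF order_iso_sym[OF order_iso_reflect[OF iso]]] by metis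
qed

lemma expansion_swap_reflect_left_split:
  assumes ex: "expansion S T" and ex': "expansion (prod.swap ` S') (prod.swap ` reflect N ` T)"
  shows "left_split (reflect M ` S')"
proof -
  let ?g = "\<lambda>x. prod.swap (reflect N x)"
  have g: "prod.swap ` reflect N ` T = ?g ` T" by (simp add: image_image)
  have gg: "?g (?g x) = x" for x by (simp add: reflect_def)
  then have injg: "inj ?g" by (metis injI)
  obtain u w where fr: "frame u w T" using ex unfolding expansion_def by blast
  obtain v0 r0 where fr': "frame v0 r0 (?g ` T)" and iso: "order_iso (prod.swap ` S') (raise v0 r0 (?g ` T))"
    using ex' unfolding expansion_def g by blast
  define v r where "v = ?g v0" and "r = ?g r0"
  have vr0: "v0 = ?g v" "r0 = ?g r" using gg by (simp_all add: v_def r_def)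
  have inT: "?g x \<in> ?g ` T \<longleftrightarrow> x \<in> T" for x using injg by (rule inj_image_mem_iff)
  have v: "v \<in> T" "r \<in> T" "nw v r" and top: "\<And>q. q \<in> T \<Longrightarrow> q \<noteq> v \<Longrightarrow> snd q < snd v"
  proof -
    show "v \<in> T" "r \<in> T" "nw v r" using fr' inT unfolding frame_def vr0 by simp_all
    fix q assume q: "q \<in> T" "q \<noteq> v"
    then have "?g q \<in> ?g ` T" "?g q \<noteq> ?g v" using inj_eq[OF injg] by blast+
    then have "fst (?g v) < fst (?g q)" using fr' unfolding frame_def vr0 by blast
    then show "snd q < snd v" by simp
  qed
  have u: "u \<in> T" "w \<in> T" "nw u w" and cmpw: "\<And>q. q \<in> T \<Longrightarrow> q \<noteq> u \<Longrightarrow> q \<noteq> w \<Longrightarrow> sw q w \<or> sw w q"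
    using fr unfolding frame_def by blast+
  obtain hi where hi: "hi \<in> T" "sw w hi" using fr unfolding frame_def by blast
  obtain t where t: "t \<in> T" "snd u < snd t" using fr unfolding frame_def by blast
  have vu: "v \<noteq> u" using top[OF t(1)] t(2) by (cases "t = u") auto
  have vw: "v \<noteq> w" using top[OF hi(1)] hi(2) by (cases "hi = w") (auto simp: sw_def)
  have "\<not> sw v w" using top[OF u(2)] vw by (auto simp: sw_def)
  then have wv: "sw w v" using cmpw[OF v(1) vu vw] by blast
  have "left_split (insert (2 * fst v - 3, 2 * snd v) (double ` (T - {v, r})))"
  proof (rule frame_left_split[OF fr v(1) vu wv])
    show "\<not> sw r w" "r \<noteq> u" using v(3) u(3) wv by (auto simp: sw_def nw_def)
  qed (use wv in \<open>simp_all add: sw_def\<close>)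
  moreover have "reflect (2 * N) ` prod.swap ` raise v0 r0 (?g ` T) =
    insert (2 * fst v - 3, 2 * snd v) (double ` (T - {v, r}))"
  proof -
    have "?g ` T - {v0, r0} = ?g ` (T - {v, r})"
      unfolding vr0 using image_set_diff[OF injg, of T "{v, r}"] by simp
    moreover have "reflect (2 * N) (prod.swap (double (?g q))) = double q" for q
      by (simp add: reflect_def double_def)
    ultimately show ?thesis unfolding raise_def by (simp add: image_image vr0) (simp add: reflect_def)
  qed
  moreover have "order_iso (reflect M ` S') (reflect (2 * N) ` prod.swap ` raise v0 r0 (?g ` T))"
    using order_iso_reflect[OF order_iso_swap[OF iso]] by simp
  ultimately show ?thesis using order_iso_left_split[OF order_iso_sym] by metis
qed

section \<open>Counting inversions\<close>

text \<open>
  The number of inversions, computed recursively along the list.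
\<close>

fun count_inv :: "nat list \<Rightarrow> nat" where
  "count_inv [] = 0"
| "count_inv (x # xs) = length (filter (\<lambda>y. y < x) xs) + count_inv xs"

lemma finite_inversions: "finite (inversions p)"
  by (rule finite_subset[of _ "{..<length p} \<times> {..<length p}"]) (auto simp: inversions_def)

lemma card_inversions_eq_count_inv: "card (inversions p) = count_inv p"
proof (induction p)
  case Nil
  then show ?case by (simp add: inversions_def)
next
  case (Cons x xs)
  let ?A = "(\<lambda>j. (0::nat, Suc j)) ` {j. j < length xs \<and> xs ! j < x}"
  let ?B = "(\<lambda>(i, j). (Suc i, Suc j)) ` inversions xs"
  have "inversions (x # xs) = ?A \<union> ?B"
  proof (intro equalityI subsetI)
    fix q assume "q \<in> inversions (x # xs)"
    then obtain i j where q: "q = (i, j)" "i < j" "j < length (x # xs)" "(x # xs) ! j < (x # xs) ! i"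
      unfolding inversions_def by blast
    then obtain j' where j: "j = Suc j'" by (cases j) auto
    show "q \<in> ?A \<union> ?B"
    proof (cases i)
      case 0
      then show ?thesis using q j by auto
    next
      case (Suc i')
      then have "(i', j') \<in> inversions xs" using q j by (simp add: inversions_def)
      then show ?thesis using q j Suc by (intro UnI2 image_eqI[of _ _ "(i', j')"]) simp_all
    qed
  qed (auto simp: inversions_def)
  moreover have "card (?A \<union> ?B) = card ?A + card ?B"
    by (rule card_Un_disjoint) (auto simp: finite_inversions)
  moreover have "card ?A = length (filter (\<lambda>y. y < x) xs)"
    by (subst card_image) (auto simp: inj_on_def length_filter_conv_card)
  moreover have "card ?B = card (inversions xs)"
    by (rule card_image) (auto simp: inj_on_def)
  ultimately show ?case using Cons.IH by simp
qed

lemma count_inv_map: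
  assumes "\<And>x y. x \<in> set xs \<Longrightarrow> y \<in> set xs \<Longrightarrow> f x < f y \<longleftrightarrow> x < y"
  shows "count_inv (map f xs) = count_inv xs"
  using assms
proof (induction xs)
  case (Cons x xs)
  have "filter (\<lambda>y. f y < f x) xs = filter (\<lambda>y. y < x) xs"
    by (rule filter_cong) (use Cons.prems in auto)
  then show ?case using Cons by (simp add: filter_map comp_def)
qed simp

lemma count_inv_append:
  assumes "\<And>x y. x \<in> set xs \<Longrightarrow> y \<in> set ys \<Longrightarrow> x \<le> y"
  shows "count_inv (xs @ ys) = count_inv xs + count_inv ys"
  using assms
proof (induction xs)
  case (Cons x xs)
  have "filter (\<lambda>y. y < x) ys = []"
    using Cons.prems by (simp add: filter_empty_conv not_less)
  then show ?case using Cons by simp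
qed simp

section \<open>Direct sums and the map \<open>g\<close>\<close>

lemma length_direct_sum [simp]: "length (s \<oplus> t) = length s + length t"
  by (simp add: direct_sum_def)

lemma direct_sum_nth:
  "i < length s + length t \<Longrightarrow> (s \<oplus> t) ! i = (if i < length s then s ! i else length s + t ! (i - length s))"
  by (auto simp: direct_sum_def nth_append)

lemma direct_sum_assoc: "(s \<oplus> t) \<oplus> r = s \<oplus> (t \<oplus> r)"
  by (simp add: direct_sum_def add.assoc)

lemma direct_sum_eq_Nil [simp]: "s \<oplus> t = [] \<longleftrightarrow> s = [] \<and> t = []"
  by (simp add: direct_sum_def)

lemma is_perm_one: "is_perm [1]"
  by (simp add: is_perm_iff)

lemma is_perm_direct_sum:
  assumes s: "is_perm s" and t: "is_perm t" shows "is_perm (s \<oplus> t)"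
proof (rule is_permI, rule subsetI)
  fix x assume x: "x \<in> {1..length (s \<oplus> t)}"
  show "x \<in> set (s \<oplus> t)"
  proof (cases "x \<le> length s")
    case True
    then have "x \<in> set s" using s x by (simp add: is_perm_iff)
    then show ?thesis by (simp add: direct_sum_def)
  next
    case False
    then have "x - length s \<in> set t" "x = length s + (x - length s)" using t x by (simp_all add: is_perm_iff) linarith
    then show ?thesis by (auto simp: direct_sum_def)
  qed
qed

lemma direct_sum_cancel:
  assumes "s \<oplus> t = s' \<oplus> t'" "length s = length s'" shows "s = s'" "t = t'"
proof -
  have "s @ map (\<lambda>x. length s + x) t = s' @ map (\<lambda>x. length s + x) t'"
    using assms by (simp add: direct_sum_def)
  then have *: "s = s'" "map (\<lambda>x. length s + x) t = map (\<lambda>x. length s + x) t'"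
    using assms(2) by auto
  then show "s = s'" by simp
  show "t = t'" using *(2) by (rule map_injective) (simp add: inj_def)
qed

lemma decomposable_direct_sum:
  "is_perm s \<Longrightarrow> is_perm t \<Longrightarrow> s \<noteq> [] \<Longrightarrow> t \<noteq> [] \<Longrightarrow> decomposable (s \<oplus> t)"
  by (auto simp: decomposable_def)

text \<open>
  Otherwise \<open>length s\<close> would be a cut of \<open>s'\<close>.
\<close>

lemma first_component_length_le:
  assumes s: "is_perm s" "s \<noteq> []" and s': "is_perm s'" "\<not> decomposable s'" and eq: "s \<oplus> t = s' \<oplus> t'"
  shows "length s' \<le> length s"
proof (rule ccontr)
  assume lt: "\<not> length s' \<le> length s"
  have nth: "s' ! i = s ! i" if "i < length s" for i
  proof -
    have "s' ! i = (s' \<oplus> t') ! i" "s ! i = (s \<oplus> t) ! i" using that lt by (simp_all add: direct_sum_nth)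
    then show ?thesis using eq by simp
  qed
  have "cut s' (length s)" unfolding cut_def using lt s nth is_perm_nth[OF s(1)] by simp
  then show False using s' decomposable_iff_cut by blast
qed

lemma first_component_unique:
  assumes "is_perm s" "s \<noteq> []" "\<not> decomposable s" "is_perm s'" "s' \<noteq> []" "\<not> decomposable s'"
    and eq: "s \<oplus> t = s' \<oplus> t'"
  shows "s = s'" "t = t'"
proof -
  have "length s' \<le> length s" by (rule first_component_length_le[OF _ _ _ _ eq]) fact+
  moreover have "length s \<le> length s'" by (rule first_component_length_le[OF _ _ _ _ eq[symmetric]]) fact+
  ultimately have "length s = length s'" by simp
  then show "s = s'" "t = t'" using direct_sum_cancel[OF eq] by simp_all
qed

lemma first_component_exists:
  assumes "is_perm s" "s \<noteq> []" "is_perm t" "t \<noteq> []"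
  shows "\<exists>a b. is_perm a \<and> a \<noteq> [] \<and> \<not> decomposable a \<and> is_perm b \<and> b \<noteq> [] \<and> s \<oplus> t = a \<oplus> b"
  using assms
proof (induction "length s" arbitrary: s t rule: less_induct)
  case less
  show ?case
  proof (cases "decomposable s")
    case True
    then obtain s1 s2 where s: "is_perm s1" "is_perm s2" "s1 \<noteq> []" "s2 \<noteq> []" "s = s1 \<oplus> s2"
      unfolding decomposable_def by blast
    have l: "length s1 < length s" using s by simp
    have "is_perm (s2 \<oplus> t)" "s2 \<oplus> t \<noteq> []" using s less.prems is_perm_direct_sum by simp_all
    from less.hyps[OF l s(1,3) this] show ?thesis unfolding s(5) direct_sum_assoc .
  next
    case False
    then show ?thesis using less.prems by blast
  qed
qed

lemma decomposable_first_component: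
  assumes "decomposable p"
  obtains a b where "is_perm a" "a \<noteq> []" "\<not> decomposable a" "is_perm b" "b \<noteq> []" "p = a \<oplus> b"
  using assms first_component_exists unfolding decomposable_def by metis

lemma no_inversion_one:
  assumes p: "is_perm p" "p \<noteq> []" and nd: "\<not> decomposable p"
    and no: "\<And>i j. i < j \<Longrightarrow> j < length p \<Longrightarrow> p ! i < p ! j"
  shows "p = [1]"
proof -
  have n: "1 \<le> length p" using p by (simp add: Suc_le_eq)
  then obtain k where k: "k < length p" "p ! k = 1" using is_perm_obtain[OF p(1), of 1] by auto
  have "k = 0"
  proof (rule ccontr)
    assume "k \<noteq> 0"
    then have "p ! 0 < 1" using no[of 0 k] k by simp
    then show False using is_perm_nth[OF p(1), of 0] p(2) by simp
  qed
  have "\<not> 1 < length p"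
  proof
    assume "1 < length p"
    then have "cut p 1" using k \<open>k = 0\<close> by (simp add: cut_def)
    then show False using nd decomposable_iff_cut[OF p(1)] by blast
  qed
  then have "length p = 1" using n by simp
  then show ?thesis using k \<open>k = 0\<close> by (cases p) auto
qed

lemma avoids1324_nth:
  assumes av: "avoids1324 (pts p)" and o: "i < j" "j < k" "k < l" "l < length p"
    and v: "p ! i < p ! k" "p ! k < p ! j" "p ! j < p ! l"
  shows False
proof -
  let ?f = "\<lambda>i. (int (Suc i), int (p ! i))"
  have "?f i \<in> pts p" "?f j \<in> pts p" "?f k \<in> pts p" "?f l \<in> pts p" using o by (auto simp: mem_pts)
  moreover have "sw (?f i) (?f j)" "sw (?f i) (?f k)" "nw (?f j) (?f k)" "sw (?f j) (?f l)"
    "sw (?f k) (?f l)" using o v by (simp_all add: sw_def nw_def)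
  ultimately show False using av unfolding avoids1324_def by blast
qed

text \<open>
  \<open>1 \<oplus> \<dots> \<oplus> 1 \<oplus> t\<close> with \<open>m\<close> summands \<open>1\<close>.
\<close>

abbreviation ones :: "nat \<Rightarrow> nat list \<Rightarrow> nat list" where
  "ones m t \<equiv> ((\<lambda>u. [1] \<oplus> u) ^^ m) t"

lemma is_perm_ones: "is_perm t \<Longrightarrow> is_perm (ones m t)"
  by (induction m) (simp_all add: is_perm_direct_sum is_perm_one del: One_nat_def)

lemma ones_not_Nil: "t \<noteq> [] \<Longrightarrow> ones m t \<noteq> []"
  by (induction m) simp_all

text \<open>
  A middle component with an inversion would give 1324, together with an entry before and one after it.
\<close>

lemma ones_exists:
  assumes "is_perm a" "a \<noteq> []" "is_perm b" "b \<noteq> []" "avoids1324 (pts (a \<oplus> b))"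
  shows "\<exists>m t. is_perm t \<and> t \<noteq> [] \<and> \<not> decomposable t \<and> b = ones m t"
  using assms
proof (induction "length b" arbitrary: a b rule: less_induct)
  case less
  note a = less.prems(1,2) and b = less.prems(3,4) and av = less.prems(5)
  show ?case
  proof (cases "decomposable b")
    case False
    then show ?thesis using b by (intro exI[of _ 0] exI[of _ b]) simp
  next
    case True
    then obtain c d where c: "is_perm c" "c \<noteq> []" "\<not> decomposable c" and d: "is_perm d" "d \<noteq> []"
      and bcd: "b = c \<oplus> d"
      using decomposable_first_component by metis
    have "c = [1]"
    proof (rule no_inversion_one[OF c])
      fix i j assume ij: "i < j" "j < length c"
      show "c ! i < c ! j"
      proof (rule ccontr)
        assume "\<not> c ! i < c ! j"
        moreover have "c ! i \<noteq> c ! j" using is_perm_nth_eq[OF c(1)] ij by simp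
        ultimately have lt: "c ! j < c ! i" by simp
        let ?p = "a \<oplus> (c \<oplus> d)" and ?l = "length a"
        have la: "0 < ?l" "0 < length d" using a d by simp_all
        have "?p ! 0 = a ! 0" "?p ! (?l + i) = ?l + c ! i" "?p ! (?l + j) = ?l + c ! j"
          "?p ! (?l + length c) = ?l + (length c + d ! 0)"
          using ij la by (simp_all add: direct_sum_nth)
        moreover have "a ! 0 \<le> ?l" using is_perm_nth[OF a(1) la(1)] by simp
        moreover have "1 \<le> c ! j" "c ! i \<le> length c" using is_perm_nth[OF c(1)] ij by simp_all
        moreover have "1 \<le> d ! 0" using is_perm_nth[OF d(1) la(2)] by simp
        ultimately show False
          using avoids1324_nth[OF av[unfolded bcd], of 0 "?l + i" "?l + j" "?l + length c"] la ij lt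
          by simp
      qed
    qed
    then have b1: "b = [1] \<oplus> d" using bcd by simp
    have "is_perm (a \<oplus> [1])" "a \<oplus> [1] \<noteq> []" using a is_perm_direct_sum is_perm_one by simp_all
    moreover have "avoids1324 (pts ((a \<oplus> [1]) \<oplus> d))" using av unfolding b1 direct_sum_assoc .
    moreover have "length d < length b" unfolding b1 by simp
    ultimately obtain m t where "is_perm t" "t \<noteq> []" "\<not> decomposable t" "d = ones m t"
      using less.hyps d by metis
    then show ?thesis unfolding b1 by (intro exI[of _ "Suc m"] exI[of _ t]) simp
  qed
qed

lemma ones_unique:
  assumes t: "is_perm t" "t \<noteq> []" "\<not> decomposable t" and t': "is_perm t'" "t' \<noteq> []" "\<not> decomposable t'"
    and "ones m t = ones m' t'"
  shows "m = m' \<and> t = t'"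
  using assms(7)
proof (induction m arbitrary: m')
  case 0
  show ?case
  proof (cases m')
    case (Suc k)
    then have "t = [1] \<oplus> ones k t'" using 0 by simp
    then have "decomposable t"
      using decomposable_direct_sum[OF is_perm_one is_perm_ones[OF t'(1)] _ ones_not_Nil[OF t'(2)]] by simp
    then show ?thesis using t by simp
  qed (use 0 in simp)
next
  case (Suc m)
  show ?case
  proof (cases m')
    case 0
    then have "t' = [1] \<oplus> ones m t" using Suc.prems by simp
    then have "decomposable t'"
      using decomposable_direct_sum[OF is_perm_one is_perm_ones[OF t(1)] _ ones_not_Nil[OF t(2)]] by simp
    then show ?thesis using t' by simp
  next
    case (Suc k)
    then have "[1] \<oplus> ones m t = [1] \<oplus> ones k t'" using Suc.prems by simp
    then have "ones m t = ones k t'" by (rule direct_sum_cancel) simp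
    then show ?thesis using Suc.IH Suc by simp
  qed
qed

text \<open>
  All that is needed about \<open>g\<close>: it inserts a summand 1 behind the first component.
\<close>

lemma map_g_direct_sum:
  assumes p: "decomposable p" and av: "avoids1324 (pts p)"
  obtains a b where "is_perm a" "a \<noteq> []" "\<not> decomposable a" "is_perm b" "b \<noteq> []" "p = a \<oplus> b"
    "map_g p = a \<oplus> ([1] \<oplus> b)"
proof -
  obtain a b where a: "is_perm a" "a \<noteq> []" "\<not> decomposable a" and b: "is_perm b" "b \<noteq> []" "p = a \<oplus> b"
    using decomposable_first_component[OF p] by metis
  obtain m t where t: "is_perm t" "t \<noteq> []" "\<not> decomposable t" and bt: "b = ones m t"
    using ones_exists[OF a(1,2) b(1,2)] av b(3) by blast
  have "map_g p = sandwich a (m + 1) t"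
    unfolding map_g_def
  proof (rule the_equality)
    show "\<exists>s m' t'. is_perm s \<and> is_perm t' \<and> s \<noteq> [] \<and> t' \<noteq> [] \<and> \<not> decomposable s \<and>
        \<not> decomposable t' \<and> p = sandwich s m' t' \<and> sandwich a (m + 1) t = sandwich s (m' + 1) t'"
      using a t b(3) bt unfolding sandwich_def by blast
    fix q assume "\<exists>s m t. is_perm s \<and> is_perm t \<and> s \<noteq> [] \<and> t \<noteq> [] \<and> \<not> decomposable s \<and>
        \<not> decomposable t \<and> p = sandwich s m t \<and> q = sandwich s (m + 1) t"
    then obtain s m' t' where s: "is_perm s" "s \<noteq> []" "\<not> decomposable s"
      and t': "is_perm t'" "t' \<noteq> []" "\<not> decomposable t'"
      and eq: "p = sandwich s m' t'" and q: "q = sandwich s (m' + 1) t'" by blast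
    have "a \<oplus> ones m t = s \<oplus> ones m' t'" using eq b(3) bt by (simp add: sandwich_def)
    from first_component_unique[OF a s this] ones_unique[OF t t']
    have "a = s" "m = m' \<and> t = t'" by blast+
    then show "q = sandwich a (m + 1) t" using q by simp
  qed
  then have "map_g p = a \<oplus> ([1] \<oplus> b)" by (simp add: sandwich_def bt)
  then show ?thesis using that a b by blast
qed

lemma map_g_inject:
  assumes p: "decomposable p" "avoids1324 (pts p)" and q: "decomposable q" "avoids1324 (pts q)"
    and eq: "map_g p = map_g q"
  shows "p = q"
proof -
  obtain a b where a: "is_perm a" "a \<noteq> []" "\<not> decomposable a" "p = a \<oplus> b" "map_g p = a \<oplus> ([1] \<oplus> b)"
    using map_g_direct_sum[OF p] by metis
  obtain c d where c: "is_perm c" "c \<noteq> []" "\<not> decomposable c" "q = c \<oplus> d" "map_g q = c \<oplus> ([1] \<oplus> d)"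
    using map_g_direct_sum[OF q] by metis
  have "a \<oplus> ([1] \<oplus> b) = c \<oplus> ([1] \<oplus> d)" using a(5) c(5) eq by simp
  from first_component_unique[OF a(1-3) c(1-3) this] have "a = c" "[1] \<oplus> b = [1] \<oplus> d" .
  moreover from this(2) have "b = d" by (rule direct_sum_cancel) simp
  ultimately show ?thesis using a c by simp
qed

lemma count_inv_direct_sum:
  assumes "is_perm s" shows "count_inv (s \<oplus> t) = count_inv s + count_inv t"
proof -
  have "count_inv (s \<oplus> t) = count_inv s + count_inv (map (\<lambda>x. length s + x) t)"
    unfolding direct_sum_def by (rule count_inv_append) (use assms in \<open>auto simp: is_perm_iff\<close>)
  also have "count_inv (map (\<lambda>x. length s + x) t) = count_inv t"
    by (rule count_inv_map) simp
  finally show ?thesis .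
qed

lemma count_inv_map_g:
  assumes "decomposable p" "avoids1324 (pts p)" shows "count_inv (map_g p) = count_inv p"
proof -
  obtain a b where a: "is_perm a" "p = a \<oplus> b" "map_g p = a \<oplus> ([1] \<oplus> b)"
    using map_g_direct_sum[OF assms] by metis
  have "count_inv ([1] \<oplus> b) = count_inv b" using count_inv_direct_sum[OF is_perm_one] by simp
  then show ?thesis using a count_inv_direct_sum by simp
qed

lemma map_g_perm:
  assumes "decomposable p" "avoids1324 (pts p)"
  shows "is_perm (map_g p)" "length (map_g p) = Suc (length p)"
proof -
  obtain a b where a: "is_perm a" "is_perm b" "p = a \<oplus> b" "map_g p = a \<oplus> ([1] \<oplus> b)"
    using map_g_direct_sum[OF assms] by metis
  then show "is_perm (map_g p)" "length (map_g p) = Suc (length p)"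
    using is_perm_direct_sum is_perm_one by simp_all
qed

section \<open>Inserting a first entry and the map \<open>f\<close>\<close>

text \<open>
  \<open>insert_first a t\<close> is the permutation with first entry \<open>a\<close> whose other entries are ordered like \<open>t\<close>; the
  entries from \<open>a\<close> on are increased to make room.
\<close>

definition inc :: "nat \<Rightarrow> nat \<Rightarrow> nat" where
  "inc a x = (if a \<le> x then x + 1 else x)"

definition insert_first :: "nat \<Rightarrow> nat list \<Rightarrow> nat list" where
  "insert_first a t = a # map (inc a) t"

lemma length_insert_first [simp]: "length (insert_first a t) = Suc (length t)"
  by (simp add: insert_first_def)

lemma insert_first_nth [simp]: "insert_first a t ! 0 = a"
  "i < length t \<Longrightarrow> insert_first a t ! Suc i = inc a (t ! i)"
  by (simp_all add: insert_first_def)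

lemma hd_insert_first [simp]: "hd (insert_first a t) = a"
  by (simp add: insert_first_def)

lemma is_perm_insert_first:
  assumes t: "is_perm t" and a: "1 \<le> a" "a \<le> length t + 1"
  shows "is_perm (insert_first a t)"
proof (rule is_permI, rule subsetI)
  fix x assume x: "x \<in> {1..length (insert_first a t)}"
  show "x \<in> set (insert_first a t)"
  proof (cases "x = a")
    case False
    let ?y = "if a < x then x - 1 else x"
    have "?y \<in> set t" using x a False t by (auto simp: is_perm_iff)
    moreover have "x = inc a ?y" using False by (auto simp: inc_def)
    ultimately have "x \<in> inc a ` set t" by (rule image_eqI[rotated])
    then show ?thesis by (simp add: insert_first_def)
  qed (simp add: insert_first_def)
qed

lemma insert_first_remove_hd:
  assumes p: "is_perm p" "p \<noteq> []" shows "insert_first (hd p) (p \<smallsetminus> hd p) = p"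
proof -
  obtain a xs where ax: "p = a # xs" using p by (cases p) auto
  have "p \<smallsetminus> a = map (dec a) xs" using remove_value_append[of "[]" a xs] p ax by simp
  moreover have "map (inc a \<circ> dec a) xs = xs"
  proof (rule map_idI)
    fix x assume "x \<in> set xs"
    then have "x \<noteq> a" using p ax by (auto simp: is_perm_iff)
    then show "(inc a \<circ> dec a) x = x" by (auto simp: inc_def dec_def)
  qed
  ultimately show ?thesis using ax by (simp add: insert_first_def)
qed

lemma remove_hd_insert_first:
  assumes "is_perm t" "1 \<le> a" "a \<le> length t + 1"
  shows "insert_first a t \<smallsetminus> a = t"
proof -
  have "insert_first a t \<smallsetminus> a = map (dec a) (map (inc a) t)"
    using remove_value_append[of "[]" a "map (inc a) t"] is_perm_insert_first[OF assms]
    by (simp add: insert_first_def)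
  also have "\<dots> = map (dec a \<circ> inc a) t" by simp
  also have "\<dots> = t" by (rule map_idI) (simp add: inc_def dec_def)
  finally show ?thesis .
qed

lemma count_inv_insert_first:
  assumes t: "is_perm t" and a: "1 \<le> a" "a \<le> length t + 1"
  shows "count_inv (insert_first a t) = a - 1 + count_inv t"
proof -
  have "filter (\<lambda>y. y < a) (map (inc a) t) = map (inc a) (filter (\<lambda>y. y < a) t)"
    unfolding filter_map comp_def by (intro arg_cong[of _ _ "map (inc a)"] filter_cong) (auto simp: inc_def)
  then have "length (filter (\<lambda>y. y < a) (map (inc a) t)) = length (filter (\<lambda>y. y < a) t)" by simp
  also have "\<dots> = card (set (filter (\<lambda>y. y < a) t))"
    using t by (intro distinct_card[symmetric]) (simp add: is_perm_iff)
  also have "set (filter (\<lambda>y. y < a) t) = {1..a - 1}"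
    using t a by (auto simp: is_perm_iff)
  finally have "length (filter (\<lambda>y. y < a) (map (inc a) t)) = a - 1" by simp
  moreover have "count_inv (map (inc a) t) = count_inv t"
    by (rule count_inv_map) (auto simp: inc_def)
  ultimately show ?thesis by (simp add: insert_first_def)
qed

lemma hd_bounds: "is_perm p \<Longrightarrow> p \<noteq> [] \<Longrightarrow> 1 \<le> hd p \<and> hd p \<le> length p"
  using is_perm_nth[of p 0] by (simp add: hd_conv_nth)

lemma avoids1324_remove_hd:
  assumes p: "is_perm p" "p \<noteq> []" and av: "avoids1324 (pts p)"
  shows "avoids1324 (pts (p \<smallsetminus> hd p))"
proof -
  have "order_iso (pts p - {(int (Suc 0), int (hd p))}) (pts (p \<smallsetminus> hd p))"
    by (rule remove_value_order_iso) (use p in \<open>simp_all add: hd_conv_nth\<close>)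
  moreover have "avoids1324 (pts p - {(int (Suc 0), int (hd p))})"
    using av unfolding avoids1324_def by blast
  ultimately show ?thesis using order_iso_imp(2) order_iso_sym by blast
qed

lemma f_first_eq:
  assumes p: "is_perm p" "p \<noteq> []" and av: "avoids1324 (pts p)" and d: "decomposable (p \<smallsetminus> hd p)"
  shows "f_first p = insert_first (hd p) (map_g (p \<smallsetminus> hd p))"
proof -
  let ?s = "p \<smallsetminus> hd p"
  have hs: "hd p \<in> set p" using p by simp
  note hb = hd_bounds[OF p]
  have av': "avoids1324 (pts ?s)" by (rule avoids1324_remove_hd[OF p av])
  have g: "is_perm (map_g ?s)" "length (map_g ?s) = length p"
    using map_g_perm[OF d av'] remove_value_perm[OF p(1) hs] p by simp_all
  show ?thesis
    unfolding f_first_def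
  proof (rule the_equality)
    show "insert_first (hd p) (map_g ?s) \<in> perms (length p + 1) \<and>
        hd (insert_first (hd p) (map_g ?s)) = hd p \<and> insert_first (hd p) (map_g ?s) \<smallsetminus> hd p = map_g ?s"
      using is_perm_insert_first[OF g(1)] remove_hd_insert_first[OF g(1)] hb g(2) by (simp add: perms_iff)
    fix q assume q: "q \<in> perms (length p + 1) \<and> hd q = hd p \<and> q \<smallsetminus> hd p = map_g ?s"
    then have "is_perm q" "q \<noteq> []" by (auto simp: perms_iff)
    then show "q = insert_first (hd p) (map_g ?s)" using insert_first_remove_hd[of q] q by simp
  qed
qed

lemma insert_first_cut:
  assumes a: "is_perm a" and b: "b \<noteq> []" and v: "1 \<le> v" "v \<le> length a + 1"
  shows "cut (insert_first v (a \<oplus> b)) (length a + 1)"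
  unfolding cut_def
proof (intro conjI allI impI)
  show "0 < length a + 1" "length a + 1 < length (insert_first v (a \<oplus> b))" using b by simp_all
  fix i assume i: "i < length a + 1"
  show "insert_first v (a \<oplus> b) ! i \<le> length a + 1"
  proof (cases i)
    case 0
    then show ?thesis using v by simp
  next
    case (Suc j)
    then have "(a \<oplus> b) ! j \<le> length a" using i is_perm_nth[OF a, of j] by (simp add: direct_sum_nth)
    then show ?thesis using Suc i by (simp add: inc_def)
  qed
qed

text \<open>
  Here \<open>u\<close> is the first entry \<open>v\<close> and \<open>w\<close> the inserted summand, with value \<open>length a + 1 < v\<close>.
\<close>

lemma insert_first_expansion:
  assumes a: "is_perm a" "a \<noteq> []" and b: "is_perm b" "b \<noteq> []"
    and v: "length a + 2 \<le> v" "v \<le> length a + length b + 1"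
  shows "expansion (pts (insert_first v (a \<oplus> b))) (pts (insert_first v (a \<oplus> ([1] \<oplus> b))))"
proof -
  let ?p = "insert_first v (a \<oplus> b)" and ?q = "insert_first v (a \<oplus> ([1] \<oplus> b))" and ?c = "length a"
  define n where "n = length a + length b + 1"
  have c: "1 \<le> ?c" "1 \<le> length b" using a b by (simp_all add: Suc_le_eq)
  have lp: "length ?p = n" and lq: "length ?q = n + 1" by (simp_all add: n_def)
  have pp: "is_perm ?p" "is_perm ?q"
    using a b v is_perm_direct_sum is_perm_one by (auto intro!: is_perm_insert_first)
  have low: "?p ! i = ?q ! i" "1 \<le> ?q ! i" "?q ! i \<le> ?c" if i: "1 \<le> i" "i \<le> ?c" for i
  proof -
    obtain j where j: "i = Suc j" "j < ?c" using i by (cases i) auto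
    have "1 \<le> a ! j" "a ! j \<le> ?c" using is_perm_nth[OF a(1) j(2)] by auto
    then have "?p ! i = a ! j" "?q ! i = a ! j"
      unfolding j(1) using j v by (simp_all add: direct_sum_nth inc_def)
    then show "?p ! i = ?q ! i" "1 \<le> ?q ! i" "?q ! i \<le> ?c"
      using \<open>1 \<le> a ! j\<close> \<open>a ! j \<le> ?c\<close> by simp_all
  qed
  have mid: "?q ! (?c + 1) = ?c + 1"
    using insert_first_nth(2)[of ?c "a \<oplus> ([1] \<oplus> b)" v] v by (simp add: direct_sum_nth inc_def)
  have high: "\<exists>y\<ge>1. ?p ! i = inc v (?c + y) \<and> ?q ! (i + 1) = inc v (?c + 1 + y)"
    if i: "?c + 1 \<le> i" "i < n" for i
  proof -
    obtain k where k: "i = Suc (?c + k)" using i by (metis Suc_eq_plus1 add_Suc le_Suc_ex)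
    have kb: "k < length b" using k i by (simp add: n_def)
    have "?p ! i = inc v (?c + b ! k)" unfolding k using kb by (simp add: direct_sum_nth)
    moreover have "?q ! (i + 1) = inc v (?c + 1 + b ! k)"
      unfolding k using kb insert_first_nth(2)[of "Suc (?c + k)" "a \<oplus> ([1] \<oplus> b)" v]
      by (simp add: direct_sum_nth)
    ultimately show ?thesis using is_perm_nth[OF b(1) kb] by blast
  qed
  let ?P = "\<lambda>i. (int (Suc i), int (?p ! i))" and ?Q = "\<lambda>i. (int (Suc i), int (?q ! i))"
  let ?u = "?Q 0" and ?w = "?Q (?c + 1)"
  have Qin: "?Q i \<in> pts ?q" if "i \<le> n" for i using that lq unfolding pts_def by auto
  have Qeq: "?Q i = ?Q j \<longleftrightarrow> i = j" for i j by auto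
  have cn: "?c + 2 \<le> n" using c by (simp add: n_def)
  have vn: "v \<le> n" using v by (simp add: n_def)
  have cmp1: "sw (?Q i) ?w" if "1 \<le> i" "i \<le> ?c" for i
    using low[OF that] that unfolding mid by (simp add: sw_def)
  have cmp2: "sw ?w (?Q i)" if i: "?c + 2 \<le> i" "i \<le> n" for i
  proof -
    have "?c + 1 \<le> i - 1" "i - 1 < n" "i - 1 + 1 = i" using i by simp_all
    then obtain y where "1 \<le> y" "?q ! i = inc v (?c + 1 + y)" using high[of "i - 1"] by auto
    then show ?thesis using i unfolding mid by (simp add: sw_def inc_def)
  qed
  have "frame ?u ?w (pts ?q)"
    unfolding frame_def
  proof (intro conjI ballI impI)
    show "?u \<in> pts ?q" "?w \<in> pts ?q" using cn by (intro Qin; simp)+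
    show "nw ?u ?w" unfolding nw_def mid using v by simp
    show "\<exists>q\<in>pts ?q. sw q ?w" using cmp1[of 1] Qin[of 1] c cn by (metis le_trans one_le_numeral trans_le_add2 order_refl)
    show "\<exists>q\<in>pts ?q. sw ?w q" using cmp2[of n] Qin[of n] cn by blast
    show "\<exists>q\<in>pts ?q. snd ?u < snd q"
    proof -
      obtain k where k: "k < n + 1" "?q ! k = n + 1" using is_perm_obtain[OF pp(2), of "n + 1"] lq by auto
      then have "snd ?u < snd (?Q k)" using vn by simp
      then show ?thesis using Qin[of k] k by (metis Suc_eq_plus1 less_Suc_eq_le)
    qed
    fix q assume "q \<in> pts ?q"
    then obtain i where i: "i \<le> n" "q = ?Q i" unfolding pts_def lq by auto
    show "fst ?u < fst q" if "q \<noteq> ?u" using that i by (cases i) simp_all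
    show "sw q ?w \<or> sw ?w q" if "q \<noteq> ?u" "q \<noteq> ?w"
    proof -
      have "i \<noteq> 0" using that(1) i(2) by metis
      moreover have "i \<noteq> ?c + 1" using that(2) i(2) by metis
      ultimately show ?thesis using cmp1[of i] cmp2[of i] i by (cases "i \<le> ?c") simp_all
    qed
  qed
  moreover have "fst ?w = snd ?w + 1" unfolding mid by simp
  moreover have "order_iso (pts ?p) (raise ?u ?w (pts ?q))"
  proof -
    \<comment> \<open>The coordinates of \<open>?p\<close> are mapped to doubled coordinates of \<open>?q\<close>; \<open>v\<close> and \<open>v - 1\<close> are exceptional,
      since \<open>v\<close> is lifted above the value that is \<open>v - 1\<close> in \<open>?p\<close> and \<open>v + 1\<close> in \<open>?q\<close>.\<close>
    define hx where "hx x = (if x \<le> int ?c + 1 then 2 * x else 2 * x + 2)" for x :: int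
    define ky where "ky y = (if y \<le> int ?c then 2 * y else if y = int v then 2 * y + 3
      else if y = int v - 1 then 2 * y + 4 else 2 * y + 2)" for y :: int
    define h where "h q = (hx (fst q), ky (snd q))" for q :: "int \<times> int"
    have h0: "h (?P 0) = (2 * fst ?u, 2 * snd ?u + 3)" using v by (simp add: h_def hx_def ky_def)
    have h1: "h (?P i) = double (?Q i)" if "1 \<le> i" "i \<le> ?c" for i
      using low[OF that] that by (simp add: h_def hx_def ky_def double_def)
    have h2: "h (?P i) = double (?Q (i + 1))" if i: "?c + 1 \<le> i" "i < n" for i
    proof -
      obtain y where y: "1 \<le> y" "?p ! i = inc v (?c + y)" "?q ! (i + 1) = inc v (?c + 1 + y)"
        using high[OF i] by blast
      have "ky (int (inc v (?c + y))) = 2 * int (inc v (?c + 1 + y))"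
        using y(1) v by (auto simp: ky_def inc_def)
      then show ?thesis unfolding h_def double_def using y i by (simp add: hx_def)
    qed
    show ?thesis
    proof (rule order_isoI[OF generic_pts[OF pp(1)]])
      show "h ` pts ?p = raise ?u ?w (pts ?q)"
      proof (intro equalityI subsetI)
        fix x assume "x \<in> h ` pts ?p"
        then obtain i where i: "i < n" "x = h (?P i)" unfolding pts_def lp by auto
        consider "i = 0" | "1 \<le> i" "i \<le> ?c" | "?c + 1 \<le> i" by linarith
        then show "x \<in> raise ?u ?w (pts ?q)"
        proof cases
          case 1
          then show ?thesis using h0 i(2) unfolding raise_def by simp
        next
          case 2
          have "?Q i \<in> pts ?q - {?u, ?w}" using 2 Qin[of i] i Qeq[of i 0] Qeq[of i "?c + 1"] by simp
          then show ?thesis unfolding i(2) h1[OF 2] raise_def by blast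
        next
          case 3
          have "?Q (i + 1) \<in> pts ?q - {?u, ?w}"
            using 3 Qin[of "i + 1"] i Qeq[of "i + 1" 0] Qeq[of "i + 1" "?c + 1"] by simp
          then show ?thesis unfolding i(2) h2[OF 3 i(1)] raise_def by blast
        qed
      next
        fix x assume "x \<in> raise ?u ?w (pts ?q)"
        then consider "x = (2 * fst ?u, 2 * snd ?u + 3)" | i where "i \<le> n" "x = double (?Q i)" "?Q i \<noteq> ?u" "?Q i \<noteq> ?w"
          unfolding raise_def pts_def lq by fastforce
        then show "x \<in> h ` pts ?p"
        proof cases
          case 1
          have "?P 0 \<in> pts ?p" unfolding pts_def lp using cn by auto
          then show ?thesis unfolding 1 h0[symmetric] by blast
        next
          case (2 i)
          have ne: "i \<noteq> 0" "i \<noteq> ?c + 1" using 2(3,4) by metis+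
          show ?thesis
          proof (cases "i \<le> ?c")
            case True
            have "?P i \<in> pts ?p" unfolding pts_def lp using cn True by auto
            moreover have "x = h (?P i)" using h1[of i] ne True 2 by simp
            ultimately show ?thesis by blast
          next
            case False
            have i': "?c + 1 \<le> i - 1" "i - 1 < n" "i - 1 + 1 = i" using ne False 2 by simp_all
            have "?P (i - 1) \<in> pts ?p" unfolding pts_def lp using i'(2) by blast
            moreover have "x = h (?P (i - 1))" using h2[OF i'(1,2)] i'(3) 2 by simp
            ultimately show ?thesis by blast
          qed
        qed
      qed
      fix r s :: "int \<times> int"
      show "fst (h r) < fst (h s)" if "fst r < fst s" using that by (auto simp: h_def hx_def)
      show "snd (h r) < snd (h s)" if "snd r < snd s" using that v by (auto simp: h_def ky_def)
    qed
  qed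
  ultimately show ?thesis unfolding expansion_def by blast
qed

lemma f_first_expansion:
  assumes p: "is_perm p" "p \<noteq> []" and nd: "\<not> decomposable p" and av: "avoids1324 (pts p)"
    and d: "decomposable (p \<smallsetminus> hd p)"
  shows "is_perm (f_first p)" "length (f_first p) = Suc (length p)"
    "expansion (pts p) (pts (f_first p))" "count_inv (f_first p) = count_inv p"
proof -
  let ?s = "p \<smallsetminus> hd p" and ?v = "hd p"
  have hs: "hd p \<in> set p" using p by simp
  note hb = hd_bounds[OF p]
  have av': "avoids1324 (pts ?s)" by (rule avoids1324_remove_hd[OF p av])
  have ps: "is_perm ?s" "length p = Suc (length ?s)" using remove_value_perm[OF p(1) hs] p by simp_all
  have g: "is_perm (map_g ?s)" "length (map_g ?s) = length p"
    using map_g_perm[OF d av'] ps by simp_all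
  note f = f_first_eq[OF p av d]
  have pe: "p = insert_first ?v ?s" using insert_first_remove_hd[OF p] by simp
  show "is_perm (f_first p)" "length (f_first p) = Suc (length p)"
    unfolding f using is_perm_insert_first[OF g(1)] g(2) hb by simp_all
  have "count_inv (f_first p) = ?v - 1 + count_inv (map_g ?s)"
    unfolding f by (rule count_inv_insert_first) (use g hb in simp_all)
  also have "\<dots> = ?v - 1 + count_inv ?s" using count_inv_map_g[OF d av'] by simp
  also have "\<dots> = count_inv (insert_first ?v ?s)"
    by (rule count_inv_insert_first[symmetric]) (use ps hb in simp_all)
  also have "\<dots> = count_inv p" using pe by simp
  finally show "count_inv (f_first p) = count_inv p" .
  obtain a b where a: "is_perm a" "a \<noteq> []" and b: "is_perm b" "b \<noteq> []" and ab: "?s = a \<oplus> b" "map_g ?s = a \<oplus> ([1] \<oplus> b)"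
    using map_g_direct_sum[OF d av'] by metis
  \<comment> \<open>A small first entry would extend \<open>a\<close> to a proper initial block of \<open>p\<close>.\<close>
  have "\<not> ?v \<le> length a + 1"
  proof
    assume "?v \<le> length a + 1"
    then have "cut (insert_first ?v (a \<oplus> b)) (length a + 1)"
      using insert_first_cut[OF a(1) b(2)] hb by simp
    then have "cut p (length a + 1)" using pe ab by simp
    then show False using nd decomposable_iff_cut[OF p(1)] by blast
  qed
  moreover have "?v \<le> length a + length b + 1" using hb ps ab(1) by simp
  ultimately have "expansion (pts (insert_first ?v (a \<oplus> b))) (pts (insert_first ?v (a \<oplus> ([1] \<oplus> b))))"
    by (intro insert_first_expansion a b) simp_all
  then show "expansion (pts p) (pts (f_first p))" using pe f ab by simp
qed

lemma f_first_inject: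
  assumes p: "is_perm p" "p \<noteq> []" "avoids1324 (pts p)" "decomposable (p \<smallsetminus> hd p)"
    and q: "is_perm q" "q \<noteq> []" "avoids1324 (pts q)" "decomposable (q \<smallsetminus> hd q)"
    and eq: "f_first p = f_first q"
  shows "p = q"
proof -
  have g: "is_perm (map_g (r \<smallsetminus> hd r))" "length (map_g (r \<smallsetminus> hd r)) = length r"
    if "is_perm r" "r \<noteq> []" "avoids1324 (pts r)" "decomposable (r \<smallsetminus> hd r)" for r
    using map_g_perm[OF that(4) avoids1324_remove_hd[OF that(1-3)]] remove_value_perm[OF that(1), of "hd r"] that
    by simp_all
  have e: "insert_first (hd p) (map_g (p \<smallsetminus> hd p)) = insert_first (hd q) (map_g (q \<smallsetminus> hd q))"
    using eq f_first_eq[OF p] f_first_eq[OF q] by simp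
  then have h: "hd p = hd q" by (metis hd_insert_first)
  have "insert_first (hd p) (map_g (p \<smallsetminus> hd p)) \<smallsetminus> hd p = map_g (p \<smallsetminus> hd p)"
    by (rule remove_hd_insert_first) (use g[OF p] hd_bounds[OF p(1,2)] in simp_all)
  moreover have "insert_first (hd q) (map_g (q \<smallsetminus> hd q)) \<smallsetminus> hd q = map_g (q \<smallsetminus> hd q)"
    by (rule remove_hd_insert_first) (use g[OF q] hd_bounds[OF q(1,2)] in simp_all)
  ultimately have "map_g (p \<smallsetminus> hd p) = map_g (q \<smallsetminus> hd q)" using e h by metis
  then have "p \<smallsetminus> hd p = q \<smallsetminus> hd q"
    using map_g_inject p q avoids1324_remove_hd by blast
  then show ?thesis using insert_first_remove_hd[OF p(1,2)] insert_first_remove_hd[OF q(1,2)] h by metis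
qed

section \<open>The map \<open>f\<close> is injective\<close>

text \<open>
  Nonempty indecomposable permutations avoiding 1324.
\<close>

definition indec_av :: "nat list \<Rightarrow> bool" where
  "indec_av p \<longleftrightarrow> is_perm p \<and> p \<noteq> [] \<and> \<not> splits (pts p) \<and> avoids1324 (pts p)"

text \<open>
  The relation between the points of \<open>p\<close> and \<open>f(p)\<close> in the cases (1) and (2).
\<close>

definition expansion12 :: "(int \<times> int) set \<Rightarrow> (int \<times> int) set \<Rightarrow> bool" where
  "expansion12 S T \<longleftrightarrow> expansion S T \<or> expansion (prod.swap ` S) (prod.swap ` T)"

lemma swap_reflect_image: "prod.swap ` reflect N ` T = reflect N ` prod.swap ` T"
  by (simp add: image_image reflect_def)

lemma inverse_perm_eq_Nil [simp]: "inverse_perm p = [] \<longleftrightarrow> p = []"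
  using length_inverse_perm[of p] by (simp only: length_0_conv[symmetric])

lemma reverse_complement_eq_Nil [simp]: "reverse_complement p = [] \<longleftrightarrow> p = []"
  using length_reverse_complement[of p] by (simp only: length_0_conv[symmetric])

lemma indec_av_inverse_perm: "indec_av p \<Longrightarrow> indec_av (inverse_perm p)"
  unfolding indec_av_def by (simp add: is_perm_inverse_perm pts_inverse_perm)

lemma indec_av_reverse_complement: "indec_av p \<Longrightarrow> indec_av (reverse_complement p)"
  unfolding indec_av_def by (simp add: is_perm_reverse_complement pts_reverse_complement)

lemma count_inv_inverse_perm: "is_perm p \<Longrightarrow> count_inv (inverse_perm p) = count_inv p"
  by (simp add: card_inversions_eq_count_inv[symmetric] card_inversions pts_inverse_perm)

lemma count_inv_reverse_complement: "is_perm p \<Longrightarrow> count_inv (reverse_complement p) = count_inv p"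
  by (simp add: card_inversions_eq_count_inv[symmetric] card_inversions pts_reverse_complement)

lemma indec_av_hd: "indec_av p \<Longrightarrow> decomposable (p \<smallsetminus> hd p) \<longleftrightarrow> left_split (pts p)"
  unfolding indec_av_def by (simp add: decomposable_remove_extremes(1))

lemma indec_av_one: "indec_av p \<Longrightarrow> decomposable (p \<smallsetminus> 1) \<longleftrightarrow> left_split (prod.swap ` pts p)"
  unfolding indec_av_def using decomposable_remove_extremes(2)[of p] by simp

lemma indec_av_f_first:
  assumes p: "indec_av p" and d: "left_split (pts p)"
  shows "is_perm (f_first p)" "length (f_first p) = Suc (length p)"
    "expansion (pts p) (pts (f_first p))" "count_inv (f_first p) = count_inv p"
proof -
  have "is_perm p" "p \<noteq> []" "\<not> splits (pts p)" "avoids1324 (pts p)"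
    using p by (simp_all add: indec_av_def)
  moreover have "\<not> decomposable p" using calculation decomposable_iff_splits by simp
  moreover have "decomposable (p \<smallsetminus> hd p)" using d indec_av_hd[OF p] by simp
  ultimately have "is_perm p" "p \<noteq> []" "\<not> decomposable p" "avoids1324 (pts p)" "decomposable (p \<smallsetminus> hd p)"
    by simp_all
  from f_first_expansion[OF this] show "is_perm (f_first p)" "length (f_first p) = Suc (length p)"
    "expansion (pts p) (pts (f_first p))" "count_inv (f_first p) = count_inv p" .
qed

lemma indec_av_f_first_inject:
  assumes "indec_av p" "left_split (pts p)" "indec_av q" "left_split (pts q)" "f_first p = f_first q"
  shows "p = q"
proof (rule f_first_inject)
  show "decomposable (p \<smallsetminus> hd p)" "decomposable (q \<smallsetminus> hd q)" using assms indec_av_hd by simp_all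
qed (use assms in \<open>simp_all add: indec_av_def\<close>)

lemma left_split_inverse_perm:
  "indec_av p \<Longrightarrow> left_split (pts (inverse_perm p)) \<longleftrightarrow> left_split (prod.swap ` pts p)"
  unfolding indec_av_def by (simp add: pts_inverse_perm)

lemma f_first_or_one_second:
  assumes p: "indec_av p" and d: "\<not> left_split (pts p)" "left_split (prod.swap ` pts p)"
  defines "q \<equiv> inverse_perm p"
  shows "f_first_or_one p = inverse_perm (f_first q)" "indec_av q" "left_split (pts q)"
  unfolding q_def f_first_or_one_def
  using d indec_av_inverse_perm[OF p] left_split_inverse_perm[OF p] indec_av_hd[OF p] by simp_all

lemma f_first_or_one_second_expansion:
  assumes p: "indec_av p" and d: "\<not> left_split (pts p)" "left_split (prod.swap ` pts p)"
  shows "expansion (prod.swap ` pts p) (prod.swap ` pts (f_first_or_one p))"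
proof -
  note f = f_first_or_one_second[OF assms]
  note g = indec_av_f_first[OF f(2,3)]
  have "is_perm p" using p unfolding indec_av_def by blast
  then show ?thesis using g(3) f(1) by (simp add: pts_inverse_perm[OF g(1)] pts_inverse_perm)
qed

lemma indec_av_f_first_or_one:
  assumes p: "indec_av p" and d: "left_split (pts p) \<or> left_split (prod.swap ` pts p)"
  shows "is_perm (f_first_or_one p)" "length (f_first_or_one p) = Suc (length p)"
    "expansion12 (pts p) (pts (f_first_or_one p))" "count_inv (f_first_or_one p) = count_inv p"
proof -
  have "is_perm (f_first_or_one p) \<and> length (f_first_or_one p) = Suc (length p) \<and>
    expansion12 (pts p) (pts (f_first_or_one p)) \<and> count_inv (f_first_or_one p) = count_inv p"
  proof (cases "left_split (pts p)")
    case True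
    then have "f_first_or_one p = f_first p" using indec_av_hd[OF p] by (simp add: f_first_or_one_def)
    then show ?thesis using indec_av_f_first[OF p True] by (simp add: expansion12_def)
  next
    case False
    then have d2: "left_split (prod.swap ` pts p)" using d by blast
    note f = f_first_or_one_second[OF p False d2]
    note g = indec_av_f_first[OF f(2,3)]
    have "is_perm p" using p unfolding indec_av_def by blast
    then show ?thesis
      using f_first_or_one_second_expansion[OF p False d2] f(1) g is_perm_inverse_perm[OF g(1)]
      by (simp add: expansion12_def count_inv_inverse_perm)
  qed
  then show "is_perm (f_first_or_one p)" "length (f_first_or_one p) = Suc (length p)"
    "expansion12 (pts p) (pts (f_first_or_one p))" "count_inv (f_first_or_one p) = count_inv p"
    by blast+
qed

lemma expansion12_avoids1324: "expansion12 S T \<Longrightarrow> avoids1324 S \<Longrightarrow> avoids1324 T"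
  unfolding expansion12_def
  using expansion_avoids1324[of S T] expansion_avoids1324[of "prod.swap ` S" "prod.swap ` T"] by auto

lemma finite_min_exists:
  fixes f :: "'a \<Rightarrow> int"
  assumes "finite T" "T \<noteq> {}" shows "\<exists>u\<in>T. \<forall>q\<in>T. f u \<le> f q"
proof -
  have "Min (f ` T) \<in> f ` T" using assms by simp
  then obtain u where "u \<in> T" "f u = Min (f ` T)" by auto
  moreover have "Min (f ` T) \<le> f q" if "q \<in> T" for q using assms that by simp
  ultimately show ?thesis by (intro bexI[of _ u]) simp_all
qed

lemma expansion_not_swap:
  assumes T: "finite T" "T \<noteq> {}" and e: "expansion S T" "expansion S' (prod.swap ` T)"
  shows False
proof -
  obtain u where u: "u \<in> T" "\<forall>q\<in>T. fst u \<le> fst q" using finite_min_exists[OF T] by metis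
  obtain b where b: "b \<in> T" "\<forall>q\<in>T. snd b \<le> snd q" using finite_min_exists[OF T] by metis
  have "fst b < snd u" by (rule expansion_bottom_left[OF e(1) b u])
  moreover have "fst (prod.swap u) < snd (prod.swap b)"
    by (rule expansion_bottom_left[OF e(2)]) (use u b in auto)
  ultimately show False by simp
qed

lemma f_first_or_one_inject:
  assumes p: "indec_av p" "left_split (pts p) \<or> left_split (prod.swap ` pts p)"
    and q: "indec_av q" "left_split (pts q) \<or> left_split (prod.swap ` pts q)"
    and eq: "f_first_or_one p = f_first_or_one q"
  shows "p = q"
proof -
  have first: "f_first_or_one r = f_first r \<and> expansion (pts r) (pts (f_first_or_one r))"
    if "indec_av r" "left_split (pts r)" for r
    using indec_av_f_first[OF that] indec_av_hd[OF that(1)] that by (simp add: f_first_or_one_def)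
  have ne: "finite (pts (f_first_or_one p))" "pts (f_first_or_one p) \<noteq> {}"
  proof -
    have "card (pts (f_first_or_one p)) \<noteq> 0" using indec_av_f_first_or_one(2)[OF p] by simp
    then show "pts (f_first_or_one p) \<noteq> {}" by (metis card.empty)
  qed simp
  show ?thesis
  proof (cases "left_split (pts p)")
    case pT: True
    show ?thesis
    proof (cases "left_split (pts q)")
      case True
      have "f_first p = f_first q" using first[OF p(1) pT] first[OF q(1) True] eq by simp
      then show ?thesis by (rule indec_av_f_first_inject[OF p(1) pT q(1) True])
    next
      case False
      then have "expansion (prod.swap ` pts q) (prod.swap ` pts (f_first_or_one p))"
        using f_first_or_one_second_expansion[OF q(1) False] q(2) eq by simp
      then show ?thesis using expansion_not_swap[OF ne] first[OF p(1) pT] by blast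
    qed
  next
    case pF: False
    then have p2: "left_split (prod.swap ` pts p)" using p by blast
    note fp = f_first_or_one_second[OF p(1) pF p2]
    show ?thesis
    proof (cases "left_split (pts q)")
      case True
      then have "expansion (pts q) (pts (f_first_or_one p))" unfolding eq using first[OF q(1) True] by blast
      then show ?thesis using expansion_not_swap[OF ne] f_first_or_one_second_expansion[OF p(1) pF p2] by blast
    next
      case False
      then have q2: "left_split (prod.swap ` pts q)" using q by blast
      note fq = f_first_or_one_second[OF q(1) False q2]
      have "f_first (inverse_perm p) = f_first (inverse_perm q)"
        using arg_cong[OF eq, of inverse_perm] unfolding fp(1) fq(1)
        by (simp add: inverse_perm_inverse_perm indec_av_f_first(1)[OF fp(2,3)] indec_av_f_first(1)[OF fq(2,3)])
      then have "inverse_perm p = inverse_perm q" by (rule indec_av_f_first_inject[OF fp(2,3) fq(2,3)])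
      then have "inverse_perm (inverse_perm p) = inverse_perm (inverse_perm q)" by simp
      then show ?thesis using p(1) q(1) unfolding indec_av_def by (simp add: inverse_perm_inverse_perm)
    qed
  qed
qed

lemma expansion12_reflect:
  assumes e: "expansion12 S T" and e': "expansion12 S' (reflect N ` T)"
  shows "left_split (reflect M ` S') \<or> left_split (prod.swap ` reflect M ` S')"
proof (cases "expansion S T")
  case True
  then show ?thesis
    using e' expansion_reflect_left_split expansion_swap_reflect_left_split unfolding expansion12_def by blast
next
  case False
  then have s: "expansion (prod.swap ` S) (prod.swap ` T)" using e unfolding expansion12_def by blast
  have "left_split (reflect M ` prod.swap ` S')"
  proof (cases "expansion S' (reflect N ` T)")
    case True
    show ?thesis
      by (rule expansion_swap_reflect_left_split[OF s, of _ N]) (use True in \<open>simp flip: swap_reflect_image\<close>)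
  next
    case False
    then have "expansion (prod.swap ` S') (reflect N ` prod.swap ` T)"
      using e' unfolding expansion12_def swap_reflect_image by blast
    then show ?thesis by (rule expansion_reflect_left_split[OF s])
  qed
  then show ?thesis by (simp add: swap_reflect_image)
qed

lemma Av_iff:
  "p \<in> Av n k [1, 3, 2, 4] \<longleftrightarrow> is_perm p \<and> length p = n \<and> avoids1324 (pts p) \<and> count_inv p = k"
  by (auto simp: Av_def perms_iff contains_iff[unfolded One_nat_def] card_inversions_eq_count_inv)

lemma AD_indec_av:
  assumes "p \<in> AD n k"
  shows "indec_av p" "length p = n" "count_inv p = k"
    "left_split (pts p) \<or> left_split (prod.swap ` pts p) \<or> left_split (reflect N ` pts p) \<or>
      left_split (prod.swap ` reflect N ` pts p)"
proof -
  have a: "is_perm p" "length p = n" "avoids1324 (pts p)" "count_inv p = k" "almost_decomposable p"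
    using assms by (auto simp: AD_def Av_iff simp del: One_nat_def)
  note ad = a(5)[unfolded almost_decomposable_iff[OF a(1)]]
  show "indec_av p" using a(1,3) ad unfolding indec_av_def by blast
  show "length p = n" "count_inv p = k" by (fact a)+
  show "left_split (pts p) \<or> left_split (prod.swap ` pts p) \<or> left_split (reflect N ` pts p) \<or>
      left_split (prod.swap ` reflect N ` pts p)"
    using ad extremal_splits_iff[OF a(1), of N] by blast
qed

text \<open>
  The removal of the first entry or of the entry 1 yields a decomposable permutation: cases (1) and (2).
\<close>

definition case12 :: "nat list \<Rightarrow> bool" where
  "case12 p \<longleftrightarrow> left_split (pts p) \<or> left_split (prod.swap ` pts p)"

lemma map_f_case12: "indec_av p \<Longrightarrow> case12 p \<Longrightarrow> map_f p = f_first_or_one p"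
  unfolding map_f_def case12_def using indec_av_hd[of p] indec_av_one[of p] by auto

lemma map_f_case3:
  "indec_av p \<Longrightarrow> \<not> case12 p \<Longrightarrow> map_f p = reverse_complement (f_first_or_one (reverse_complement p))"
  unfolding map_f_def case12_def using indec_av_hd[of p] indec_av_one[of p] by simp

lemma AD_case3:
  assumes "p \<in> AD n k" "\<not> case12 p" shows "case12 (reverse_complement p)"
proof -
  have "is_perm p" using AD_indec_av(1)[OF assms(1)] unfolding indec_av_def by blast
  then show ?thesis using AD_indec_av(4)[OF assms(1), of "int (length p) + 1"] assms(2)
    unfolding case12_def by (simp add: pts_reverse_complement)
qed

lemma map_f_in_Av:
  assumes p: "p \<in> AD n k" shows "map_f p \<in> Av (n + 1) k [1, 3, 2, 4]"
proof -
  note g = AD_indec_av(1-3)[OF p]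
  have *: "is_perm (f_first_or_one r)" "length (f_first_or_one r) = Suc (length r)"
    "avoids1324 (pts (f_first_or_one r))" "count_inv (f_first_or_one r) = count_inv r"
    if "indec_av r" "case12 r" for r
  proof -
    note f = indec_av_f_first_or_one[OF that[unfolded case12_def]]
    show "is_perm (f_first_or_one r)" "length (f_first_or_one r) = Suc (length r)"
      "count_inv (f_first_or_one r) = count_inv r" by (fact f)+
    show "avoids1324 (pts (f_first_or_one r))"
      using expansion12_avoids1324[OF f(3)] that(1) unfolding indec_av_def by blast
  qed
  show ?thesis
  proof (cases "case12 p")
    case True
    then show ?thesis using *[OF g(1) True] g map_f_case12[OF g(1)] by (simp add: Av_iff del: One_nat_def)
  next
    case False
    note c = AD_case3[OF p False]
    note r = *[OF indec_av_reverse_complement[OF g(1)] c]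
    have "is_perm p" using g(1) unfolding indec_av_def by blast
    then show ?thesis
      using r g map_f_case3[OF g(1) False] is_perm_reverse_complement
      by (simp add: Av_iff pts_reverse_complement count_inv_reverse_complement del: One_nat_def)
  qed
qed

text \<open>
  An image of \<open>f\<close> in case (1) or (2) is never an image in case (3).
\<close>

lemma case12_of_map_f_eq:
  assumes p: "p \<in> AD n k" "case12 p" and q: "q \<in> AD n k" and eq: "map_f p = map_f q"
  shows "case12 q"
proof (rule ccontr)
  assume nq: "\<not> case12 q"
  let ?t = "reverse_complement q" and ?T = "pts (map_f p)"
  note gp = AD_indec_av(1-3)[OF p(1)] and gq = AD_indec_av(1-3)[OF q]
  have ct: "case12 ?t" by (rule AD_case3[OF q nq])
  have gt: "indec_av ?t" by (rule indec_av_reverse_complement[OF gq(1)])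
  have e: "expansion12 (pts p) ?T"
    using indec_av_f_first_or_one(3)[OF gp(1)] p(2) map_f_case12[OF gp(1) p(2)] by (simp add: case12_def)
  have ft: "is_perm (f_first_or_one ?t)" "expansion12 (pts ?t) (pts (f_first_or_one ?t))"
    using indec_av_f_first_or_one[OF gt] ct by (simp_all add: case12_def)
  define N where "N = int (length (f_first_or_one ?t)) + 1"
  have "?T = reflect N ` pts (f_first_or_one ?t)"
    using eq map_f_case3[OF gq(1) nq] ft(1) by (simp add: pts_reverse_complement N_def)
  then have "pts (f_first_or_one ?t) = reflect N ` ?T" by simp
  then have "expansion12 (pts ?t) (reflect N ` ?T)" using ft(2) by simp
  from expansion12_reflect[OF e this]
  have "left_split (reflect M ` pts ?t) \<or> left_split (prod.swap ` reflect M ` pts ?t)" for M .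
  moreover have "reflect (int (length q) + 1) ` pts ?t = pts q"
    using gq(1) unfolding indec_av_def by (simp add: pts_reverse_complement)
  ultimately show False using nq unfolding case12_def by metis
qed

lemma map_f_inj_on_AD: "inj_on map_f (AD n k)"
proof (rule inj_onI)
  fix p q assume pq: "p \<in> AD n k" "q \<in> AD n k" and eq: "map_f p = map_f q"
  note gp = AD_indec_av(1)[OF pq(1)] and gq = AD_indec_av(1)[OF pq(2)]
  show "p = q"
  proof (cases "case12 p")
    case True
    have "case12 q" by (rule case12_of_map_f_eq[OF pq(1) True pq(2) eq])
    then show ?thesis
      using f_first_or_one_inject[OF gp _ gq] True eq map_f_case12[OF gp True] map_f_case12[OF gq]
      unfolding case12_def by simp
  next
    case False
    have nq: "\<not> case12 q" using case12_of_map_f_eq[OF pq(2) _ pq(1) eq[symmetric]] False by blast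
    let ?p = "reverse_complement p" and ?q = "reverse_complement q"
    note g = indec_av_reverse_complement[OF gp] indec_av_reverse_complement[OF gq]
    have c: "case12 ?p" "case12 ?q" using AD_case3 pq False nq by blast+
    have perm: "is_perm (f_first_or_one ?p)" "is_perm (f_first_or_one ?q)"
      using indec_av_f_first_or_one(1) g c unfolding case12_def by blast+
    have "f_first_or_one ?p = f_first_or_one ?q"
      using arg_cong[OF eq, of reverse_complement] perm
      unfolding map_f_case3[OF gp False] map_f_case3[OF gq nq]
      by (simp add: reverse_complement_reverse_complement)
    then have "?p = ?q" using f_first_or_one_inject[OF g(1) _ g(2)] c unfolding case12_def by blast
    then have "reverse_complement ?p = reverse_complement ?q" by simp
    then show ?thesis using gp gq unfolding indec_av_def by (simp add: reverse_complement_reverse_complement)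
  qed
qed

section \<open>Monotonicity\<close>

lemma pivot_swap: "pivot r T \<Longrightarrow> pivot (prod.swap r) (prod.swap ` T)"
  unfolding pivot_def by (auto simp del: split_paired_Ex split_paired_All)

lemma pivot_reflect: "pivot r T \<Longrightarrow> pivot (reflect N r) (reflect N ` T)"
  unfolding pivot_def by (auto simp del: split_paired_Ex split_paired_All)

lemma expansion12_no_pivot:
  assumes "expansion12 S T" "\<not> splits S" shows "\<not> pivot r T"
proof
  assume pv: "pivot r T"
  show False
  proof (cases "expansion S T")
    case True
    then show False using expansion_no_pivot[OF True assms(2)] pv by blast
  next
    case False
    then have "expansion (prod.swap ` S) (prod.swap ` T)" using assms(1) unfolding expansion12_def by blast
    then have "\<not> pivot (prod.swap r) (prod.swap ` T)" by (rule expansion_no_pivot) (simp add: assms(2))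
    then show False using pivot_swap[OF pv] by blast
  qed
qed

lemma map_f_no_pivot:
  assumes p: "p \<in> AD n k" shows "\<not> pivot r (pts (map_f p))"
proof -
  note g = AD_indec_av(1)[OF p]
  have *: "is_perm (f_first_or_one q) \<and> \<not> pivot s (pts (f_first_or_one q))" if "indec_av q" "case12 q" for q s
  proof -
    have "\<not> splits (pts q)" using that(1) unfolding indec_av_def by blast
    then show ?thesis
      using indec_av_f_first_or_one(1,3)[OF that[unfolded case12_def]] expansion12_no_pivot by blast
  qed
  show ?thesis
  proof (cases "case12 p")
    case True
    then show ?thesis using *[OF g True] map_f_case12[OF g] by simp
  next
    case False
    note r = *[OF indec_av_reverse_complement[OF g] AD_case3[OF p False]]
    show ?thesis
    proof
      assume "pivot r (pts (map_f p))"
      then have "pivot (reflect N r) (reflect N ` pts (map_f p))" for N by (rule pivot_reflect)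
      moreover have "\<exists>N. reflect N ` pts (map_f p) = pts (f_first_or_one (reverse_complement p))"
        unfolding map_f_case3[OF g False] using r by (metis pts_reverse_complement reflect_image_image)
      ultimately show False using r by metis
    qed
  qed
qed

text \<open>
  The inserted summand 1 is a pivot, and a pivot cannot create an occurrence of 1324.
\<close>

lemma map_g_pivot:
  assumes p: "is_perm p" "decomposable p" "avoids1324 (pts p)"
  shows "avoids1324 (pts (map_g p))" "\<exists>r. pivot r (pts (map_g p))"
proof -
  obtain a b where a: "is_perm a" "a \<noteq> []" and b: "is_perm b" "b \<noteq> []"
    and ab: "p = a \<oplus> b" "map_g p = a \<oplus> ([1] \<oplus> b)"
    using map_g_direct_sum[OF p(2,3)] by metis
  let ?c = "length a" and ?q = "a \<oplus> ([1] \<oplus> b)"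
  let ?Q = "\<lambda>i. (int (Suc i), int (?q ! i))"
  have pq: "is_perm ?q" using a b is_perm_direct_sum is_perm_one by simp
  have mid: "?q ! ?c = ?c + 1" using a b by (simp add: direct_sum_nth)
  have lq: "length ?q = ?c + length b + 1" by simp
  have low: "?q ! i \<le> ?c" if "i < ?c" for i
    using is_perm_nth[OF a(1) that] that by (simp add: direct_sum_nth)
  have high: "?c + 1 < ?q ! i" if "?c < i" "i < ?c + length b + 1" for i
  proof -
    have l: "i - ?c - 1 < length b" using that by simp
    have "?q ! i = ?c + (1 + b ! (i - ?c - 1))" using that by (simp add: direct_sum_nth)
    then show ?thesis using is_perm_nth[OF b(1) l] by simp
  qed
  have cb: "0 < ?c" "0 < length b" using a b by simp_all
  have "pivot (?Q ?c) (pts ?q)"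
    unfolding pivot_def
  proof (intro conjI ballI impI)
    have Qin: "?Q i \<in> pts ?q" if "i < ?c + length b + 1" for i using that unfolding pts_def lq by blast
    show "?Q ?c \<in> pts ?q" by (rule Qin) simp
    show "\<exists>q\<in>pts ?q. sw q (?Q ?c)"
      by (rule bexI[OF _ Qin[of 0]]) (use low[of 0] cb mid in \<open>simp_all add: sw_def\<close>)
    show "\<exists>q\<in>pts ?q. sw (?Q ?c) q"
      by (rule bexI[OF _ Qin[of "?c + 1"]]) (use high[of "?c + 1"] cb mid in \<open>simp_all add: sw_def\<close>)
    fix q assume "q \<in> pts ?q" "q \<noteq> ?Q ?c"
    then obtain i where i: "i < ?c + length b + 1" "q = ?Q i" "i \<noteq> ?c" unfolding pts_def lq by blast
    then show "sw q (?Q ?c) \<or> sw (?Q ?c) q"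
      using low[of i] high[of i] mid by (cases "i < ?c") (simp_all add: sw_def)
  qed
  moreover have "avoids1324 (pts ?q - {?Q ?c})"
  proof -
    have "?q = a @ (?c + 1) # map (\<lambda>x. ?c + (1 + x)) b" by (simp add: direct_sum_def)
    then have "?q \<smallsetminus> (?c + 1) = map (dec (?c + 1)) (a @ map (\<lambda>x. ?c + (1 + x)) b)"
      using remove_value_append[of a "?c + 1" "map (\<lambda>x. ?c + (1 + x)) b"] pq by metis
    also have "\<dots> = a \<oplus> b"
    proof -
      have "map (dec (?c + 1)) a = a" by (rule map_idI) (use a in \<open>auto simp: dec_def is_perm_iff\<close>)
      moreover have "0 < x" if "x \<in> set b" for x using that b by (simp add: is_perm_iff)
      then have "map (dec (?c + 1)) (map (\<lambda>x. ?c + (1 + x)) b) = map (\<lambda>x. ?c + x) b"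
        by (auto simp: dec_def)
      ultimately show ?thesis by (simp add: direct_sum_def)
    qed
    finally have "?q \<smallsetminus> (?c + 1) = p" using ab by simp
    moreover have "order_iso (pts ?q - {?Q ?c}) (pts (?q \<smallsetminus> (?c + 1)))"
      unfolding mid by (rule remove_value_order_iso[OF pq]) (use cb mid in simp_all)
    ultimately show ?thesis using order_iso_imp(2) p(3) by metis
  qed
  ultimately show "avoids1324 (pts (map_g p))" "\<exists>r. pivot r (pts (map_g p))"
    unfolding ab(2) using pivot_avoids1324 by blast+
qed

lemma map_g_in_Av:
  assumes "p \<in> Av n k [1, 3, 2, 4]" "decomposable p"
  shows "map_g p \<in> Av (n + 1) k [1, 3, 2, 4]"
  using assms map_g_pivot(1)[of p] map_g_perm[of p] count_inv_map_g[of p]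
  by (simp add: Av_iff del: One_nat_def)

lemma finite_Av: "finite (Av n k t)"
  by (rule finite_subset[of _ "perms n"]) (auto simp: Av_def perms_def)

lemma Av_few_inversions:
  assumes p: "p \<in> Av n k [1, 3, 2, 4]" and k: "int k \<le> 2 * int n - 7"
  shows "decomposable p \<or> p \<in> AD n k"
proof (rule ccontr)
  assume no: "\<not> (decomposable p \<or> p \<in> AD n k)"
  have a: "is_perm p" "length p = n" "avoids1324 (pts p)" "count_inv p = k"
    using p by (simp_all add: Av_iff del: One_nat_def)
  have "p \<noteq> []" using k a(2) by auto
  then have "\<not> splits (pts p)" "\<And>e. extremal e (pts p) \<Longrightarrow> \<not> splits (pts p - {e})"
    using no a(1) p almost_decomposable_iff decomposable_iff_splits unfolding AD_def by blast+
  then have "2 * card (pts p) \<le> invs (pts p) + 6"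
    by (intro card_le_invs_of_indecomposable generic_pts a) simp_all
  moreover have "invs (pts p) = k"
    using a(4) card_inversions[of p] card_inversions_eq_count_inv[of p] by simp
  ultimately show False using k a(2) by simp
qed

theorem theorem3p5:
  shows "(\<forall>n k. map_f \<in> AD n k \<rightarrow> Av (n + 1) k [1, 3, 2, 4] \<and> inj_on map_f (AD n k)) \<and>
    (\<forall>n k. int k \<le> 2 * int n - 7 \<longrightarrow> av n k [1, 3, 2, 4] \<le> av (n + 1) k [1, 3, 2, 4])"
proof (intro conjI allI impI)
  fix n k
  show "map_f \<in> AD n k \<rightarrow> Av (n + 1) k [1, 3, 2, 4]" by (rule Pi_I) (rule map_f_in_Av)
  show "inj_on map_f (AD n k)" by (rule map_f_inj_on_AD)
next
  fix n k :: nat assume k: "int k \<le> 2 * int n - 7"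
  let ?A = "Av n k [1, 3, 2, 4]" and ?B = "Av (n + 1) k [1, 3, 2, 4]"
  define D where "D = {p \<in> ?A. decomposable p}"
  have fin: "finite ?A" "finite ?B" by (rule finite_Av)+
  have AD: "AD n k \<subseteq> ?A" unfolding AD_def by blast
  have fin': "finite D" "finite (AD n k)" using fin(1) AD finite_subset unfolding D_def by auto
  have "D \<inter> AD n k = {}" unfolding D_def AD_def almost_decomposable_def by blast
  moreover have A: "?A = D \<union> AD n k" using Av_few_inversions[OF _ k] AD unfolding D_def by blast
  ultimately have "card ?A = card D + card (AD n k)" using fin' by (simp add: card_Un_disjoint)
  also have "card D = card (map_g ` D)"
  proof (rule card_image[symmetric], rule inj_onI)
    fix p q assume "p \<in> D" "q \<in> D" "map_g p = map_g q"
    then show "p = q" using map_g_inject[of p q] unfolding D_def by (simp add: Av_iff del: One_nat_def)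
  qed
  also have "card (AD n k) = card (map_f ` AD n k)"
    by (rule card_image[symmetric]) (rule map_f_inj_on_AD)
  also have "card (map_g ` D) + card (map_f ` AD n k) = card (map_g ` D \<union> map_f ` AD n k)"
  proof (rule card_Un_disjoint[symmetric])
    show "map_g ` D \<inter> map_f ` AD n k = {}"
    proof (rule ccontr)
      assume "map_g ` D \<inter> map_f ` AD n k \<noteq> {}"
      then obtain p q where pq: "p \<in> D" "q \<in> AD n k" "map_g p = map_f q" by blast
      then have "is_perm p" "decomposable p" "avoids1324 (pts p)"
        unfolding D_def by (simp_all add: Av_iff del: One_nat_def)
      from map_g_pivot(2)[OF this] show False using map_f_no_pivot[OF pq(2)] pq(3) by metis
    qed
  qed (use fin' in simp_all)
  also have "\<dots> \<le> card ?B"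
    by (rule card_mono[OF fin(2)]) (use map_g_in_Av map_f_in_Av in \<open>auto simp: D_def simp del: One_nat_def\<close>)
  finally show "av n k [1, 3, 2, 4] \<le> av (n + 1) k [1, 3, 2, 4]" unfolding av_def .
qed

end
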